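(* Let $k$ be a field of characteristic zero, $R=k[x_0,\ldots,x_6]$, and let $$\mathcal{C}=\begin{pmatrix} x_0&x_1&x_2\\ x_2&x_3&x_4\\ x_4&x_5&x_6\end{pmatrix},\qquad \widetilde{\mathcal{C}}=\begin{pmatrix} x_0&x_1&x_2&x_3&x_4\\ x_2&x_3&x_4&x_5&x_6\end{pmatrix}.$$ Let $J\subset R$ be the gradient ideal of $\det\mathcal{C}$. Then: (a) Let $I:=I_2(\mathcal{C})\subset R$ and $P:=I_2(\widetilde{\mathcal{C}})\subset R$; then the minimal part of $J$ is the radical ideal $I=P\cap(I:P)=P\cap(x_0,x_2,x_4,x_6)$, and $Q:=(I:P)+P=(x_0,x_2,x_4,x_6,x_1x_5-x_3^2)$ is the only embedded prime of $R/J$. (b) The generators of $J$ (the seven partial derivatives of $\det\mathcal{C}$) are algebraically independent over $k$ and the syzygy matrix of $J$ has maximal linear rank. In particular, $\det\mathcal{C}$ is homaloidal.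
   Context: The gradient ideal of a polynomial is the ideal generated by all its partial derivatives. $I_t(M)$ denotes the ideal generated by the $t\times t$ minors of a matrix $M$. The minimal part of $J$ is the intersection of the primary components of $J$ associated to its minimal primes. For an ideal minimally generated by $n+1$ forms of the same degree $s$ in a standard graded polynomial ring, with syzygy matrix $\varphi$, the linear part of $\varphi$ consists of the syzygies on these generators whose coordinates are linear forms (i.e. of standard degree $s+1$); the syzygy matrix has maximal linear rank if the submodule generated by the linear syzygies has rank $n$ (the rank of the full syzygy module). Here $n=6$. A homogeneous polynomial $f\in k[x_0,\ldots,x_n]$ is homaloidal if its polar map $(\partial f/\partial x_0:\cdots:\partial f/\partial x_n):\mathbb{P}^n\dashrightarrow\mathbb{P}^n$ is birational. *)

theory Defs
  imports
    "HOL-Analysis.Analysis"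
    "HOL-Library.Poly_Mapping"
    "HOL-Library.Numeral_Type"
    "HOL-Computational_Algebra.Polynomial_Factorial"
    "HOL-Algebra.Algebraic_Closure_Type"
    "HOL-Algebra.QuotRing"
begin

section \<open>Polynomials\<close>

text \<open>
  For a finite index type \<open>'v\<close> this is the polynomial ring over \<open>'k\<close> with one variable per
  element of \<open>'v\<close>: an exponent vector is mapped to its coefficient, and the product of
  \<^theory>\<open>HOL-Library.Poly_Mapping\<close> is the convolution product.
\<close>

type_synonym ('v, 'k) mpoly = "('v \<Rightarrow>\<^sub>0 nat) \<Rightarrow>\<^sub>0 'k"

definition Const :: "'k::comm_ring_1 \<Rightarrow> ('v, 'k) mpoly" where
  "Const c = Poly_Mapping.single 0 c"

definition Var :: "'v \<Rightarrow> ('v, 'k::comm_ring_1) mpoly" where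
  "Var i = Poly_Mapping.single (Poly_Mapping.single i 1) 1"

text \<open>
  The exponent \<open>m - single i 1\<close> is truncated when \<open>i\<close> does not occur in \<open>m\<close>, but then the
  coefficient is zero.
\<close>

definition partial_deriv :: "'v \<Rightarrow> ('v, 'k::comm_ring_1) mpoly \<Rightarrow> ('v, 'k) mpoly" where
  "partial_deriv i f =
     (\<Sum>m\<in>Poly_Mapping.keys f.
        Poly_Mapping.single (m - Poly_Mapping.single i 1)
          (of_nat (Poly_Mapping.lookup m i) * Poly_Mapping.lookup f m))"

definition homogeneous :: "nat \<Rightarrow> ('v::finite, 'k::comm_ring_1) mpoly \<Rightarrow> bool" where
  "homogeneous d f \<longleftrightarrow>
     (\<forall>m\<in>Poly_Mapping.keys f. (\<Sum>i\<in>UNIV. Poly_Mapping.lookup m i) = d)"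

definition subst ::
  "('w::finite \<Rightarrow> ('v, 'k::comm_ring_1) mpoly) \<Rightarrow> ('w, 'k) mpoly \<Rightarrow> ('v, 'k) mpoly" where
  "subst F g =
     (\<Sum>m\<in>Poly_Mapping.keys g.
        Const (Poly_Mapping.lookup g m) * (\<Prod>i\<in>UNIV. F i ^ Poly_Mapping.lookup m i))"

definition algebraically_independent ::
  "('w::finite \<Rightarrow> ('v, 'k::comm_ring_1) mpoly) \<Rightarrow> bool" where
  "algebraically_independent F \<longleftrightarrow> (\<forall>g. subst F g = 0 \<longrightarrow> g = 0)"

section \<open>Ideals\<close>

definition radical :: "('a, 'b) ring_scheme \<Rightarrow> 'a set \<Rightarrow> 'a set" where
  "radical R I = {f \<in> carrier R. \<exists>n::nat. f [^]\<^bsub>R\<^esub> n \<in> I}"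

definition radical_ideal :: "('a, 'b) ring_scheme \<Rightarrow> 'a set \<Rightarrow> bool" where
  "radical_ideal R I \<longleftrightarrow> ideal I R \<and> radical R I = I"

definition colon_ideal :: "('a, 'b) ring_scheme \<Rightarrow> 'a set \<Rightarrow> 'a set \<Rightarrow> 'a set" where
  "colon_ideal R I K = {f \<in> carrier R. \<forall>g\<in>K. f \<otimes>\<^bsub>R\<^esub> g \<in> I}"

definition primary_ideal :: "('a, 'b) ring_scheme \<Rightarrow> 'a set \<Rightarrow> bool" where
  "primary_ideal R q \<longleftrightarrow> ideal q R \<and> q \<noteq> carrier R \<and>
     (\<forall>a\<in>carrier R. \<forall>b\<in>carrier R. a \<otimes>\<^bsub>R\<^esub> b \<in> q \<longrightarrow> a \<in> q \<or> b \<in> radical R q)"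

definition minimal_primes :: "('a, 'b) ring_scheme \<Rightarrow> 'a set \<Rightarrow> 'a set set" where
  "minimal_primes R J =
     {p. primeideal p R \<and> J \<subseteq> p \<and> (\<forall>q. primeideal q R \<and> J \<subseteq> q \<and> q \<subseteq> p \<longrightarrow> q = p)}"

text \<open>
  The associated primes of the module \<open>R/J\<close>: \<open>{r. r f \<in> J}\<close> is the annihilator of the class
  of \<open>f\<close>.
\<close>

definition associated_primes :: "('a, 'b) ring_scheme \<Rightarrow> 'a set \<Rightarrow> 'a set set" where
  "associated_primes R J =
     {p. primeideal p R \<and> (\<exists>f\<in>carrier R. p = {r \<in> carrier R. r \<otimes>\<^bsub>R\<^esub> f \<in> J})}"

definition embedded_primes :: "('a, 'b) ring_scheme \<Rightarrow> 'a set \<Rightarrow> 'a set set" where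
  "embedded_primes R J = associated_primes R J - minimal_primes R J"

definition irredundant_primary_decomposition ::
  "('a, 'b) ring_scheme \<Rightarrow> 'a set \<Rightarrow> 'a set set \<Rightarrow> bool" where
  "irredundant_primary_decomposition R J D \<longleftrightarrow>
     finite D \<and> (\<forall>q\<in>D. primary_ideal R q) \<and> J = carrier R \<inter> \<Inter>D \<and>
     inj_on (radical R) D \<and> (\<forall>q\<in>D. carrier R \<inter> \<Inter>(D - {q}) \<noteq> J)"

text \<open>
  By the uniqueness of the primary components belonging to minimal primes, the intersection
  below does not depend on \<open>D\<close>; a decomposition exists since the rings of interest are
  Noetherian.
\<close>

definition minimal_part :: "('a, 'b) ring_scheme \<Rightarrow> 'a set \<Rightarrow> 'a set" where
  "minimal_part R J =
     (THE M. \<exists>D. irredundant_primary_decomposition R J D \<and>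
        M = carrier R \<inter> \<Inter>{q \<in> D. radical R q \<in> minimal_primes R J})"

text \<open>
  The ideal generated by the minors of \<open>A\<close> of size \<open>CARD('t)\<close>. Rows and columns are selected in
  arbitrary order; reordering only changes the sign of a minor.
\<close>

definition minors_ideal :: "'t::finite itself \<Rightarrow> 'a::comm_ring_1 ^ 'n ^ 'm \<Rightarrow> 'a set" where
  "minors_ideal T A =
     Idl\<^bsub>ring_of_type_algebra\<^esub>
       {det (\<chi> i j. A $ r i $ c j) | (r :: 't \<Rightarrow> 'm) (c :: 't \<Rightarrow> 'n). inj r \<and> inj c}"

definition gradient_ideal :: "('v, 'k::comm_ring_1) mpoly \<Rightarrow> ('v, 'k) mpoly set" where
  "gradient_ideal f = Idl\<^bsub>ring_of_type_algebra\<^esub> (range (\<lambda>i. partial_deriv i f))"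

section \<open>Syzygies and linear rank\<close>

definition syzygies :: "('n::finite \<Rightarrow> 'a::comm_ring_1) \<Rightarrow> ('a ^ 'n) set" where
  "syzygies F = {s. (\<Sum>i\<in>UNIV. s $ i * F i) = 0}"

definition linear_syzygies ::
  "('n::finite \<Rightarrow> ('v::finite, 'k::comm_ring_1) mpoly) \<Rightarrow> (('v, 'k) mpoly ^ 'n) set" where
  "linear_syzygies F = {s \<in> syzygies F. \<forall>i. homogeneous 1 (s $ i)}"

text \<open>
  The rank of a submodule of a free module over a domain: the dimension of the vector space it
  spans over the field of fractions.
\<close>

definition module_rank :: "('a::idom ^ 'n) set \<Rightarrow> nat" where
  "module_rank M = vec.dim ((\<lambda>s. \<chi> i. to_fract (s $ i)) ` M)"

definition minimal_generators :: "('n \<Rightarrow> 'a::comm_ring_1) \<Rightarrow> bool" where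
  "minimal_generators F \<longleftrightarrow>
     (\<forall>i. Idl\<^bsub>ring_of_type_algebra\<^esub> (F ` (UNIV - {i})) \<noteq> Idl\<^bsub>ring_of_type_algebra\<^esub> (range F))"

text \<open>
  For \<open>n + 1 = CARD('n)\<close> forms of the same degree that minimally generate an ideal; their full
  syzygy module has rank \<open>n\<close>.
\<close>

definition maximal_linear_rank ::
  "('n::finite \<Rightarrow> ('v::{finite,linorder}, 'k::field) mpoly) \<Rightarrow> bool" where
  "maximal_linear_rank F \<longleftrightarrow>
     (\<exists>s. \<forall>i. homogeneous s (F i)) \<and> minimal_generators F \<and>
     module_rank (Modules.module.span (*s) (linear_syzygies F)) = CARD('n) - 1"

section \<open>Rational maps of projective space and homaloidal polynomials\<close>

text \<open>
  A rational map from the projective space with homogeneous coordinates indexed by \<open>'v\<close> to the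
  one with coordinates indexed by \<open>'w\<close> is represented by forms of the same degree, not all zero.
  Two representatives define the same map iff they are proportional over the field of fractions.
\<close>

definition rational_map :: "('w \<Rightarrow> ('v::finite, 'k::field) mpoly) \<Rightarrow> bool" where
  "rational_map F \<longleftrightarrow> (\<exists>d. \<forall>i. homogeneous d (F i)) \<and> (\<exists>i. F i \<noteq> 0)"

definition same_rational_map ::
  "('w \<Rightarrow> ('v::finite, 'k::field) mpoly) \<Rightarrow> ('w \<Rightarrow> ('v, 'k) mpoly) \<Rightarrow> bool" where
  "same_rational_map F G \<longleftrightarrow>
     rational_map F \<and> rational_map G \<and> (\<forall>i j. F i * G j = F j * G i)"

text \<open>
  Birational means having a rational inverse. That the composites are defined (not all
  coordinates vanish) is part of \<^const>\<open>same_rational_map\<close>; \<^const>\<open>Var\<close> represents the identity.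
\<close>

definition birational_map :: "('v::finite \<Rightarrow> ('v, 'k::field) mpoly) \<Rightarrow> bool" where
  "birational_map F \<longleftrightarrow> rational_map F \<and>
     (\<exists>G. rational_map G \<and>
        same_rational_map (\<lambda>i. subst F (G i)) Var \<and>
        same_rational_map (\<lambda>i. subst G (F i)) Var)"

definition homaloidal :: "('v::finite, 'k::field) mpoly \<Rightarrow> bool" where
  "homaloidal f \<longleftrightarrow> (\<exists>d. homogeneous d f) \<and> birational_map (\<lambda>i. partial_deriv i f)"

end

theory Submission
  imports Defs
begin

text \<open>
  Write \<open>f\<^sub>0, \<dots>, f\<^sub>6\<close> for the partial derivatives of the determinant, \<open>m = (x\<^sub>0, x\<^sub>2, x\<^sub>4, x\<^sub>6)\<close>
  for the ideal of the even variables and \<open>q = x\<^sub>1 x\<^sub>5 - x\<^sub>3\<^sup>2\<close>. Both \<open>I\<close> and \<open>P\<close> are generated by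
  explicit quadrics, and \<open>P = I + (q)\<close>. The ideal \<open>m\<close> is the kernel of the retraction
  \<open>odd_part\<close> onto \<open>k[x\<^sub>1, x\<^sub>3, x\<^sub>5]\<close>, and \<open>P\<close> is the kernel of the monomial parametrisation of
  a rational normal scroll (\<open>scroll_ideal_iff\<close>, by rewriting monomials to a normal form), so both are
  prime. As \<open>m q \<subseteq> I \<subseteq> m\<close> and \<open>q \<notin> m\<close>, this gives \<open>I = P \<inter> m\<close>, \<open>I : P = m\<close> and
  \<open>Q = m + P = m + (q)\<close>; the last ideal is prime because \<open>P\<close> meets \<open>k[x\<^sub>1, x\<^sub>3, x\<^sub>5]\<close> in \<open>(q)\<close>.

  Modulo \<open>J\<close> the ideal \<open>I\<close> is generated by two quadrics \<open>a\<close> and \<open>b\<close> (\<open>gen_a\<close>, \<open>gen_b\<close>), and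
  \<open>Q I \<subseteq> J\<close>. To see that nothing larger kills an element of \<open>I\<close> outside \<open>J\<close>, a third component is
  needed. To first order in the even variables, \<open>f\<^sub>2 = f\<^sub>4 = f\<^sub>6 = 0\<close> has a solution that is
  linear in a parameter \<open>z\<close>, with coefficients in \<open>k[x\<^sub>1, x\<^sub>3, x\<^sub>5]\<close>, and there \<open>f\<^sub>0\<close> becomes
  \<open>- q\<^sup>2 z\<close>. The preimage of \<open>(q\<^sup>2, z\<^sup>2)\<close> under this substitution is a \<open>Q\<close>-primary ideal
  \<open>K\<close> (\<open>embedded_component\<close>) with \<open>I \<inter> K = J\<close> (\<open>minors_Int_component\<close>). So
  \<open>J = P \<inter> m \<inter> K\<close> is an irredundant primary decomposition, from which the minimal part and the
  embedded prime are read off.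

  For the second half, the determinant is linear in \<open>x\<^sub>1, x\<^sub>3, x\<^sub>5\<close>, and its coefficients there are,
  up to sign, those of the Hessian of the binary cubic with coefficients \<open>x\<^sub>0, 3 x\<^sub>2, 3 x\<^sub>4, x\<^sub>6\<close>.
  There are six linear syzygies of \<open>f\<^sub>0, \<dots>, f\<^sub>6\<close> which are independent because the discriminant of this
  cubic does not vanish identically. Read the other way round, they are six equations for \<open>x\<close> which are linear
  in \<open>x\<close> and in the values \<open>y\<close> of the \<open>f\<^sub>i\<close>. A solution of degree six in \<open>y\<close>
  (\<open>polar_inverse\<close>) inverts the polar map: one composite is \<open>h(y) y\<close> by a direct computation
  (\<open>polar_polar_inverse\<close>), the other one is proportional to \<open>x\<close> since for general \<open>y\<close> the solutions form a
  line (\<open>related_proportional\<close>). Finally a relation \<open>g(f\<^sub>0, \<dots>, f\<^sub>6) = 0\<close> becomes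
  \<open>g(h y) = 0\<close> after inserting the inverse, which forces \<open>g = 0\<close> as the homogeneous parts of \<open>g\<close> end
  up in different degrees (\<open>subst_scaled_eq_0\<close>).
\<close>

section \<open>Ideals of a commutative ring\<close>

abbreviation type_ring :: "'a::comm_ring_1 ring" where
  "type_ring \<equiv> ring_of_type_algebra"

abbreviation idl :: "'a::comm_ring_1 set \<Rightarrow> 'a set" where
  "idl S \<equiv> Idl\<^bsub>type_ring\<^esub> S"

lemma type_ring_simps [simp]:
  "carrier (type_ring :: 'a::comm_ring_1 ring) = UNIV"
  "a \<otimes>\<^bsub>type_ring\<^esub> b = a * (b::'a::comm_ring_1)"
  "a \<oplus>\<^bsub>type_ring\<^esub> b = a + (b::'a)"
  "\<one>\<^bsub>type_ring\<^esub> = (1::'a)"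
  "\<zero>\<^bsub>type_ring\<^esub> = (0::'a)"
  by (simp_all add: ring_of_type_algebra_def)

lemma type_ring_power [simp]: "a [^]\<^bsub>type_ring\<^esub> (n::nat) = (a::'a::comm_ring_1) ^ n"
proof -
  interpret cring "type_ring :: 'a ring" ..
  show ?thesis
    by (induction n) (simp_all add: mult.commute)
qed

lemma ideal_iff:
  "ideal I (type_ring :: 'a::comm_ring_1 ring) \<longleftrightarrow>
     0 \<in> I \<and> (\<forall>a\<in>I. \<forall>b\<in>I. a + b \<in> I) \<and> (\<forall>r. \<forall>a\<in>I. r * a \<in> I)" (is "?l = ?r")
proof
  assume ?l
  then interpret ideal I "type_ring :: 'a ring" .
  show ?r
    using additive_subgroup.zero_closed[OF is_additive_subgroup]
      additive_subgroup.a_closed[OF is_additive_subgroup] I_l_closed by auto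
next
  assume r: ?r
  interpret cring "type_ring :: 'a ring" ..
  have minus: "- a \<in> I" if "a \<in> I" for a
    using r that by (metis mult_minus1)
  have ainv: "\<ominus>\<^bsub>type_ring\<^esub> a = - a" for a :: 'a
    using minus_equality[of "- a" a] by simp
  show ?l
  proof (rule idealI)
    show "Ring.ring (type_ring :: 'a ring)" ..
    show "subgroup I (add_monoid (type_ring :: 'a ring))"
      using r minus by (intro add.subgroupI) (auto simp: ainv a_inv_def[symmetric])
    show "a \<otimes>\<^bsub>type_ring\<^esub> x \<in> I" if "a \<in> I" for a x
      using r that by (simp add: mult.commute[of a])
  qed (use r in auto)
qed

lemma idealD:
  assumes "ideal I (type_ring :: 'a::comm_ring_1 ring)"
  shows ideal_0: "0 \<in> I"
    and ideal_add: "a \<in> I \<Longrightarrow> b \<in> I \<Longrightarrow> a + b \<in> I"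
    and ideal_mult: "a \<in> I \<Longrightarrow> r * a \<in> I"
    and ideal_mult_right: "a \<in> I \<Longrightarrow> a * r \<in> I"
    and ideal_uminus: "a \<in> I \<Longrightarrow> - a \<in> I"
    and ideal_diff: "a \<in> I \<Longrightarrow> b \<in> I \<Longrightarrow> a - b \<in> I"
proof -
  note * = assms[unfolded ideal_iff]
  show "0 \<in> I" "a \<in> I \<Longrightarrow> b \<in> I \<Longrightarrow> a + b \<in> I" "a \<in> I \<Longrightarrow> r * a \<in> I"
    using * by auto
  show "a \<in> I \<Longrightarrow> a * r \<in> I"
    using * by (simp add: mult.commute[of a])
  show un: "a \<in> I \<Longrightarrow> - a \<in> I" for a
    using * by (metis mult_minus1)
  show "a \<in> I \<Longrightarrow> b \<in> I \<Longrightarrow> a - b \<in> I"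
    using * un by (metis add_uminus_conv_diff)
qed

lemma ideal_sum:
  assumes "ideal I (type_ring :: 'a::comm_ring_1 ring)" "\<And>i. i \<in> A \<Longrightarrow> f i \<in> I"
  shows "sum f A \<in> I"
  using assms(2) by (induction A rule: infinite_finite_induct) (auto intro: idealD[OF assms(1)])

lemma ideal_cong:
  assumes "ideal I (type_ring :: 'a::comm_ring_1 ring)" "a - b \<in> I"
  shows "a \<in> I \<longleftrightarrow> b \<in> I"
  using ideal_add[OF assms(1), of "a - b" b] ideal_diff[OF assms(1), of a "a - b"] assms(2) by auto

lemma ideal_idl [simp, intro]: "ideal (idl S) type_ring"
proof -
  interpret cring "type_ring :: 'a ring" ..
  show ?thesis by (rule genideal_ideal) simp
qed

lemma idl_superset: "S \<subseteq> idl S"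
proof -
  interpret cring "type_ring :: 'a ring" ..
  show ?thesis by (rule genideal_self) simp
qed

lemma idl_base: "a \<in> S \<Longrightarrow> a \<in> idl S"
  using idl_superset by blast

lemma idl_minimal: "ideal I type_ring \<Longrightarrow> S \<subseteq> I \<Longrightarrow> idl S \<subseteq> I"
proof -
  interpret cring "type_ring :: 'a ring" ..
  show "ideal I type_ring \<Longrightarrow> S \<subseteq> I \<Longrightarrow> idl S \<subseteq> I" by (rule genideal_minimal)
qed

lemma idl_eqI:
  assumes "\<And>a. a \<in> S \<Longrightarrow> a \<in> idl T" "\<And>a. a \<in> T \<Longrightarrow> a \<in> idl S"
  shows "idl S = idl T"
  using assms by (intro equalityI idl_minimal) auto

lemma idl_insertE:
  assumes "x \<in> idl (insert a S)"
  obtains r s where "s \<in> idl S" "x = r * a + s"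
proof -
  let ?M = "{x. \<exists>r. \<exists>s\<in>idl S. x = r * a + s}"
  have "ideal ?M type_ring"
    unfolding ideal_iff
  proof (intro conjI ballI allI)
    show "0 \<in> ?M"
      using ideal_0[OF ideal_idl] by (auto intro!: exI[of _ 0] bexI[of _ 0])
  next
    fix x y assume "x \<in> ?M" "y \<in> ?M"
    then obtain r s r' s' where "s \<in> idl S" "s' \<in> idl S" "x = r * a + s" "y = r' * a + s'" by blast
    then show "x + y \<in> ?M"
      by (auto intro!: exI[of _ "r + r'"] bexI[of _ "s + s'"] ideal_add simp: algebra_simps)
  next
    fix t x assume "x \<in> ?M"
    then obtain r s where "s \<in> idl S" "x = r * a + s" by blast
    then show "t * x \<in> ?M"
      by (auto intro!: exI[of _ "t * r"] bexI[of _ "t * s"] ideal_mult simp: algebra_simps)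
  qed
  moreover have "insert a S \<subseteq> ?M"
  proof
    fix x assume "x \<in> insert a S"
    then show "x \<in> ?M"
    proof
      assume "x = a"
      then show ?thesis
        using ideal_0[OF ideal_idl] by (auto intro!: exI[of _ 1] bexI[of _ 0])
    next
      assume "x \<in> S"
      then show ?thesis
        using idl_base by (auto intro!: exI[of _ 0] bexI[of _ x])
    qed
  qed
  ultimately have "x \<in> ?M"
    using idl_minimal assms by blast
  then show ?thesis using that by blast
qed

lemma idl_empty [simp]: "idl {} = ({0} :: 'a::comm_ring_1 set)"
proof -
  have "ideal ({0} :: 'a set) type_ring" by (simp add: ideal_iff)
  then have "idl {} \<subseteq> ({0} :: 'a set)" by (rule idl_minimal) simp
  then show ?thesis using ideal_0[OF ideal_idl] by blast
qed

lemma prime_iff: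
  "primeideal p (type_ring :: 'a::comm_ring_1 ring) \<longleftrightarrow>
     ideal p type_ring \<and> 1 \<notin> p \<and> (\<forall>a b. a * b \<in> p \<longrightarrow> a \<in> p \<or> b \<in> p)" (is "?l = ?r")
proof
  assume ?l
  then interpret primeideal p "type_ring :: 'a ring" .
  show ?r
    using I_notcarr I_prime one_imp_carrier is_ideal by auto
next
  assume ?r
  then show ?l
    by (intro primeidealI) auto
qed

lemma primeD:
  assumes "primeideal p (type_ring :: 'a::comm_ring_1 ring)"
  shows prime_is_ideal: "ideal p type_ring"
    and prime_proper: "1 \<notin> p"
    and prime_mult: "a * b \<in> p \<Longrightarrow> a \<in> p \<or> b \<in> p"
    and prime_power: "a ^ n \<in> p \<Longrightarrow> a \<in> p"
proof -
  note * = assms[unfolded prime_iff]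
  then show "ideal p type_ring" "1 \<notin> p" "a * b \<in> p \<Longrightarrow> a \<in> p \<or> b \<in> p" by auto
  show "a ^ n \<in> p \<Longrightarrow> a \<in> p"
    using * by (induction n) auto
qed

lemma prime_Int_subset:
  assumes "primeideal p (type_ring :: 'a::comm_ring_1 ring)" "ideal I type_ring" "ideal K type_ring"
    "I \<inter> K \<subseteq> p"
  shows "I \<subseteq> p \<or> K \<subseteq> p"
proof (rule ccontr)
  assume "\<not> ?thesis"
  then obtain a b where "a \<in> I" "a \<notin> p" "b \<in> K" "b \<notin> p" by blast
  moreover have "a * b \<in> I \<inter> K"
    using calculation assms(2,3) by (simp add: ideal_mult ideal_mult_right)
  ultimately show False
    using assms(4) prime_mult[OF assms(1)] by blast
qed

lemma prime_Inter_subset: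
  assumes p: "primeideal p (type_ring :: 'a::comm_ring_1 ring)"
    and "finite D" "\<And>q. q \<in> D \<Longrightarrow> ideal q type_ring" "\<Inter>D \<subseteq> p"
  shows "\<exists>q\<in>D. q \<subseteq> p"
  using assms(2-)
proof (induction D rule: finite_induct)
  case empty
  then show ?case using prime_proper[OF p] by auto
next
  case (insert q D)
  have "ideal (\<Inter>D) type_ring"
    using insert.prems(1) by (auto simp: ideal_iff)
  then show ?case
    using prime_Int_subset[OF p, of q "\<Inter>D"] insert by auto
qed

lemma prime_subset_radical:
  assumes "primeideal p (type_ring :: 'a::comm_ring_1 ring)"
  shows "radical type_ring q \<subseteq> p \<longleftrightarrow> q \<subseteq> p"
proof
  assume "radical type_ring q \<subseteq> p"
  moreover have "q \<subseteq> radical type_ring q"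
    by (auto simp: radical_def intro: exI[of _ 1])
  ultimately show "q \<subseteq> p" by blast
next
  assume "q \<subseteq> p"
  then show "radical type_ring q \<subseteq> p"
    using prime_power[OF assms] by (auto simp: radical_def)
qed

lemma radical_prime:
  assumes "primeideal p (type_ring :: 'a::comm_ring_1 ring)"
  shows "radical type_ring p = p"
  using prime_power[OF assms] by (auto simp: radical_def intro: exI[of _ 1])

lemma primary_ideal_prime:
  assumes "primeideal p (type_ring :: 'a::comm_ring_1 ring)"
  shows "primary_ideal type_ring p"
  using assms radical_prime[OF assms] unfolding primary_ideal_def prime_iff by auto

lemma prime_radical_primary:
  assumes "primary_ideal (type_ring :: 'a::comm_ring_1 ring) q"
  shows "primeideal (radical type_ring q) type_ring"
proof -
  have q: "ideal q type_ring" and q1: "q \<noteq> UNIV"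
    and mult: "\<And>a b. a * b \<in> q \<Longrightarrow> a \<in> q \<or> b \<in> radical type_ring q"
    using assms by (auto simp: primary_ideal_def)
  show ?thesis
    unfolding prime_iff
  proof (intro conjI allI impI)
    show "ideal (radical type_ring q) type_ring"
      unfolding ideal_iff
    proof (intro conjI ballI allI)
      show "0 \<in> radical type_ring q"
        using ideal_0[OF q] by (auto simp: radical_def intro: exI[of _ 1])
    next
      fix a b assume "a \<in> radical type_ring q" "b \<in> radical type_ring q"
      then obtain m n where m: "a ^ m \<in> q" and n: "b ^ n \<in> q" by (auto simp: radical_def)
      \<comment> \<open>In each term of the binomial expansion one of the two exponents is large enough.\<close>
      have "of_nat (m + n choose k) * a ^ k * b ^ (m + n - k) \<in> q" for k
      proof (cases "m \<le> k")
        case True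
        then have "a ^ k = a ^ (k - m) * a ^ m" by (simp flip: power_add)
        then show ?thesis using m q by (simp add: ideal_mult ideal_mult_right mult.assoc)
      next
        case False
        then have "b ^ (m + n - k) = b ^ (m - k) * b ^ n" by (simp flip: power_add)
        then show ?thesis using n q by (simp add: ideal_mult ideal_mult_right)
      qed
      then have "(a + b) ^ (m + n) \<in> q"
        unfolding binomial_ring by (intro ideal_sum q)
      then show "a + b \<in> radical type_ring q" by (auto simp: radical_def)
    next
      fix r a assume "a \<in> radical type_ring q"
      then show "r * a \<in> radical type_ring q"
        using ideal_mult[OF q] by (auto simp: radical_def power_mult_distrib)
    qed
    show "1 \<notin> radical type_ring q"
      using q q1 ideal_mult_right[OF q, of 1] by (auto simp: radical_def)
  next
    fix a b assume "a * b \<in> radical type_ring q"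
    then obtain n where n: "a ^ n * b ^ n \<in> q" by (auto simp: radical_def power_mult_distrib)
    show "a \<in> radical type_ring q \<or> b \<in> radical type_ring q"
      using mult[OF n] by (auto simp: radical_def simp flip: power_mult)
  qed
qed

text \<open>
  The component belonging to a minimal prime \<open>p\<close> is the contraction of the localisation of \<open>J\<close> at
  \<open>p\<close>, hence determined by \<open>J\<close>: no other radical of a component lies in \<open>p\<close>, so that
  some \<open>s\<close> outside \<open>p\<close> is in all the other components.
\<close>

lemma primary_component_eq:
  fixes J :: "'a::comm_ring_1 set"
  assumes D: "irredundant_primary_decomposition type_ring J D"
    and p: "p \<in> minimal_primes type_ring J" and q: "q \<in> D" "radical type_ring q = p"
  shows "q = {f. \<exists>s. s \<notin> p \<and> s * f \<in> J}"
proof (intro equalityI subsetI)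
  have fin: "finite D" and prim: "\<And>q. q \<in> D \<Longrightarrow> primary_ideal type_ring q" and J: "J = \<Inter>D"
    and inj: "inj_on (radical type_ring) D"
    using D by (auto simp: irredundant_primary_decomposition_def)
  have id: "ideal q type_ring" if "q \<in> D" for q using prim[OF that] by (simp add: primary_ideal_def)
  have pp: "primeideal p type_ring" and
    pmin: "\<And>p'. primeideal p' type_ring \<Longrightarrow> J \<subseteq> p' \<Longrightarrow> p' \<subseteq> p \<Longrightarrow> p' = p"
    using p by (auto simp: minimal_primes_def)
  fix f
  {
    assume f: "f \<in> q"
    have "\<not> \<Inter>(D - {q}) \<subseteq> p"
    proof
      assume "\<Inter>(D - {q}) \<subseteq> p"
      then obtain q' where q': "q' \<in> D" "q' \<noteq> q" "q' \<subseteq> p"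
        using prime_Inter_subset[OF pp, of "D - {q}"] fin id by auto
      then have "radical type_ring q' \<subseteq> p" using prime_subset_radical[OF pp] by blast
      moreover have "J \<subseteq> radical type_ring q'"
        using q' J prime_subset_radical[OF prime_radical_primary[OF prim[OF q'(1)]]] by blast
      ultimately have "radical type_ring q' = p"
        using pmin prime_radical_primary[OF prim[OF q'(1)]] by blast
      then show False using q q' inj by (auto dest: inj_onD)
    qed
    then obtain s where s: "s \<notin> p" "\<And>q'. q' \<in> D \<Longrightarrow> q' \<noteq> q \<Longrightarrow> s \<in> q'" by blast
    have "s * f \<in> q'" if "q' \<in> D" for q'
      using f s(2)[OF that] id[OF that]
      by (cases "q' = q") (auto intro: ideal_mult ideal_mult_right)
    then show "f \<in> {f. \<exists>s. s \<notin> p \<and> s * f \<in> J}" using s(1) J by auto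
  }
  assume "f \<in> {f. \<exists>s. s \<notin> p \<and> s * f \<in> J}"
  then obtain s where "s \<notin> p" "f * s \<in> q" using q(1) J by (auto simp: mult.commute)
  then show "f \<in> q"
    using prim[OF q(1)] q(2) by (auto simp: primary_ideal_def)
qed

text \<open>
  Each minimal prime is the radical of exactly one component, and this component is known
  from the previous lemma. Hence the choice of the decomposition is irrelevant.
\<close>

lemma minimal_part_eq:
  fixes J :: "'a::comm_ring_1 set"
  assumes D: "irredundant_primary_decomposition type_ring J D"
  shows "minimal_part type_ring J = \<Inter>{q \<in> D. radical type_ring q \<in> minimal_primes type_ring J}"
proof -
  let ?comp = "\<lambda>p. {f. \<exists>s. s \<notin> p \<and> s * f \<in> J}"
  have eq: "\<Inter>{q \<in> D. radical type_ring q \<in> minimal_primes type_ring J} =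
      \<Inter>(?comp ` minimal_primes type_ring J)"
    if D: "irredundant_primary_decomposition type_ring J D" for D
  proof -
    have fin: "finite D" and prim: "\<And>q. q \<in> D \<Longrightarrow> primary_ideal type_ring q" and J: "J = \<Inter>D"
      using D by (auto simp: irredundant_primary_decomposition_def)
    have id: "ideal q type_ring" if "q \<in> D" for q using prim[OF that] by (simp add: primary_ideal_def)
    have ex: "\<exists>q\<in>D. radical type_ring q = p" if "p \<in> minimal_primes type_ring J" for p
    proof -
      have pp: "primeideal p type_ring" and "J \<subseteq> p" and
        pmin: "\<And>p'. primeideal p' type_ring \<Longrightarrow> J \<subseteq> p' \<Longrightarrow> p' \<subseteq> p \<Longrightarrow> p' = p"
        using that by (auto simp: minimal_primes_def)
      then obtain q where q: "q \<in> D" "q \<subseteq> p"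
        using prime_Inter_subset[OF pp fin id] J by blast
      have "J \<subseteq> radical type_ring q"
        using q J prime_subset_radical[OF prime_radical_primary[OF prim[OF q(1)]]] by blast
      then show ?thesis
        using pmin[OF prime_radical_primary[OF prim[OF q(1)]]] prime_subset_radical[OF pp] q by blast
    qed
    have "{q \<in> D. radical type_ring q \<in> minimal_primes type_ring J} = ?comp ` minimal_primes type_ring J"
    proof (intro equalityI subsetI)
      fix q assume "q \<in> {q \<in> D. radical type_ring q \<in> minimal_primes type_ring J}"
      then show "q \<in> ?comp ` minimal_primes type_ring J"
        using primary_component_eq[OF D _ _ refl, of q] by blast
    next
      fix q assume "q \<in> ?comp ` minimal_primes type_ring J"
      then obtain p where p: "p \<in> minimal_primes type_ring J" "q = ?comp p" by blast
      obtain q' where q': "q' \<in> D" "radical type_ring q' = p" using ex[OF p(1)] by blast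
      have "q' = q" using primary_component_eq[OF D p(1) q'] p(2) by simp
      then show "q \<in> {q \<in> D. radical type_ring q \<in> minimal_primes type_ring J}"
        using q' p(1) by simp
    qed
    then show ?thesis by simp
  qed
  show ?thesis
    unfolding minimal_part_def
  proof (rule the_equality)
    show "\<exists>D'. irredundant_primary_decomposition type_ring J D' \<and>
        \<Inter>{q \<in> D. radical type_ring q \<in> minimal_primes type_ring J} =
        carrier type_ring \<inter> \<Inter>{q \<in> D'. radical type_ring q \<in> minimal_primes type_ring J}"
      using D by auto
  next
    fix M
    assume "\<exists>D'. irredundant_primary_decomposition type_ring J D' \<and>
        M = carrier type_ring \<inter> \<Inter>{q \<in> D'. radical type_ring q \<in> minimal_primes type_ring J}"
    then show "M = \<Inter>{q \<in> D. radical type_ring q \<in> minimal_primes type_ring J}"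
      unfolding eq[OF D] using eq by auto
  qed
qed

section \<open>Polynomials: induction, substitution and derivatives\<close>

lemma poly_mapping_sum_single:
  fixes g :: "'b \<Rightarrow>\<^sub>0 'k::comm_monoid_add"
  shows "g = (\<Sum>m\<in>Poly_Mapping.keys g. Poly_Mapping.single m (Poly_Mapping.lookup g m))"
proof (rule poly_mapping_eqI)
  fix k
  show "Poly_Mapping.lookup g k =
      Poly_Mapping.lookup (\<Sum>m\<in>Poly_Mapping.keys g. Poly_Mapping.single m (Poly_Mapping.lookup g m)) k"
    by (cases "k \<in> Poly_Mapping.keys g")
      (auto simp: lookup_sum lookup_single when_def sum.delta in_keys_iff)
qed

lemma poly_mapping_single_induct [case_names zero single add]:
  fixes g :: "'b \<Rightarrow>\<^sub>0 'k::comm_monoid_add"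
  assumes "Q 0" "\<And>m c. Q (Poly_Mapping.single m c)" "\<And>f g. Q f \<Longrightarrow> Q g \<Longrightarrow> Q (f + g)"
  shows "Q g"
proof -
  have "Q (\<Sum>m\<in>A. Poly_Mapping.single m (Poly_Mapping.lookup g m))" for A
    by (induction A rule: infinite_finite_induct) (auto intro: assms)
  then show ?thesis using poly_mapping_sum_single[of g] by metis
qed

lemma Const_simps:
  "Const 0 = (0 :: ('v, 'k::comm_ring_1) mpoly)"
  "Const 1 = (1 :: ('v, 'k) mpoly)"
  "Const (a + b) = (Const a + Const b :: ('v, 'k) mpoly)"
  "Const (a * b) = (Const a * Const b :: ('v, 'k) mpoly)"
  by (simp_all add: Const_def single_add mult_single)

definition monom_value :: "('w::finite \<Rightarrow> 'a::comm_ring_1) \<Rightarrow> ('w \<Rightarrow>\<^sub>0 nat) \<Rightarrow> 'a" where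
  "monom_value F m = (\<Prod>i\<in>UNIV. F i ^ Poly_Mapping.lookup m i)"

lemma monom_value_0 [simp]: "monom_value F 0 = 1"
  by (simp add: monom_value_def)

lemma monom_value_add: "monom_value F (m + n) = monom_value F m * monom_value F n"
  by (simp add: monom_value_def lookup_add power_add prod.distrib)

lemma monom_value_single: "monom_value F (Poly_Mapping.single i k) = F i ^ k"
proof -
  have "monom_value F (Poly_Mapping.single i k) = (\<Prod>j\<in>UNIV. if j = i then F i ^ k else 1)"
    unfolding monom_value_def by (rule prod.cong) (auto simp: lookup_single when_def)
  then show ?thesis by simp
qed

lemma subst_superset:
  assumes "finite A" "Poly_Mapping.keys g \<subseteq> A"
  shows "subst F g = (\<Sum>m\<in>A. Const (Poly_Mapping.lookup g m) * monom_value F m)"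
  unfolding subst_def monom_value_def[symmetric]
  using assms by (intro sum.mono_neutral_left) (auto simp: in_keys_iff Const_simps)

lemma subst_0 [simp]: "subst F 0 = 0"
  by (simp add: subst_def)

lemma subst_add [simp]: "subst F (f + g) = subst F f + subst F g"
proof -
  let ?A = "Poly_Mapping.keys f \<union> Poly_Mapping.keys g"
  have "Poly_Mapping.keys (f + g) \<subseteq> ?A" by (rule Poly_Mapping.keys_add)
  then show ?thesis
    by (simp add: subst_superset[of ?A] lookup_add Const_simps sum.distrib distrib_right)
qed

lemma subst_single: "subst F (Poly_Mapping.single m c) = Const c * monom_value F m"
  by (subst subst_superset[of "{m}"]) auto

lemma subst_mult [simp]: "subst F (f * g) = subst F f * subst F g"
proof (induction f rule: poly_mapping_single_induct)
  case (single m c)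
  show ?case
  proof (induction g rule: poly_mapping_single_induct)
    case (single n d)
    show ?case
      by (simp add: mult_single subst_single monom_value_add Const_simps ac_simps)
  qed (simp_all add: distrib_left)
qed (simp_all add: distrib_right)

lemma subst_Const [simp]: "subst F (Const c) = Const c"
  by (simp add: Const_def[of c] subst_single)

lemma subst_1 [simp]: "subst F 1 = 1"
  using subst_Const[of F 1] by (simp add: Const_simps)

lemma subst_Var [simp]: "subst F (Var i) = F i"
  by (simp add: Var_def subst_single monom_value_single Const_simps)

lemma subst_uminus [simp]: "subst F (- f) = - subst F f"
  using subst_add[of F f "- f"] by (simp add: add_eq_0_iff)

lemma subst_diff [simp]: "subst F (f - g) = subst F f - subst F g"
  using subst_add[of F f "- g"] by simp

lemma subst_power [simp]: "subst F (f ^ n) = subst F f ^ n"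
  by (induction n) simp_all

lemma Const_numeral: "Const (numeral n) = (numeral n :: ('v, 'k::comm_ring_1) mpoly)"
  by (simp add: Const_def)

lemma subst_numeral [simp]: "subst F (numeral n) = numeral n"
  using subst_Const[of F "numeral n"] by (simp add: Const_numeral)

lemma subst_sum [simp]: "subst F (sum f A) = (\<Sum>i\<in>A. subst F (f i))"
  by (induction A rule: infinite_finite_induct) simp_all

lemma single_eq_monom_value:
  fixes m :: "'v::finite \<Rightarrow>\<^sub>0 nat" and c :: "'k::comm_ring_1"
  shows "Poly_Mapping.single m c = Const c * monom_value Var m"
proof -
  have prod: "(\<Prod>i\<in>A. (Var i :: ('v, 'k) mpoly) ^ Poly_Mapping.lookup m i) =
      Poly_Mapping.single (\<Sum>i\<in>A. Poly_Mapping.single i (Poly_Mapping.lookup m i)) 1" for A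
  proof (induction A rule: infinite_finite_induct)
    case (insert i A)
    have "(Var i :: ('v, 'k) mpoly) ^ n = Poly_Mapping.single (Poly_Mapping.single i n) 1" for n
      by (induction n) (simp_all add: Var_def mult_single flip: single_add)
    then show ?case using insert by (simp add: mult_single)
  qed simp_all
  have "(\<Sum>i\<in>UNIV. Poly_Mapping.single i (Poly_Mapping.lookup m i)) = m"
    by (rule poly_mapping_eqI) (simp add: lookup_sum lookup_single when_def sum.delta)
  then show ?thesis
    using prod[of UNIV] by (simp add: monom_value_def Const_def mult_single)
qed

text \<open>
  In this form the induction applies to ring homomorphisms, which are determined by the images of constants and
  variables.
\<close>

lemma mpoly_induct [case_names Const Var add mult]:
  fixes g :: "('v::finite, 'k::comm_ring_1) mpoly"
  assumes "\<And>c. Q (Const c)" "\<And>i. Q (Var i)"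
    "\<And>f g. Q f \<Longrightarrow> Q g \<Longrightarrow> Q (f + g)" "\<And>f g. Q f \<Longrightarrow> Q g \<Longrightarrow> Q (f * g)"
  shows "Q g"
proof (induction g rule: poly_mapping_single_induct)
  case zero
  then show ?case using assms(1)[of 0] by (simp add: Const_simps)
next
  case (single m c)
  have one: "Q 1" using assms(1)[of 1] by (simp add: Const_simps)
  have "Q ((Var i) ^ n)" for i n
    by (induction n) (auto intro: assms one)
  then have "Q (\<Prod>i\<in>A. Var i ^ Poly_Mapping.lookup m i)" for A
    by (induction A rule: infinite_finite_induct) (auto intro: assms one)
  then show ?case
    by (auto simp: single_eq_monom_value monom_value_def intro: assms)
qed (rule assms)

lemma subst_subst: "subst F (subst G g) = subst (\<lambda>i. subst F (G i)) g"
  by (induction g rule: mpoly_induct) simp_all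

lemma subst_id: "subst Var g = g"
  by (induction g rule: mpoly_induct) simp_all

text \<open>
  For \<open>G = Var\<close> the second substitution is the identity. In this way a kernel is computed: the
  difference of \<open>g\<close> and its image lies in any ideal that contains the differences of the variables and their images.
\<close>

lemma subst_cong_ideal:
  fixes F G :: "'w::finite \<Rightarrow> ('v, 'k::comm_ring_1) mpoly"
  assumes "ideal I type_ring" "\<And>i. F i - G i \<in> I"
  shows "subst F g - subst G g \<in> I"
proof (induction g rule: mpoly_induct)
  case (add f g)
  have "subst F (f + g) - subst G (f + g) = (subst F f - subst G f) + (subst F g - subst G g)"
    by simp
  then show ?case using add ideal_add[OF assms(1)] by metis
next
  case (mult f g)
  have "subst F (f * g) - subst G (f * g) =
      subst F g * (subst F f - subst G f) + subst G f * (subst F g - subst G g)"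
    by (simp add: algebra_simps)
  then show ?case using mult ideal_add[OF assms(1)] ideal_mult[OF assms(1)] by metis
qed (use assms ideal_0 in \<open>auto\<close>)

lemma ker_zero_vars:
  fixes g :: "('v::finite, 'k::comm_ring_1) mpoly"
  shows "subst (\<lambda>i. if i \<in> A then 0 else Var i) g = 0 \<longleftrightarrow> g \<in> idl (Var ` A)"
proof
  assume "subst (\<lambda>i. if i \<in> A then 0 else Var i) g = 0"
  moreover have "subst Var g - subst (\<lambda>i. if i \<in> A then 0 else Var i) g \<in> idl (Var ` A)"
    by (rule subst_cong_ideal) (auto intro: idl_base ideal_0)
  ultimately show "g \<in> idl (Var ` A)" by (simp add: subst_id)
next
  let ?s = "subst (\<lambda>i. if i \<in> A then 0 else Var i) :: ('v, 'k) mpoly \<Rightarrow> ('v, 'k) mpoly"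
  have "ideal {g. ?s g = 0} type_ring" by (simp add: ideal_iff)
  then have "idl (Var ` A) \<subseteq> {g. ?s g = 0}" by (rule idl_minimal) auto
  then show "g \<in> idl (Var ` A) \<Longrightarrow> ?s g = 0" by auto
qed

lemma partial_deriv_superset:
  assumes "finite A" "Poly_Mapping.keys g \<subseteq> A"
  shows "partial_deriv i g = (\<Sum>m\<in>A. Poly_Mapping.single (m - Poly_Mapping.single i 1)
          (of_nat (Poly_Mapping.lookup m i) * Poly_Mapping.lookup g m))"
  unfolding partial_deriv_def
  using assms by (intro sum.mono_neutral_left) (auto simp: in_keys_iff)

lemma partial_deriv_add [simp]: "partial_deriv i (f + g) = partial_deriv i f + partial_deriv i g"
proof -
  let ?A = "Poly_Mapping.keys f \<union> Poly_Mapping.keys g"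
  have "Poly_Mapping.keys (f + g) \<subseteq> ?A" by (rule Poly_Mapping.keys_add)
  then show ?thesis
    by (simp add: partial_deriv_superset[of ?A] lookup_add sum.distrib distrib_left single_add)
qed

lemma partial_deriv_single:
  "partial_deriv i (Poly_Mapping.single m c) =
     Poly_Mapping.single (m - Poly_Mapping.single i 1) (of_nat (Poly_Mapping.lookup m i) * c)"
  by (subst partial_deriv_superset[of "{m}"]) auto

lemma partial_deriv_0 [simp]: "partial_deriv i 0 = 0"
  by (simp add: partial_deriv_def)

text \<open>
  Both sides are biadditive, so that only products of two terms have to be compared. Where an exponent
  is truncated, the coefficient vanishes.
\<close>

lemma partial_deriv_mult [simp]:
  "partial_deriv i (f * g) = f * partial_deriv i g + partial_deriv i f * g"
proof (induction f rule: poly_mapping_single_induct)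
  case (single m c)
  show ?case
  proof (induction g rule: poly_mapping_single_induct)
    case (single n d)
    let ?e = "Poly_Mapping.single i (1::nat)"
    have left: "Poly_Mapping.single (m + (n - ?e)) (of_nat (Poly_Mapping.lookup n i) * (c * d)) =
        Poly_Mapping.single (m + n - ?e) (of_nat (Poly_Mapping.lookup n i) * (c * d))"
      for m n c and d :: 'b
    proof (cases "Poly_Mapping.lookup n i = 0")
      case False
      then have "m + (n - ?e) = m + n - ?e"
        by (intro poly_mapping_eqI) (auto simp: lookup_add lookup_minus lookup_single when_def)
      then show ?thesis by simp
    qed simp
    show ?case
      using left[of m n c d] left[of n m d c]
      by (simp add: mult_single partial_deriv_single lookup_add distrib_right distrib_left
          ac_simps flip: single_add)
  qed (simp_all add: distrib_left)
qed (simp_all add: distrib_right)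

lemma partial_deriv_Const [simp]: "partial_deriv i (Const c) = 0"
  by (simp add: Const_def partial_deriv_single)

lemma partial_deriv_Var [simp]: "partial_deriv i (Var j) = (if i = j then 1 else 0)"
  by (auto simp: Var_def partial_deriv_single lookup_single when_def)

lemma partial_deriv_uminus [simp]: "partial_deriv i (- f) = - partial_deriv i f"
  using partial_deriv_add[of i f "- f"] by (simp add: add_eq_0_iff)

lemma partial_deriv_diff [simp]: "partial_deriv i (f - g) = partial_deriv i f - partial_deriv i g"
  using partial_deriv_add[of i f "- g"] by simp

section \<open>Homogeneous polynomials\<close>

lemma homogeneous_0 [simp]: "homogeneous d 0"
  by (simp add: homogeneous_def)

lemma homogeneous_add: "homogeneous d f \<Longrightarrow> homogeneous d g \<Longrightarrow> homogeneous d (f + g)"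
  using Poly_Mapping.keys_add[of f g] by (auto simp: homogeneous_def)

lemma homogeneous_uminus: "homogeneous d f \<Longrightarrow> homogeneous d (- f)"
  by (auto simp: homogeneous_def in_keys_iff)

lemma homogeneous_diff: "homogeneous d f \<Longrightarrow> homogeneous d g \<Longrightarrow> homogeneous d (f - g)"
  using homogeneous_add[of d f "- g"] homogeneous_uminus[of d g] by simp

lemma homogeneous_mult:
  assumes "homogeneous d f" "homogeneous e g" "n = d + e"
  shows "homogeneous n (f * g)"
  unfolding homogeneous_def
proof
  fix k assume "k \<in> Poly_Mapping.keys (f * g)"
  then obtain a b where "k = a + b" "a \<in> Poly_Mapping.keys f" "b \<in> Poly_Mapping.keys g"
    using keys_mult[of f g] by auto
  then show "(\<Sum>i\<in>UNIV. Poly_Mapping.lookup k i) = n"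
    using assms by (auto simp: homogeneous_def lookup_add sum.distrib)
qed

lemma homogeneous_Const: "homogeneous 0 (Const c)"
  by (simp add: homogeneous_def Const_def)

lemma homogeneous_1: "homogeneous 0 1"
  by (metis homogeneous_Const Const_simps(2))

lemma homogeneous_numeral: "homogeneous 0 (numeral n)"
  by (metis homogeneous_Const Const_numeral)

lemma homogeneous_power: "homogeneous d f \<Longrightarrow> n = d * k \<Longrightarrow> homogeneous n (f ^ k)"
  by (induction k arbitrary: n) (auto intro!: homogeneous_mult homogeneous_1)

lemma homogeneous_Var: "homogeneous 1 (Var i)"
  by (simp add: homogeneous_def Var_def lookup_single when_def sum.delta)

lemma homogeneous_sum: "(\<And>i. i \<in> A \<Longrightarrow> homogeneous d (f i)) \<Longrightarrow> homogeneous d (sum f A)"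
  by (induction A rule: infinite_finite_induct) (auto intro: homogeneous_add)

lemma homogeneous_monom_value:
  assumes "\<And>i. homogeneous e (F i)"
  shows "homogeneous (e * (\<Sum>i\<in>UNIV. Poly_Mapping.lookup m i)) (monom_value F m)"
proof -
  have "homogeneous (e * (\<Sum>i\<in>A. Poly_Mapping.lookup m i)) (\<Prod>i\<in>A. F i ^ Poly_Mapping.lookup m i)" for A
    by (induction A rule: infinite_finite_induct)
      (auto intro!: homogeneous_mult homogeneous_1 homogeneous_power assms simp: distrib_left)
  then show ?thesis by (simp add: monom_value_def)
qed

lemma homogeneous_subst:
  assumes "homogeneous d g" "\<And>i. homogeneous e (F i)"
  shows "homogeneous (e * d) (subst F g)"
  unfolding subst_def monom_value_def[symmetric]
proof (intro homogeneous_sum homogeneous_mult[OF homogeneous_Const])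
  fix m assume "m \<in> Poly_Mapping.keys g"
  then show "homogeneous (e * d) (monom_value F m)"
    using homogeneous_monom_value[OF assms(2), where m = m] assms(1) by (auto simp: homogeneous_def)
qed simp

section \<open>Seven variables\<close>

lemma exhaust_7: "i = 0 \<or> i = 1 \<or> i = 2 \<or> i = 3 \<or> i = 4 \<or> i = 5 \<or> i = (6::7)"
proof (induct i)
  case (of_int z)
  hence "z = 0 \<or> z = 1 \<or> z = 2 \<or> z = 3 \<or> z = 4 \<or> z = 5 \<or> z = 6" by simp arith
  then show ?case by auto
qed

lemma UNIV_7: "UNIV = {0, 1, 2, 3, 4, 5, 6::7}"
  using exhaust_7 by auto

lemma forall_7: "(\<forall>i::7. A i) \<longleftrightarrow> A 0 \<and> A 1 \<and> A 2 \<and> A 3 \<and> A 4 \<and> A 5 \<and> A 6"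
  by (metis exhaust_7)

lemma sum_7: "sum f (UNIV::7 set) = f 0 + f 1 + f 2 + f 3 + f 4 + f 5 + f 6"
  unfolding UNIV_7 by (simp add: ac_simps)

lemma prod_7: "prod f (UNIV::7 set) = f 0 * f 1 * f 2 * f 3 * f 4 * f 5 * f 6"
  unfolding UNIV_7 by (simp add: ac_simps)

text \<open>
  Points and tuples of polynomials with seven coordinates are functions on the type \<open>7\<close>, whose
  elements are \<open>0, \<dots>, 6\<close>.
\<close>

definition seven :: "'a \<Rightarrow> 'a \<Rightarrow> 'a \<Rightarrow> 'a \<Rightarrow> 'a \<Rightarrow> 'a \<Rightarrow> 'a \<Rightarrow> 7 \<Rightarrow> 'a" where
  "seven a0 a1 a2 a3 a4 a5 a6 i =
     (if i = 0 then a0 else if i = 1 then a1 else if i = 2 then a2 else if i = 3 then a3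
      else if i = 4 then a4 else if i = 5 then a5 else a6)"

lemma seven_simps [simp]:
  "seven a0 a1 a2 a3 a4 a5 a6 0 = a0" "seven a0 a1 a2 a3 a4 a5 a6 1 = a1"
  "seven a0 a1 a2 a3 a4 a5 a6 2 = a2" "seven a0 a1 a2 a3 a4 a5 a6 3 = a3"
  "seven a0 a1 a2 a3 a4 a5 a6 4 = a4" "seven a0 a1 a2 a3 a4 a5 a6 5 = a5"
  "seven a0 a1 a2 a3 a4 a5 a6 6 = a6"
  by (simp_all add: seven_def)

section \<open>Kernels of monomial maps\<close>

text \<open>
  Let \<open>L\<close> be the linear map which sends a monomial of exponent \<open>t\<close> to the representative in \<open>N\<close> of
  weight \<open>t\<close>. Every monomial is congruent modulo \<open>I\<close> to the representative of its weight, hence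
  \<open>g\<close> is congruent to \<open>L\<close> of its image, which is zero for \<open>g\<close> in the kernel.
\<close>

lemma monomial_map_kernel:
  fixes F :: "'v::finite \<Rightarrow> ('w, 'k::comm_ring_1) mpoly"
  assumes F: "\<And>m c. subst F (Poly_Mapping.single m c) = Poly_Mapping.single (\<tau> m) c"
    and I: "ideal I type_ring"
    and N: "inj_on \<tau> N"
    and red: "\<And>m. \<exists>n\<in>N. \<tau> n = \<tau> m \<and> Poly_Mapping.single m 1 - Poly_Mapping.single n 1 \<in> I"
    and g: "subst F g = 0"
  shows "g \<in> I"
proof -
  define \<rho> where "\<rho> = inv_into N \<tau>"
  define L where "L h = (\<Sum>t\<in>Poly_Mapping.keys h. Poly_Mapping.single (\<rho> t) (Poly_Mapping.lookup h t))"
    for h :: "('w, 'k) mpoly"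
  have sup: "L h = (\<Sum>t\<in>A. Poly_Mapping.single (\<rho> t) (Poly_Mapping.lookup h t))"
    if "finite A" "Poly_Mapping.keys h \<subseteq> A" for h A
    unfolding L_def using that by (intro sum.mono_neutral_left) (auto simp: in_keys_iff)
  have L_add: "L (h + h') = L h + L h'" for h h'
  proof -
    let ?A = "Poly_Mapping.keys h \<union> Poly_Mapping.keys h'"
    have "Poly_Mapping.keys (h + h') \<subseteq> ?A" by (rule Poly_Mapping.keys_add)
    then show ?thesis
      by (simp add: sup[of ?A] lookup_add sum.distrib single_add)
  qed
  have L_single: "L (Poly_Mapping.single t c) = Poly_Mapping.single (\<rho> t) c" for t c
    by (subst sup[of "{t}"]) auto
  have "g - L (subst F g) \<in> I"
  proof (induction g rule: poly_mapping_single_induct)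
    case zero
    then show ?case by (simp add: L_def ideal_0[OF I])
  next
    case (single m c)
    obtain n where n: "n \<in> N" "\<tau> n = \<tau> m" "Poly_Mapping.single m 1 - Poly_Mapping.single n 1 \<in> I"
      using red by blast
    have "\<rho> (\<tau> m) = n"
      unfolding \<rho>_def n(2)[symmetric] using N n(1) by (rule inv_into_f_f)
    then have "Poly_Mapping.single m c - L (subst F (Poly_Mapping.single m c)) =
        Const c * (Poly_Mapping.single m 1 - Poly_Mapping.single n 1)"
      by (simp add: F L_single Const_def mult_single right_diff_distrib)
    then show ?case using ideal_mult[OF I n(3)] by metis
  next
    case (add f g)
    have "f + g - L (subst F (f + g)) = (f - L (subst F f)) + (g - L (subst F g))"
      by (simp add: L_add)
    then show ?case using add ideal_add[OF I] by metis
  qed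
  then show ?thesis using g by (simp add: L_def)
qed

section \<open>The ideals\<close>

definition conic_form :: "(7 \<Rightarrow> 'a::comm_ring_1) \<Rightarrow> 'a" where
  "conic_form x = x 1 * x 5 - (x 3)\<^sup>2"

definition minors_C :: "(7 \<Rightarrow> 'a::comm_ring_1) \<Rightarrow> 'a set" where
  "minors_C x =
     {x 0 * x 3 - x 1 * x 2, x 0 * x 4 - x 2 * x 2, x 1 * x 4 - x 2 * x 3,
      x 0 * x 5 - x 1 * x 4, x 0 * x 6 - x 2 * x 4, x 1 * x 6 - x 2 * x 5,
      x 2 * x 5 - x 3 * x 4, x 2 * x 6 - x 4 * x 4, x 3 * x 6 - x 4 * x 5}"

text \<open>
  The partial derivatives of the determinant, as functions of the values of the variables: this way
  they can be evaluated in any ring, in particular at another tuple of polynomials.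
\<close>

definition polar :: "(7 \<Rightarrow> 'a::comm_ring_1) \<Rightarrow> 7 \<Rightarrow> 'a" where
  "polar x = seven
     (x 3 * x 6 - x 4 * x 5)
     (x 4 * x 4 - x 2 * x 6)
     (2 * (x 2 * x 5) - x 1 * x 6 - x 3 * x 4)
     (x 0 * x 6 - x 2 * x 4)
     (2 * (x 1 * x 4) - x 0 * x 5 - x 2 * x 3)
     (x 2 * x 2 - x 0 * x 4)
     (x 0 * x 3 - x 1 * x 2)"

definition polar_ideal :: "(7, 'k::field_char_0) mpoly set" where
  "polar_ideal = idl (range (polar Var))"

definition minors_ideal_C :: "(7, 'k::field_char_0) mpoly set" where
  "minors_ideal_C = idl (minors_C Var)"

text \<open>
  The ten minors of the matrix with two rows are, up to sums of two, the nine minors of the square matrix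
  and the equation of the conic.
\<close>

definition scroll_ideal :: "(7, 'k::field_char_0) mpoly set" where
  "scroll_ideal = idl (insert (conic_form Var) (minors_C Var))"

definition even_ideal :: "(7, 'k::field_char_0) mpoly set" where
  "even_ideal = idl (Var ` {0, 2, 4, 6})"

text \<open>
  The retraction onto the subring \<open>k[x\<^sub>1, x\<^sub>3, x\<^sub>5]\<close>, whose elements are the polynomials fixed by it.
\<close>

definition odd_part :: "(7, 'k::field_char_0) mpoly \<Rightarrow> (7, 'k) mpoly" where
  "odd_part = subst (\<lambda>i. if i \<in> {0, 2, 4, 6} then 0 else Var i)"

lemma ideals [simp, intro]:
  "ideal polar_ideal type_ring" "ideal minors_ideal_C type_ring"
  "ideal scroll_ideal type_ring" "ideal even_ideal type_ring"
  by (simp_all add: polar_ideal_def minors_ideal_C_def scroll_ideal_def even_ideal_def)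

section \<open>The ideal of the even variables\<close>

lemma odd_part_simps [simp]:
  "odd_part (f + g) = odd_part f + odd_part g" "odd_part (f * g) = odd_part f * odd_part g"
  "odd_part (f - g) = odd_part f - odd_part g" "odd_part (- f) = - odd_part f"
  "odd_part (f ^ n) = odd_part f ^ n" "odd_part (Const c) = Const c"
  "odd_part 0 = 0" "odd_part 1 = 1" "odd_part (numeral k) = numeral k"
  "odd_part (Var 0) = 0" "odd_part (Var 1) = Var 1" "odd_part (Var 2) = 0" "odd_part (Var 3) = Var 3"
  "odd_part (Var 4) = 0" "odd_part (Var 5) = Var 5" "odd_part (Var 6) = 0"
  by (simp_all add: odd_part_def)

lemma odd_part_idem [simp]: "odd_part (odd_part g) = odd_part g"
  by (induction g rule: mpoly_induct) (auto simp: odd_part_def)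

lemma even_ideal_iff: "g \<in> even_ideal \<longleftrightarrow> odd_part g = 0"
  unfolding even_ideal_def odd_part_def ker_zero_vars[symmetric] ..

lemma prime_even_ideal: "primeideal even_ideal type_ring"
  unfolding prime_iff by (auto simp: even_ideal_iff)

lemma odd_part_conic [simp]: "odd_part (conic_form Var) = conic_form Var"
  by (simp add: conic_form_def)

section \<open>The ideal of the scroll is the kernel of its parametrisation\<close>

text \<open>
  The affine cone over the scroll of a twisted cubic and a conic: with the variables \<open>y, s, t\<close> for
  \<open>Var 1, Var 2, Var 3\<close>, the even variables become \<open>y\<close> times the cubic monomials in \<open>s, t\<close>, and the
  odd ones the quadratic monomials.
\<close>

definition scroll_param :: "7 \<Rightarrow> (3, 'k::field_char_0) mpoly" where
  "scroll_param = seven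
     (Var 1 * Var 2 ^ 3) (Var 2 ^ 2) (Var 1 * Var 2 ^ 2 * Var 3) (Var 2 * Var 3)
     (Var 1 * Var 2 * Var 3 ^ 2) (Var 3 ^ 2) (Var 1 * Var 3 ^ 3)"

text \<open>
  The exponent vector of the image of a monomial under the parametrisation.
\<close>

definition scroll_weight :: "(7 \<Rightarrow>\<^sub>0 nat) \<Rightarrow> 3 \<Rightarrow>\<^sub>0 nat" where
  "scroll_weight m = (let a = Poly_Mapping.lookup m in
     Poly_Mapping.single 1 (a 0 + a 2 + a 4 + a 6) +
     Poly_Mapping.single 2 (3 * a 0 + 2 * a 2 + a 4 + 2 * a 1 + a 3) +
     Poly_Mapping.single 3 (a 2 + 2 * a 4 + 3 * a 6 + a 3 + 2 * a 5))"

lemma lookup_scroll_weight: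
  fixes m :: "7 \<Rightarrow>\<^sub>0 nat"
  defines "a \<equiv> Poly_Mapping.lookup m"
  shows "Poly_Mapping.lookup (scroll_weight m) 1 = a 0 + a 2 + a 4 + a 6"
    "Poly_Mapping.lookup (scroll_weight m) 2 = 3 * a 0 + 2 * a 2 + a 4 + 2 * a 1 + a 3"
    "Poly_Mapping.lookup (scroll_weight m) 3 = a 2 + 2 * a 4 + 3 * a 6 + a 3 + 2 * a 5"
  by (simp_all add: a_def scroll_weight_def Let_def lookup_add lookup_single)

lemma scroll_weight_add: "scroll_weight (m + n) = scroll_weight m + scroll_weight n"
  by (simp add: scroll_weight_def Let_def lookup_add distrib_left single_add ac_simps)

lemma Var_power: "Var i ^ n = Poly_Mapping.single (Poly_Mapping.single i n) 1"
  by (induction n) (simp_all add: Var_def mult_single flip: single_add)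

lemma subst_scroll_param_single:
  "subst scroll_param (Poly_Mapping.single m c) =
    (Poly_Mapping.single (scroll_weight m) c :: (3, 'k::field_char_0) mpoly)"
proof -
  define a where "a = Poly_Mapping.lookup m"
  have "subst scroll_param (Poly_Mapping.single m c) =
      (Const c :: (3, 'k) mpoly) * (Var 1 ^ (a 0 + a 2 + a 4 + a 6) *
       Var 2 ^ (3 * a 0 + 2 * a 2 + a 4 + 2 * a 1 + a 3) *
       Var 3 ^ (a 2 + 2 * a 4 + 3 * a 6 + a 3 + 2 * a 5))"
    by (simp only: subst_single monom_value_def prod_7 scroll_param_def seven_simps a_def
        power_mult_distrib power_add power_mult mult_ac)
  also have "\<dots> = Poly_Mapping.single (scroll_weight m) c"
    by (simp only: Var_power Const_def mult_single scroll_weight_def Let_def a_def mult_1_right add_0_left add.assoc)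
  finally show ?thesis .
qed

text \<open>
  Standard monomials modulo the scroll: a product of \<open>x\<^sub>0, x\<^sub>1, x\<^sub>6\<close> with at most one of
  \<open>x\<^sub>2, x\<^sub>4\<close>, or a product of \<open>x\<^sub>1, x\<^sub>5, x\<^sub>6\<close> with at most one \<open>x\<^sub>3\<close>.
\<close>

definition scroll_normal :: "(7 \<Rightarrow>\<^sub>0 nat) set" where
  "scroll_normal = {m. let a = Poly_Mapping.lookup m in
     a 3 = 0 \<and> a 5 = 0 \<and> a 2 + a 4 \<le> 1 \<or> a 0 = 0 \<and> a 2 = 0 \<and> a 4 = 0 \<and> a 3 \<le> 1}"

text \<open>
  In the third equation, \<open>a2 + 2 * a4\<close> is at most \<open>2\<close>, so it is a remainder modulo \<open>3\<close>.
\<close>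

lemma scroll_normal_unique_1: assumes "a0 + a2 + a4 + a6 = b0 + b2 + b4 + (b6::nat)"
    "3 * a0 + 2 * a2 + a4 + 2 * a1 = 3 * b0 + 2 * b2 + b4 + 2 * b1"
    "a2 + 2 * a4 + 3 * a6 = b2 + 2 * b4 + 3 * b6"
    "a2 + a4 \<le> 1" "b2 + b4 \<le> 1"
  shows "a0 = b0 \<and> a1 = b1 \<and> a2 = b2 \<and> a4 = b4 \<and> a6 = b6"
proof -
  have 6: "a6 = b6" using assms(3-) by linarith
  then have 4: "a4 = b4" using assms(3-) by linarith
  then have 2: "a2 = b2" using assms(3) 6 by linarith
  then show ?thesis using assms(1,2) 4 6 by simp
qed
text \<open>
  Three times the first equation minus the third one says that a sum of natural numbers vanishes.
\<close>

lemma scroll_normal_unique_2: assumes "a0 + a2 + a4 + a6 = (b6::nat)"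
    "3 * a0 + 2 * a2 + a4 + 2 * a1 = 2 * b1 + b3"
    "a2 + 2 * a4 + 3 * a6 = 3 * b6 + b3 + 2 * b5"
  shows "a0 = 0 \<and> a1 = b1 \<and> a2 = 0 \<and> a4 = 0 \<and> a6 = b6 \<and> b3 = 0 \<and> b5 = 0"
proof -
  have "3 * a0 + 2 * a2 + a4 + b3 + 2 * b5 = 0" using assms(1,3) by linarith
  then show ?thesis using assms by simp
qed
lemma scroll_normal_unique:
  fixes a0 a1 a2 a3 a4 a5 a6 b0 b1 b2 b3 b4 b5 b6 :: nat
  assumes w: "a0 + a2 + a4 + a6 = b0 + b2 + b4 + (b6::nat)"
    "3 * a0 + 2 * a2 + a4 + 2 * a1 + a3 = 3 * b0 + 2 * b2 + b4 + 2 * b1 + b3"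
    "a2 + 2 * a4 + 3 * a6 + a3 + 2 * a5 = b2 + 2 * b4 + 3 * b6 + b3 + 2 * b5"
 and nm: "a3 = 0 \<and> a5 = 0 \<and> a2 + a4 \<le> 1 \<or> a0 = 0 \<and> a2 = 0 \<and> a4 = 0 \<and> a3 \<le> 1"
    "b3 = 0 \<and> b5 = 0 \<and> b2 + b4 \<le> 1 \<or> b0 = 0 \<and> b2 = 0 \<and> b4 = 0 \<and> b3 \<le> 1"
  shows "a0 = b0 \<and> a1 = b1 \<and> a2 = b2 \<and> a3 = b3 \<and> a4 = b4 \<and> a5 = b5 \<and> a6 = b6"
  using nm
proof (elim disjE conjE)
  assume "a3 = 0" "a5 = 0" "a2 + a4 \<le> 1" "b3 = 0" "b5 = 0" "b2 + b4 \<le> 1"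
  then show ?thesis using scroll_normal_unique_1[of a0 a2 a4 a6 b0 b2 b4 b6 a1 b1] w by simp
next
  assume "a3 = 0" "a5 = 0" "a2 + a4 \<le> 1" "b0 = 0" "b2 = 0" "b4 = 0" "b3 \<le> 1"
  then show ?thesis using scroll_normal_unique_2[of a0 a2 a4 a6 b6 a1 b1 b3 b5] w by simp
next
  assume "b3 = 0" "b5 = 0" "b2 + b4 \<le> 1" "a0 = 0" "a2 = 0" "a4 = 0" "a3 \<le> 1"
  then show ?thesis using scroll_normal_unique_2[of b0 b2 b4 b6 a6 b1 a1 a3 a5] w by simp
next
  assume s: "a0 = 0" "a2 = 0" "a4 = 0" "a3 \<le> 1" "b0 = 0" "b2 = 0" "b4 = 0" "b3 \<le> 1"
  then have 6: "a6 = b6" and e: "2 * a1 + a3 = 2 * b1 + b3" "a3 + 2 * a5 = b3 + 2 * b5" using w by simp_all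
  then have "a3 = b3" using s(4,8) e(2) by presburger
  then show ?thesis using s 6 e by simp
qed
lemma inj_scroll_weight: "inj_on scroll_weight scroll_normal"
proof (rule inj_onI)
  fix m n assume m: "m \<in> scroll_normal" and n: "n \<in> scroll_normal"
    and eq: "scroll_weight m = scroll_weight n"
  obtain a b where a: "a = Poly_Mapping.lookup m" and b: "b = Poly_Mapping.lookup n" by blast
  have w: "a 0 + a 2 + a 4 + a 6 = b 0 + b 2 + b 4 + b 6"
    "3 * a 0 + 2 * a 2 + a 4 + 2 * a 1 + a 3 = 3 * b 0 + 2 * b 2 + b 4 + 2 * b 1 + b 3"
    "a 2 + 2 * a 4 + 3 * a 6 + a 3 + 2 * a 5 = b 2 + 2 * b 4 + 3 * b 6 + b 3 + 2 * b 5"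
    using eq lookup_scroll_weight[of m] lookup_scroll_weight[of n] unfolding a b by metis+
  have nm: "a 3 = 0 \<and> a 5 = 0 \<and> a 2 + a 4 \<le> 1 \<or> a 0 = 0 \<and> a 2 = 0 \<and> a 4 = 0 \<and> a 3 \<le> 1"
    "b 3 = 0 \<and> b 5 = 0 \<and> b 2 + b 4 \<le> 1 \<or> b 0 = 0 \<and> b 2 = 0 \<and> b 4 = 0 \<and> b 3 \<le> 1"
    using m n by (auto simp: scroll_normal_def a b Let_def)
  have "a 0 = b 0 \<and> a 1 = b 1 \<and> a 2 = b 2 \<and> a 3 = b 3 \<and> a 4 = b 4 \<and> a 5 = b 5 \<and> a 6 = b 6"
    using scroll_normal_unique w nm by blast
  then have "a i = b i" for i using forall_7[of "\<lambda>i. a i = b i"] by blast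
  then show "m = n" by (intro poly_mapping_eqI) (simp add: a b)
qed

lemma scroll_ideal_in_kernel:
  assumes "g \<in> scroll_ideal"
  shows "subst scroll_param g = 0"
proof -
  have "ideal {g. subst scroll_param g = (0 :: (3, 'a) mpoly)} type_ring"
    by (simp add: ideal_iff)
  then have "scroll_ideal \<subseteq> {g. subst scroll_param g = (0 :: (3, 'a) mpoly)}"
    unfolding scroll_ideal_def minors_C_def conic_form_def
    by (rule idl_minimal)
      (simp add: scroll_param_def power2_eq_square power3_eq_cube mult_ac)
  then show ?thesis using assms by blast
qed

text \<open>
  The weights \<open>0, 0, 2, 3, 3, 5, 3\<close> of the variables are chosen such that each of the ten quadratic
  binomials in \<open>scroll_relations\<close>, read from left to right, lowers the potential.
\<close>

definition scroll_potential :: "(7 \<Rightarrow>\<^sub>0 nat) \<Rightarrow> nat" where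
  "scroll_potential m = (\<Sum>i\<in>UNIV. Poly_Mapping.lookup m i * seven 0 0 2 3 3 5 3 i)"

text \<open>
  One rewriting step. It preserves the weight, because the binomial is in the kernel of the
  parametrisation.
\<close>

lemma scroll_rewrite:
  assumes mem: "Var p * Var q - Var r * Var s \<in> (scroll_ideal :: (7, 'k::field_char_0) mpoly set)"
    and le: "if p = q then Poly_Mapping.lookup m p \<ge> 2
      else Poly_Mapping.lookup m p \<ge> 1 \<and> Poly_Mapping.lookup m q \<ge> 1"
    and v: "seven 0 0 2 3 3 5 3 r + seven 0 0 2 3 3 5 3 s < seven 0 0 2 3 3 5 3 p + (seven 0 0 2 3 3 5 3 q :: nat)"
  shows "\<exists>m'. scroll_weight m' = scroll_weight m \<and> scroll_potential m' < scroll_potential m \<and>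
    Poly_Mapping.single m 1 - Poly_Mapping.single m' 1 \<in> (scroll_ideal :: (7, 'k) mpoly set)"
proof -
  let ?l = "Poly_Mapping.single p 1 + Poly_Mapping.single q 1 :: 7 \<Rightarrow>\<^sub>0 nat"
  let ?r = "Poly_Mapping.single r 1 + Poly_Mapping.single s 1 :: 7 \<Rightarrow>\<^sub>0 nat"
  have m: "m = (m - ?l) + ?l"
    using le by (intro poly_mapping_eqI)
      (auto simp: lookup_add lookup_minus lookup_single when_def split: if_splits)
  have pot: "scroll_potential (m + n) = scroll_potential m + scroll_potential n" for m n
    by (simp add: scroll_potential_def lookup_add distrib_right sum.distrib)
  have pot_single: "scroll_potential (Poly_Mapping.single i 1) = seven 0 0 2 3 3 5 3 i" for i
    by (simp add: scroll_potential_def lookup_single when_def if_distrib[of "\<lambda>x. x * _"] cong: if_cong)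
  have Var2: "Var i * Var j = (Poly_Mapping.single (Poly_Mapping.single i 1 + Poly_Mapping.single j 1) 1 :: (7, 'k) mpoly)"
    for i j by (simp add: Var_def mult_single)
  have "(Poly_Mapping.single (scroll_weight ?l) 1 :: (3, 'k) mpoly) = Poly_Mapping.single (scroll_weight ?r) 1"
    using scroll_ideal_in_kernel[OF mem] by (simp only: subst_diff Var2 subst_scroll_param_single right_minus_eq)
  then have w: "scroll_weight ?l = scroll_weight ?r"
    by (metis keys_single singleton_inject zero_neq_one)
  have "Poly_Mapping.single ((m - ?l) + ?l) 1 - Poly_Mapping.single ((m - ?l) + ?r) 1 =
      Poly_Mapping.single (m - ?l) 1 * (Var p * Var q - Var r * Var s :: (7, 'k) mpoly)"
    by (simp add: Var_def mult_single right_diff_distrib add.assoc)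
  then have "Poly_Mapping.single m 1 - Poly_Mapping.single ((m - ?l) + ?r) 1 \<in> (scroll_ideal :: (7, 'k) mpoly set)"
    using m ideal_mult[OF ideals(3) mem] by metis
  moreover have "scroll_weight ((m - ?l) + ?r) = scroll_weight m"
    using w by (subst (2) m) (simp only: scroll_weight_add)
  moreover have "scroll_potential ((m - ?l) + ?r) < scroll_potential m"
    using v by (subst (2) m) (simp only: pot pot_single add_less_cancel_left)
  ultimately show ?thesis by blast
qed

lemma scroll_minors:
  "Var 0 * Var 3 - Var 1 * Var 2 \<in> scroll_ideal" "Var 0 * Var 4 - Var 2 * Var 2 \<in> scroll_ideal"
  "Var 1 * Var 4 - Var 2 * Var 3 \<in> scroll_ideal" "Var 0 * Var 5 - Var 1 * Var 4 \<in> scroll_ideal"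
  "Var 0 * Var 6 - Var 2 * Var 4 \<in> scroll_ideal" "Var 1 * Var 6 - Var 2 * Var 5 \<in> scroll_ideal"
  "Var 2 * Var 5 - Var 3 * Var 4 \<in> scroll_ideal" "Var 2 * Var 6 - Var 4 * Var 4 \<in> scroll_ideal"
  "Var 3 * Var 6 - Var 4 * Var 5 \<in> scroll_ideal" "Var 1 * Var 5 - Var 3 * Var 3 \<in> scroll_ideal"
  unfolding scroll_ideal_def minors_C_def conic_form_def power2_eq_square
  by (rule idl_base; (rule insertI1 | rule insertI2)+)+

lemma scroll_relations:
  "Var 2 * Var 2 - Var 0 * Var 4 \<in> scroll_ideal" "Var 2 * Var 4 - Var 0 * Var 6 \<in> scroll_ideal"
  "Var 4 * Var 4 - Var 2 * Var 6 \<in> scroll_ideal" "Var 0 * Var 3 - Var 1 * Var 2 \<in> scroll_ideal"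
  "Var 0 * Var 5 - Var 1 * Var 4 \<in> scroll_ideal" "Var 2 * Var 3 - Var 1 * Var 4 \<in> scroll_ideal"
  "Var 2 * Var 5 - Var 1 * Var 6 \<in> scroll_ideal" "Var 3 * Var 4 - Var 1 * Var 6 \<in> scroll_ideal"
  "Var 4 * Var 5 - Var 3 * Var 6 \<in> scroll_ideal" "Var 3 * Var 3 - Var 1 * Var 5 \<in> scroll_ideal"
proof -
  have flip: "b - a \<in> scroll_ideal" if "a - b \<in> scroll_ideal" for a b
    using ideal_uminus[OF ideals(3) that] by simp
  have "Var 1 * Var 6 - Var 3 * Var 4 \<in> scroll_ideal"
    using ideal_add[OF ideals(3) scroll_minors(6) scroll_minors(7)] by simp
  then show "Var 3 * Var 4 - Var 1 * Var 6 \<in> scroll_ideal" by (rule flip)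
qed (rule scroll_minors scroll_minors[THEN ideal_uminus[OF ideals(3)], simplified minus_diff_eq])+

lemma not_scroll_normal:
  fixes a0 a2 a3 a4 a5 :: nat
  assumes "\<not> (a3 = 0 \<and> a5 = 0 \<and> a2 + a4 \<le> 1 \<or> a0 = 0 \<and> a2 = 0 \<and> a4 = 0 \<and> a3 \<le> 1)"
  shows "a2 \<ge> 2 \<or> a2 \<ge> 1 \<and> a4 \<ge> 1 \<or> a4 \<ge> 2 \<or> a0 \<ge> 1 \<and> a3 \<ge> 1 \<or> a0 \<ge> 1 \<and> a5 \<ge> 1 \<or>
    a2 \<ge> 1 \<and> a3 \<ge> 1 \<or> a2 \<ge> 1 \<and> a5 \<ge> 1 \<or> a3 \<ge> 1 \<and> a4 \<ge> 1 \<or> a4 \<ge> 1 \<and> a5 \<ge> 1 \<or> a3 \<ge> 2"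
proof (cases "a3 = 0 \<and> a5 = 0")
  case True
  then have "a2 + a4 \<ge> 2" using assms by linarith
  then have "a2 \<ge> 2 \<or> a2 \<ge> 1 \<and> a4 \<ge> 1 \<or> a4 \<ge> 2" by linarith
  then show ?thesis by blast
next
  case False
  then have "a3 \<ge> 1 \<or> a5 \<ge> 1" by linarith
  moreover have "a0 \<ge> 1 \<or> a2 \<ge> 1 \<or> a4 \<ge> 1 \<or> a3 \<ge> 2" using assms by linarith
  ultimately show ?thesis by blast
qed

text \<open>
  Each monomial which is not standard is divisible by the left-hand side of one of the ten binomials.
\<close>

lemma scroll_reduce:
  "\<exists>n\<in>scroll_normal. scroll_weight n = scroll_weight m \<and>
     Poly_Mapping.single m 1 - Poly_Mapping.single n 1 \<in> (scroll_ideal :: (7, 'k::field_char_0) mpoly set)"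
proof (induction "scroll_potential m" arbitrary: m rule: less_induct)
  case less
  note P = ideals(3)
  show ?case
  proof (cases "m \<in> scroll_normal")
    case True
    then show ?thesis using ideal_0[OF P] by (auto intro: bexI[of _ m])
  next
    case False
    let ?a = "Poly_Mapping.lookup m"
    have "?a 2 \<ge> 2 \<or> ?a 2 \<ge> 1 \<and> ?a 4 \<ge> 1 \<or> ?a 4 \<ge> 2 \<or> ?a 0 \<ge> 1 \<and> ?a 3 \<ge> 1 \<or> ?a 0 \<ge> 1 \<and> ?a 5 \<ge> 1 \<or>
        ?a 2 \<ge> 1 \<and> ?a 3 \<ge> 1 \<or> ?a 2 \<ge> 1 \<and> ?a 5 \<ge> 1 \<or> ?a 3 \<ge> 1 \<and> ?a 4 \<ge> 1 \<or> ?a 4 \<ge> 1 \<and> ?a 5 \<ge> 1 \<or> ?a 3 \<ge> 2"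
      using False by (intro not_scroll_normal) (simp add: scroll_normal_def Let_def)
    then have "\<exists>m'. scroll_weight m' = scroll_weight m \<and> scroll_potential m' < scroll_potential m \<and>
        Poly_Mapping.single m 1 - Poly_Mapping.single m' 1 \<in> (scroll_ideal :: (7, 'k) mpoly set)" (is ?step)
    proof (elim disjE conjE)
      assume "?a 2 \<ge> 2"
      then show ?step
        by (intro scroll_rewrite[OF scroll_relations(1)]) simp_all
    next
      assume "?a 2 \<ge> 1" "?a 4 \<ge> 1"
      then show ?step
        by (intro scroll_rewrite[OF scroll_relations(2)]) simp_all
    next
      assume "?a 4 \<ge> 2"
      then show ?step
        by (intro scroll_rewrite[OF scroll_relations(3)]) simp_all
    next
      assume "?a 0 \<ge> 1" "?a 3 \<ge> 1"
      then show ?step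
        by (intro scroll_rewrite[OF scroll_relations(4)]) simp_all
    next
      assume "?a 0 \<ge> 1" "?a 5 \<ge> 1"
      then show ?step
        by (intro scroll_rewrite[OF scroll_relations(5)]) simp_all
    next
      assume "?a 2 \<ge> 1" "?a 3 \<ge> 1"
      then show ?step
        by (intro scroll_rewrite[OF scroll_relations(6)]) simp_all
    next
      assume "?a 2 \<ge> 1" "?a 5 \<ge> 1"
      then show ?step
        by (intro scroll_rewrite[OF scroll_relations(7)]) simp_all
    next
      assume "?a 3 \<ge> 1" "?a 4 \<ge> 1"
      then show ?step
        by (intro scroll_rewrite[OF scroll_relations(8)]) simp_all
    next
      assume "?a 4 \<ge> 1" "?a 5 \<ge> 1"
      then show ?step
        by (intro scroll_rewrite[OF scroll_relations(9)]) simp_all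
    next
      assume "?a 3 \<ge> 2"
      then show ?step
        by (intro scroll_rewrite[OF scroll_relations(10)]) simp_all
    qed
    then obtain m' where m': "scroll_weight m' = scroll_weight m" "scroll_potential m' < scroll_potential m"
      "Poly_Mapping.single m 1 - Poly_Mapping.single m' 1 \<in> (scroll_ideal :: (7, 'k) mpoly set)" by blast
    obtain n where n: "n \<in> scroll_normal" "scroll_weight n = scroll_weight m'"
      "Poly_Mapping.single m' 1 - Poly_Mapping.single n 1 \<in> (scroll_ideal :: (7, 'k) mpoly set)"
      using less[OF m'(2)] by blast
    have "Poly_Mapping.single m 1 - Poly_Mapping.single n 1 \<in> (scroll_ideal :: (7, 'k) mpoly set)"
      using ideal_add[OF P m'(3) n(3)] by simp
    then show ?thesis using n m' by auto
  qed
qed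

lemma scroll_ideal_iff: "g \<in> scroll_ideal \<longleftrightarrow> subst scroll_param g = 0"
  using scroll_ideal_in_kernel
    monomial_map_kernel[OF subst_scroll_param_single ideals(3) inj_scroll_weight scroll_reduce]
  by blast

lemma prime_scroll_ideal: "primeideal scroll_ideal type_ring"
  unfolding prime_iff by (auto simp: scroll_ideal_iff)

section \<open>The ideal of the minors and the embedded prime\<close>

lemma conic_nonzero [simp]: "conic_form Var \<noteq> (0 :: (7, 'k::field_char_0) mpoly)"
proof
  assume "conic_form Var = (0 :: (7, 'k) mpoly)"
  from arg_cong[OF this, of "subst (seven 0 1 0 0 0 1 0) :: _ \<Rightarrow> (7, 'k) mpoly"]
  show False by (simp add: conic_form_def)
qed

lemma conic_in_scroll_ideal: "conic_form Var \<in> scroll_ideal"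
  unfolding scroll_ideal_def by (intro idl_base insertI1)

lemma minors_C_mem:
  "Var 0 * Var 3 - Var 1 * Var 2 \<in> minors_ideal_C" "Var 0 * Var 4 - Var 2 * Var 2 \<in> minors_ideal_C"
  "Var 1 * Var 4 - Var 2 * Var 3 \<in> minors_ideal_C" "Var 0 * Var 5 - Var 1 * Var 4 \<in> minors_ideal_C"
  "Var 0 * Var 6 - Var 2 * Var 4 \<in> minors_ideal_C" "Var 1 * Var 6 - Var 2 * Var 5 \<in> minors_ideal_C"
  "Var 2 * Var 5 - Var 3 * Var 4 \<in> minors_ideal_C" "Var 2 * Var 6 - Var 4 * Var 4 \<in> minors_ideal_C"
  "Var 3 * Var 6 - Var 4 * Var 5 \<in> minors_ideal_C"
  unfolding minors_ideal_C_def minors_C_def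
  by (rule idl_base; (rule insertI1 | rule insertI2)+)+

lemma minors_ideal_C_minimal:
  assumes "ideal I (type_ring :: (7, 'k::field_char_0) mpoly ring)"
    "Var 0 * Var 3 - Var 1 * Var 2 \<in> I" "Var 0 * Var 4 - Var 2 * Var 2 \<in> I"
    "Var 1 * Var 4 - Var 2 * Var 3 \<in> I" "Var 0 * Var 5 - Var 1 * Var 4 \<in> I"
    "Var 0 * Var 6 - Var 2 * Var 4 \<in> I" "Var 1 * Var 6 - Var 2 * Var 5 \<in> I"
    "Var 2 * Var 5 - Var 3 * Var 4 \<in> I" "Var 2 * Var 6 - Var 4 * Var 4 \<in> I"
    "Var 3 * Var 6 - Var 4 * Var 5 \<in> I"
  shows "minors_ideal_C \<subseteq> I"
  unfolding minors_ideal_C_def minors_C_def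
  by (intro idl_minimal insert_subsetI empty_subsetI assms)

lemma minors_ideal_C_subset_even: "minors_ideal_C \<subseteq> even_ideal"
  by (rule minors_ideal_C_minimal) (simp_all add: even_ideal_iff)

lemma minors_ideal_C_subset_scroll: "minors_ideal_C \<subseteq> scroll_ideal"
  by (rule minors_ideal_C_minimal) (simp_all add: scroll_minors)

text \<open>
  The ideal of the scroll is that of the minors plus \<open>(q)\<close>, and \<open>q\<close> is outside of the prime ideal \<open>m\<close>. So an
  element of the intersection with \<open>m\<close> is, up to minors, a multiple \<open>r q\<close> with \<open>r\<close> in
  \<open>m\<close>; it remains to see that these products are combinations of the minors.
\<close>

lemma even_times_conic:
  assumes "r \<in> even_ideal"
  shows "r * conic_form Var \<in> minors_ideal_C"
proof -
  let ?M = "{r. r * conic_form Var \<in> (minors_ideal_C :: (7, 'a) mpoly set)}"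
  note I = ideals(2)
  have "ideal ?M type_ring"
    by (auto simp: ideal_iff distrib_right mult.assoc intro: idealD[OF I])
  moreover have "Var ` {0, 2, 4, 6} \<subseteq> ?M"
  proof -
    have "Var 0 * conic_form Var = Var 1 * (Var 0 * Var 5 - Var 1 * Var 4) + Var 1 * (Var 1 * Var 4 - Var 2 * Var 3)
        - Var 3 * (Var 0 * Var 3 - Var 1 * Var 2 :: (7, 'a) mpoly)"
      unfolding conic_form_def by (simp add: algebra_simps power2_eq_square)
    then have 0: "Var 0 * conic_form Var \<in> (minors_ideal_C :: (7, 'a) mpoly set)"
      by (metis ideal_add[OF I] ideal_diff[OF I] ideal_mult[OF I] minors_C_mem)
    have "Var 2 * conic_form Var = Var 1 * (Var 2 * Var 5 - Var 3 * Var 4)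
        + Var 3 * (Var 1 * Var 4 - Var 2 * Var 3 :: (7, 'a) mpoly)"
      unfolding conic_form_def by (simp add: algebra_simps power2_eq_square)
    then have 2: "Var 2 * conic_form Var \<in> (minors_ideal_C :: (7, 'a) mpoly set)"
      by (metis ideal_add[OF I] ideal_diff[OF I] ideal_mult[OF I] minors_C_mem)
    have "Var 4 * conic_form Var = Var 5 * (Var 1 * Var 4 - Var 2 * Var 3)
        + Var 3 * (Var 2 * Var 5 - Var 3 * Var 4 :: (7, 'a) mpoly)"
      unfolding conic_form_def by (simp add: algebra_simps power2_eq_square)
    then have 4: "Var 4 * conic_form Var \<in> (minors_ideal_C :: (7, 'a) mpoly set)"
      by (metis ideal_add[OF I] ideal_diff[OF I] ideal_mult[OF I] minors_C_mem)
    have "Var 6 * conic_form Var = Var 5 * (Var 1 * Var 6 - Var 2 * Var 5) + Var 5 * (Var 2 * Var 5 - Var 3 * Var 4)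
        - Var 3 * (Var 3 * Var 6 - Var 4 * Var 5 :: (7, 'a) mpoly)"
      unfolding conic_form_def by (simp add: algebra_simps power2_eq_square)
    then have 6: "Var 6 * conic_form Var \<in> (minors_ideal_C :: (7, 'a) mpoly set)"
      by (metis ideal_add[OF I] ideal_diff[OF I] ideal_mult[OF I] minors_C_mem)
    show ?thesis using 0 2 4 6 by simp
  qed
  ultimately have "even_ideal \<subseteq> ?M"
    unfolding even_ideal_def by (rule idl_minimal)
  then show ?thesis using assms by blast
qed

lemma minors_ideal_C_eq: "minors_ideal_C = scroll_ideal \<inter> even_ideal"
proof (intro equalityI Int_greatest minors_ideal_C_subset_even minors_ideal_C_subset_scroll subsetI)
  fix g :: "(7, 'a) mpoly" assume "g \<in> scroll_ideal \<inter> even_ideal"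
  then have even: "g \<in> even_ideal" and scroll: "g \<in> scroll_ideal" by auto
  obtain r s where s: "s \<in> minors_ideal_C" and g: "g = r * conic_form Var + s"
    using scroll unfolding scroll_ideal_def minors_ideal_C_def by (rule idl_insertE)
  have "odd_part r * conic_form Var = 0"
    using even s minors_ideal_C_subset_even by (auto simp: g even_ideal_iff)
  then have "r \<in> even_ideal" by (simp add: even_ideal_iff)
  then show "g \<in> minors_ideal_C"
    unfolding g using ideal_add[OF ideals(2)] even_times_conic s by blast
qed

text \<open>
  One inclusion holds as \<open>m\<close> is a prime ideal that contains the minors and does not contain \<open>q\<close>, the other
  one as a product of ideals lies in their intersection.
\<close>

lemma colon_minors_scroll: "colon_ideal type_ring minors_ideal_C scroll_ideal = even_ideal"
proof (intro equalityI subsetI)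
  fix f :: "(7, 'a) mpoly" assume "f \<in> colon_ideal type_ring minors_ideal_C scroll_ideal"
  then have "f * conic_form Var \<in> even_ideal"
    using minors_ideal_C_subset_even conic_in_scroll_ideal by (auto simp: colon_ideal_def)
  then show "f \<in> even_ideal" by (simp add: even_ideal_iff)
next
  fix f :: "(7, 'a) mpoly" assume "f \<in> even_ideal"
  then show "f \<in> colon_ideal type_ring minors_ideal_C scroll_ideal"
    using ideal_mult[OF ideals(3)] ideal_mult_right[OF ideals(4)]
    by (auto simp: colon_ideal_def minors_ideal_C_eq)
qed

lemma minors_ideal_C_radical: "radical_ideal type_ring minors_ideal_C"
proof -
  have "f \<in> minors_ideal_C" if "f ^ n \<in> minors_ideal_C" for f :: "(7, 'a) mpoly" and n
    using that prime_power[OF prime_scroll_ideal, of f n] prime_power[OF prime_even_ideal, of f n]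
    unfolding minors_ideal_C_eq by blast
  then show ?thesis by (auto simp: radical_ideal_def radical_def intro: exI[of _ 1])
qed

definition embedded_ideal :: "(7, 'k::field_char_0) mpoly set" where
  "embedded_ideal = idl {Var 0, Var 2, Var 4, Var 6, conic_form Var}"

lemma conic_dvd_odd_part_scroll:
  assumes "g \<in> scroll_ideal"
  shows "conic_form Var dvd odd_part g"
proof -
  have "ideal {g. conic_form Var dvd odd_part g} (type_ring :: (7, 'a) mpoly ring)"
    by (auto simp: ideal_iff)
  moreover have "minors_C Var \<subseteq> {g :: (7, 'a) mpoly. odd_part g = 0}"
    using minors_ideal_C_subset_even idl_superset[of "minors_C Var"]
    unfolding minors_ideal_C_def even_ideal_iff[symmetric] by blast
  ultimately have "scroll_ideal \<subseteq> {g :: (7, 'a) mpoly. conic_form Var dvd odd_part g}"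
    unfolding scroll_ideal_def by (intro idl_minimal) auto
  then show ?thesis using assms by blast
qed

lemma minus_odd_part: "g - odd_part g \<in> even_ideal"
  by (simp add: even_ideal_iff)

lemma ideal_embedded [simp, intro]: "ideal embedded_ideal type_ring"
  by (simp add: embedded_ideal_def)

lemma even_subset_embedded: "even_ideal \<subseteq> embedded_ideal"
  unfolding even_ideal_def embedded_ideal_def
  by (rule idl_minimal) (auto intro: idl_base)

lemma embedded_ideal_iff: "g \<in> embedded_ideal \<longleftrightarrow> conic_form Var dvd odd_part g"
proof
  have "ideal {g. conic_form Var dvd odd_part g} (type_ring :: (7, 'a) mpoly ring)"
    by (auto simp: ideal_iff)
  then have "embedded_ideal \<subseteq> {g :: (7, 'a) mpoly. conic_form Var dvd odd_part g}"
    unfolding embedded_ideal_def by (rule idl_minimal) simp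
  then show "g \<in> embedded_ideal \<Longrightarrow> conic_form Var dvd odd_part g" by blast
  assume "conic_form Var dvd odd_part g"
  moreover have "conic_form Var \<in> embedded_ideal"
    unfolding embedded_ideal_def by (intro idl_base) simp
  ultimately have "odd_part g \<in> embedded_ideal"
    using ideal_mult_right[OF ideal_embedded] by (auto simp: dvd_def)
  then show "g \<in> embedded_ideal"
    using ideal_cong[OF ideal_embedded] minus_odd_part even_subset_embedded by blast
qed

lemma even_plus_scroll: "even_ideal <+>\<^bsub>type_ring\<^esub> scroll_ideal = embedded_ideal"
proof (intro equalityI subsetI)
  fix g :: "(7, 'a) mpoly" assume "g \<in> even_ideal <+>\<^bsub>type_ring\<^esub> scroll_ideal"
  then obtain a b where "a \<in> even_ideal" "b \<in> scroll_ideal" "g = a + b"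
    by (auto simp: set_add_def set_mult_def ring_of_type_algebra_def)
  then show "g \<in> embedded_ideal"
    by (auto simp: embedded_ideal_iff even_ideal_iff conic_dvd_odd_part_scroll)
next
  fix g :: "(7, 'a) mpoly" assume "g \<in> embedded_ideal"
  then have "odd_part g \<in> scroll_ideal"
    using ideal_mult_right[OF ideals(3) conic_in_scroll_ideal] by (auto simp: embedded_ideal_iff dvd_def)
  then have "\<exists>a\<in>even_ideal. \<exists>b\<in>scroll_ideal. g = a + b"
    using minus_odd_part[of g] by (intro bexI[of _ "g - odd_part g"] bexI[of _ "odd_part g"]) auto
  then show "g \<in> even_ideal <+>\<^bsub>type_ring\<^esub> scroll_ideal"
    by (auto simp: set_add_def set_mult_def ring_of_type_algebra_def)
qed

text \<open>
  In \<open>k[x\<^sub>1, x\<^sub>3, x\<^sub>5]\<close> the form \<open>q\<close> is prime, since there it generates the contraction of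
  the prime ideal of the scroll.
\<close>

lemma conic_prime_odd:
  fixes u v :: "(7, 'k::field_char_0) mpoly"
  assumes "conic_form Var dvd odd_part u * odd_part v"
  shows "conic_form Var dvd odd_part u \<or> conic_form Var dvd odd_part v"
proof -
  have "odd_part u * odd_part v \<in> scroll_ideal"
    using assms ideal_mult_right[OF ideals(3) conic_in_scroll_ideal] by (auto simp: dvd_def)
  then have "odd_part u \<in> scroll_ideal \<or> odd_part v \<in> scroll_ideal"
    by (rule prime_mult[OF prime_scroll_ideal])
  then show ?thesis
    using conic_dvd_odd_part_scroll[of "odd_part u"] conic_dvd_odd_part_scroll[of "odd_part v"] by auto
qed

lemma conic_square_cancel:
  fixes u v :: "(7, 'k::field_char_0) mpoly"
  assumes "(conic_form Var)\<^sup>2 dvd odd_part u * odd_part v" "\<not> conic_form Var dvd odd_part v"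
  shows "(conic_form Var)\<^sup>2 dvd odd_part u"
proof -
  have "conic_form Var dvd odd_part u * odd_part v"
    using assms(1) by (auto simp: power2_eq_square dest: dvd_mult_left)
  then have "conic_form Var dvd odd_part u" using conic_prime_odd assms(2) by blast
  then obtain w where "odd_part u = conic_form Var * w" by (auto simp: dvd_def)
  from arg_cong[OF this, of odd_part] have w: "odd_part u = conic_form Var * odd_part w" by simp
  then have "conic_form Var dvd odd_part w * odd_part v"
    using assms(1) by (simp add: power2_eq_square mult.assoc)
  then have "conic_form Var dvd odd_part w" using conic_prime_odd assms(2) by blast
  then show ?thesis by (simp add: w power2_eq_square)
qed

lemma not_conic_dvd_one: "\<not> conic_form Var dvd (1 :: (7, 'k::field_char_0) mpoly)"
proof
  assume "conic_form Var dvd (1 :: (7, 'k) mpoly)"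
  then have "1 \<in> (scroll_ideal :: (7, 'k) mpoly set)"
    using ideal_mult_right[OF ideals(3) conic_in_scroll_ideal] by (metis dvd_def)
  then show False using prime_proper[OF prime_scroll_ideal] by blast
qed

lemma prime_embedded_ideal: "primeideal embedded_ideal type_ring"
  unfolding prime_iff
  using conic_prime_odd not_conic_dvd_one by (auto simp: embedded_ideal_iff)

section \<open>The polar ideal\<close>

lemma ideal_numeral_cancel:
  fixes g :: "('v::finite, 'k::field_char_0) mpoly"
  assumes "ideal I type_ring" "numeral n * g \<in> I"
  shows "g \<in> I"
proof -
  have "Const (inverse (numeral n)) * (numeral n * g) = Const (inverse (numeral n) * numeral n) * g"
    unfolding Const_simps Const_numeral by (simp add: mult.assoc)
  also have "\<dots> = g" by (simp add: Const_simps)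
  finally show ?thesis using ideal_mult[OF assms] by metis
qed

lemma polar_mem: "polar Var i \<in> polar_ideal"
  unfolding polar_ideal_def by (rule idl_base) simp

lemma polar_combination: "(\<Sum>i\<in>UNIV. r i * polar Var i) \<in> polar_ideal"
  by (intro ideal_sum ideals ideal_mult polar_mem)

text \<open>
  Each of \<open>f\<^sub>2\<close> and \<open>f\<^sub>4\<close> is a difference of two minors, and the other \<open>f\<^sub>i\<close> are minors up to sign.
  So two of the nine minors generate the ideal of minors modulo the partial derivatives.
\<close>

definition gen_a :: "(7, 'k::field_char_0) mpoly" where
  "gen_a = Var 2 * Var 5 - Var 3 * Var 4"

definition gen_b :: "(7, 'k::field_char_0) mpoly" where
  "gen_b = Var 1 * Var 4 - Var 2 * Var 3"

text \<open>
  The coefficients of these combinations of \<open>f\<^sub>0, \<dots>, f\<^sub>6\<close> are linear forms, found by solving a linear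
  system over the rational numbers; a multiple by \<open>2\<close>, \<open>3\<close> or \<open>4\<close> clears the denominators. The last two
  memberships are the relations between \<open>a\<close> and \<open>b\<close> over \<open>k[x\<^sub>1, x\<^sub>3, x\<^sub>5]\<close>.
\<close>

lemma even_times_gen:
  fixes J :: "(7, 'k::field_char_0) mpoly set"
  defines "J \<equiv> polar_ideal"
  shows "Var 0 * gen_a \<in> J"
    "Var 2 * gen_a \<in> J"
    "Var 4 * gen_a \<in> J"
    "Var 6 * gen_a \<in> J"
    "Var 0 * gen_b \<in> J"
    "Var 2 * gen_b \<in> J"
    "Var 4 * gen_b \<in> J"
    "Var 6 * gen_b \<in> J"
    "Var 1 * gen_a - Var 3 * gen_b \<in> J"
    "Var 3 * gen_a - Var 5 * gen_b \<in> J"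
proof -
  have comb: "g \<in> J" if "g = (\<Sum>i\<in>UNIV. r i * polar Var i)" for g r
    using polar_combination[of r] that by (simp add: J_def)
  have cancel: "g \<in> J" if "numeral n * g \<in> J" for n g
    using ideal_numeral_cancel[OF ideals(1)] that unfolding J_def .
  note s = gen_a_def gen_b_def sum_7 polar_def seven_simps
  show "Var 0 * gen_a \<in> J"
    by (rule cancel[of "num.Bit1 num.One"], rule comb[of _ "seven 0 0 (2 * Var 0) (2 * Var 1) (Var 2) (Var 3) 0"]) (unfold s, simp add: algebra_simps)
  show "Var 2 * gen_a \<in> J"
    by (rule cancel[of "num.Bit0 (num.Bit0 num.One)"], rule comb[of _ "seven (- Var 0) (- 2 * Var 1) (2 * Var 2) (Var 3) (Var 4) 0 0"]) (unfold s, simp add: algebra_simps)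
  show "Var 4 * gen_a \<in> J"
    by (rule comb[of _ "seven (- Var 2) (- Var 3) 0 0 0 0 0"]) (unfold s, simp add: algebra_simps)
  show "Var 6 * gen_a \<in> J"
    by (rule comb[of _ "seven (- Var 4) (- Var 5) 0 0 0 0 0"]) (unfold s, simp add: algebra_simps)
  show "Var 0 * gen_b \<in> J"
    by (rule comb[of _ "seven 0 0 0 0 0 (- Var 1) (- Var 2)"]) (unfold s, simp add: algebra_simps)
  show "Var 2 * gen_b \<in> J"
    by (rule cancel[of "num.Bit1 num.One"], rule comb[of _ "seven 0 0 (Var 0) (Var 1) (2 * Var 2) (- Var 3) 0"]) (unfold s, simp add: algebra_simps)
  show "Var 4 * gen_b \<in> J"
    by (rule cancel[of "num.Bit0 num.One"], rule comb[of _ "seven (- Var 0) 0 0 (Var 3) (Var 4) 0 0"]) (unfold s, simp add: algebra_simps)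
  show "Var 6 * gen_b \<in> J"
    by (rule comb[of _ "seven (- 2 * Var 2) (- Var 3) (- Var 4) 0 0 0 0"]) (unfold s, simp add: algebra_simps)
  show "Var 1 * gen_a - Var 3 * gen_b \<in> J"
    by (rule comb[of _ "seven 0 0 0 0 (- Var 3) 0 (- Var 5)"]) (unfold s, simp add: algebra_simps)
  show "Var 3 * gen_a - Var 5 * gen_b \<in> J"
    by (rule comb[of _ "seven (Var 1) 0 (Var 3) 0 0 0 0"]) (unfold s, simp add: algebra_simps)
qed

lemma even_gen:
  fixes r :: "(7, 'a::field_char_0) mpoly"
  assumes "r \<in> even_ideal"
  shows "r * gen_a \<in> polar_ideal" "r * gen_b \<in> polar_ideal"
proof -
  have id: "ideal {r. r * g \<in> (polar_ideal :: (7, 'a) mpoly set)} type_ring" for g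
    by (auto simp: ideal_iff distrib_right mult.assoc intro: idealD[OF ideals(1)])
  have "even_ideal \<subseteq> {r :: (7, 'a) mpoly. r * gen_a \<in> polar_ideal}"
    unfolding even_ideal_def by (rule idl_minimal[OF id]) (simp add: even_times_gen)
  then show "r * gen_a \<in> polar_ideal" using assms by blast
  have "even_ideal \<subseteq> {r :: (7, 'a) mpoly. r * gen_b \<in> polar_ideal}"
    unfolding even_ideal_def by (rule idl_minimal[OF id]) (simp add: even_times_gen)
  then show "r * gen_b \<in> polar_ideal" using assms by blast
qed

lemma conic_gen:
  fixes J :: "(7, 'a::field_char_0) mpoly set"
  defines "J \<equiv> polar_ideal"
  shows "conic_form Var * gen_a \<in> J" "conic_form Var * gen_b \<in> J"
  unfolding J_def
proof -
  have "conic_form Var * gen_a = Var 5 * (Var 1 * gen_a - Var 3 * gen_b)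
      - Var 3 * (Var 3 * gen_a - Var 5 * gen_b :: (7, 'a) mpoly)"
    by (simp add: conic_form_def algebra_simps power2_eq_square)
  then show "conic_form Var * gen_a \<in> (polar_ideal :: (7, 'a) mpoly set)"
    using ideal_diff[OF ideals(1)] ideal_mult[OF ideals(1)] even_times_gen(9,10) by metis
  have "conic_form Var * gen_b = Var 3 * (Var 1 * gen_a - Var 3 * gen_b)
      - Var 1 * (Var 3 * gen_a - Var 5 * gen_b :: (7, 'a) mpoly)"
    by (simp add: conic_form_def algebra_simps power2_eq_square)
  then show "conic_form Var * gen_b \<in> (polar_ideal :: (7, 'a) mpoly set)"
    using ideal_diff[OF ideals(1)] ideal_mult[OF ideals(1)] even_times_gen(9,10) by metis
qed

lemma polar_in_minors_ideal_C: "polar Var i \<in> minors_ideal_C"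
proof -
  note I = ideals(2)
  have "polar Var 0 \<in> (minors_ideal_C :: (7, 'a) mpoly set)"
    using minors_C_mem(9) by (simp add: polar_def)
  moreover have "polar Var 1 \<in> (minors_ideal_C :: (7, 'a) mpoly set)"
    using ideal_uminus[OF I minors_C_mem(8)] by (simp add: polar_def)
  moreover have "polar Var 2 = (Var 2 * Var 5 - Var 3 * Var 4) - (Var 1 * Var 6 - Var 2 * Var 5 :: (7, 'a) mpoly)"
    by (simp add: polar_def)
  then have "polar Var 2 \<in> (minors_ideal_C :: (7, 'a) mpoly set)"
    using ideal_diff[OF I minors_C_mem(7) minors_C_mem(6)] by simp
  moreover have "polar Var 3 \<in> (minors_ideal_C :: (7, 'a) mpoly set)"
    using minors_C_mem(5) by (simp add: polar_def)
  moreover have "polar Var 4 = (Var 1 * Var 4 - Var 2 * Var 3) - (Var 0 * Var 5 - Var 1 * Var 4 :: (7, 'a) mpoly)"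
    by (simp add: polar_def)
  then have "polar Var 4 \<in> (minors_ideal_C :: (7, 'a) mpoly set)"
    using ideal_diff[OF I minors_C_mem(3) minors_C_mem(4)] by simp
  moreover have "polar Var 5 \<in> (minors_ideal_C :: (7, 'a) mpoly set)"
    using ideal_uminus[OF I minors_C_mem(2)] by (simp add: polar_def)
  moreover have "polar Var 6 \<in> (minors_ideal_C :: (7, 'a) mpoly set)"
    using minors_C_mem(1) by (simp add: polar_def)
  ultimately have "\<forall>i. polar Var i \<in> (minors_ideal_C :: (7, 'a) mpoly set)"
    unfolding forall_7 by blast
  then show ?thesis ..
qed

lemma polar_subset_minors: "polar_ideal \<subseteq> minors_ideal_C"
  unfolding polar_ideal_def by (rule idl_minimal) (auto simp: polar_in_minors_ideal_C)

lemma minors_ideal_C_cases: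
  assumes "g \<in> minors_ideal_C"
  obtains \<alpha> \<beta> j where "j \<in> polar_ideal" "g = \<alpha> * gen_a + \<beta> * gen_b + j"
proof -
  let ?I = "idl (insert gen_a (insert gen_b (range (polar Var)))) :: (7, 'a) mpoly set"
  have I: "ideal ?I type_ring" by simp
  have a: "gen_a \<in> ?I" and b: "gen_b \<in> ?I" by (auto intro: idl_base)
  have f: "polar Var i \<in> ?I" for i by (rule idl_base) simp
  have "minors_ideal_C \<subseteq> ?I"
  proof (rule minors_ideal_C_minimal[OF I])
    show "Var 0 * Var 3 - Var 1 * Var 2 \<in> ?I" using f[of 6] by (simp add: polar_def)
    show "Var 0 * Var 4 - Var 2 * Var 2 \<in> ?I" using ideal_uminus[OF I f[of 5]] by (simp add: polar_def)
    show "Var 1 * Var 4 - Var 2 * Var 3 \<in> ?I" using b by (simp add: gen_b_def)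
    show "Var 0 * Var 5 - Var 1 * Var 4 \<in> ?I" using ideal_diff[OF I b f[of 4]] by (simp add: gen_b_def polar_def)
    show "Var 0 * Var 6 - Var 2 * Var 4 \<in> ?I" using f[of 3] by (simp add: polar_def)
    show "Var 1 * Var 6 - Var 2 * Var 5 \<in> ?I" using ideal_diff[OF I a f[of 2]] by (simp add: gen_a_def polar_def)
    show "Var 2 * Var 5 - Var 3 * Var 4 \<in> ?I" using a by (simp add: gen_a_def)
    show "Var 2 * Var 6 - Var 4 * Var 4 \<in> ?I" using ideal_uminus[OF I f[of 1]] by (simp add: polar_def)
    show "Var 3 * Var 6 - Var 4 * Var 5 \<in> ?I" using f[of 0] by (simp add: polar_def)
  qed
  then have "g \<in> ?I" using assms by blast
  then obtain \<alpha> s where s: "s \<in> idl (insert gen_b (range (polar Var)))" "g = \<alpha> * gen_a + s"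
    by (rule idl_insertE)
  from s(1) obtain \<beta> j where "j \<in> polar_ideal" "s = \<beta> * gen_b + j"
    unfolding polar_ideal_def by (rule idl_insertE)
  then show ?thesis using s(2) that[of j \<alpha> \<beta>] by (simp add: add.assoc)
qed

text \<open>
  Since \<open>a\<close> and \<open>b\<close> generate the ideal of minors modulo the partial derivatives, only their products with the
  generators of the embedded prime have to be checked.
\<close>

lemma embedded_times_minors:
  assumes "r \<in> embedded_ideal" "g \<in> minors_ideal_C"
  shows "r * g \<in> polar_ideal"
proof -
  note J = ideals(1)
  have gen: "r * h \<in> polar_ideal" if h: "\<And>r. r \<in> even_ideal \<Longrightarrow> r * h \<in> polar_ideal"
    "conic_form Var * h \<in> polar_ideal" for h
  proof -
    have "ideal {r. r * h \<in> polar_ideal} type_ring"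
      by (auto simp: ideal_iff distrib_right mult.assoc intro: idealD[OF J])
    then have "embedded_ideal \<subseteq> {r. r * h \<in> polar_ideal}"
      unfolding embedded_ideal_def
      by (rule idl_minimal) (use h in \<open>auto simp: even_ideal_iff\<close>)
    then show ?thesis using assms(1) by blast
  qed
  obtain \<alpha> \<beta> j where g: "j \<in> polar_ideal" "g = \<alpha> * gen_a + \<beta> * gen_b + j"
    using assms(2) by (rule minors_ideal_C_cases)
  have "r * g = \<alpha> * (r * gen_a) + \<beta> * (r * gen_b) + r * j"
    by (simp add: g(2) algebra_simps)
  then show ?thesis
    using ideal_add[OF J ideal_add[OF J ideal_mult[OF J gen[OF even_gen(1) conic_gen(1)]]
          ideal_mult[OF J gen[OF even_gen(2) conic_gen(2)]]] ideal_mult[OF J g(1)]]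
    by metis
qed

section \<open>The embedded component\<close>

text \<open>
  Multiplied by a parameter \<open>z\<close>, these are values of \<open>x\<^sub>0, x\<^sub>2, x\<^sub>4, x\<^sub>6\<close> for which
  \<open>f\<^sub>2\<close>, \<open>f\<^sub>4\<close> and \<open>f\<^sub>6\<close> vanish: they solve \<open>f\<^sub>6 = 0\<close> for \<open>x\<^sub>2\<close>, \<open>f\<^sub>4 = 0\<close> for \<open>x\<^sub>4\<close> and
  \<open>f\<^sub>2 = 0\<close> for \<open>x\<^sub>6\<close>, with \<open>x\<^sub>0 = 2 x\<^sub>1\<^sup>3 z\<close> to avoid denominators. Then \<open>f\<^sub>0 = - q\<^sup>2 z\<close>, while the
  remaining \<open>f\<^sub>i\<close> are multiples of \<open>z\<^sup>2\<close>.
\<close>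

definition tangent_weight :: "7 \<Rightarrow> (7, 'k::field_char_0) mpoly" where
  "tangent_weight = seven (2 * Var 1 ^ 3) 0 (2 * Var 1 ^ 2 * Var 3) 0
     (Var 1 * (Var 1 * Var 5 + Var 3 ^ 2)) 0 (Var 3 * (3 * (Var 1 * Var 5) - Var 3 ^ 2))"

text \<open>
  The coefficient of \<open>z\<close> after this substitution; the constant coefficient is \<open>odd_part\<close>. It is a
  derivation along \<open>odd_part\<close>.
\<close>

definition tangent :: "(7, 'k::field_char_0) mpoly \<Rightarrow> (7, 'k) mpoly" where
  "tangent g = (\<Sum>i\<in>UNIV. odd_part (partial_deriv i g) * tangent_weight i)"

lemma tangent_simps [simp]:
  "tangent (f + g) = tangent f + tangent g" "tangent (f - g) = tangent f - tangent g"
  "tangent (- f) = - tangent f" "tangent (Const c) = 0"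
  "tangent (f * g) = odd_part f * tangent g + tangent f * odd_part g"
  "tangent (Var i) = tangent_weight i"
  by (simp_all add: tangent_def algebra_simps sum.distrib sum_subtractf sum_negf sum_distrib_left sum_distrib_right
        if_distrib[of odd_part] if_distrib[of "\<lambda>x. x * _"] if_distrib[of "\<lambda>x. _ * x"] cong: if_cong)

lemma tangent_const [simp]: "tangent 0 = 0" "tangent 1 = 0" "tangent (numeral n) = 0"
  using tangent_simps(4)[of 0] tangent_simps(4)[of 1] tangent_simps(4)[of "numeral n"]
  by (simp_all add: Const_simps Const_numeral)

lemma odd_part_tangent_weight: "odd_part (tangent_weight i) = tangent_weight i"
proof -
  have "\<forall>i. odd_part (tangent_weight i) = (tangent_weight i :: (7, 'a) mpoly)"
    unfolding forall_7 by (simp add: tangent_weight_def)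
  then show ?thesis ..
qed

lemma odd_part_tangent [simp]: "odd_part (tangent g) = tangent g"
proof -
  have "odd_part (sum f A) = (\<Sum>i\<in>A. odd_part (f i))" for f :: "7 \<Rightarrow> (7, 'a) mpoly" and A
    by (induction A rule: infinite_finite_induct) simp_all
  then show ?thesis by (simp add: tangent_def odd_part_tangent_weight)
qed

text \<open>
  The preimage of the ideal \<open>(q\<^sup>2, z\<^sup>2)\<close> under the substitution.
\<close>

definition embedded_component :: "(7, 'k::field_char_0) mpoly set" where
  "embedded_component = {g. (conic_form Var)\<^sup>2 dvd odd_part g \<and> (conic_form Var)\<^sup>2 dvd tangent g}"

lemma ideal_embedded_component [simp, intro]: "ideal embedded_component type_ring"
  by (auto simp: ideal_iff embedded_component_def)

lemma tangent_gen:
  "tangent gen_a = Var 1 * Var 3 * conic_form Var" "tangent gen_b = Var 1 ^ 2 * conic_form Var"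
  by (simp_all add: gen_a_def gen_b_def tangent_weight_def conic_form_def algebra_simps power2_eq_square power3_eq_cube)

lemma tangent_polar: "(conic_form Var)\<^sup>2 dvd tangent (polar Var i)"
proof -
  have "tangent (polar Var 0) = - (conic_form Var :: (7, 'a) mpoly)\<^sup>2"
    by (simp add: polar_def tangent_weight_def conic_form_def algebra_simps power2_eq_square power3_eq_cube)
  moreover have "tangent (polar Var 1) = (0 :: (7, 'a) mpoly)" "tangent (polar Var 2) = (0 :: (7, 'a) mpoly)"
    "tangent (polar Var 3) = (0 :: (7, 'a) mpoly)" "tangent (polar Var 4) = (0 :: (7, 'a) mpoly)"
    "tangent (polar Var 5) = (0 :: (7, 'a) mpoly)" "tangent (polar Var 6) = (0 :: (7, 'a) mpoly)"
    by (simp_all add: polar_def tangent_weight_def algebra_simps power2_eq_square power3_eq_cube)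
  ultimately have "\<forall>i. (conic_form Var)\<^sup>2 dvd tangent (polar Var i :: (7, 'a) mpoly)"
    unfolding forall_7 by simp
  then show ?thesis ..
qed

lemma polar_subset_component: "polar_ideal \<subseteq> embedded_component"
  unfolding polar_ideal_def
proof (rule idl_minimal[OF ideal_embedded_component])
  have "odd_part (polar Var i) = (0 :: (7, 'a) mpoly)" for i
    using polar_in_minors_ideal_C minors_ideal_C_subset_even by (auto simp flip: even_ideal_iff)
  then show "range (polar Var) \<subseteq> (embedded_component :: (7, 'a) mpoly set)"
    by (auto simp: embedded_component_def tangent_polar)
qed

lemma Var_dvd_iff: "Var i dvd g \<longleftrightarrow> subst (\<lambda>j. if j \<in> {i} then 0 else Var j) g = 0"
  unfolding ker_zero_vars
proof
  assume "g \<in> idl (Var ` {i})"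
  then have "g \<in> idl (insert (Var i) {})" by simp
  then obtain r s where "s \<in> idl ({} :: ('a, 'b) mpoly set)" "g = r * Var i + s" by (rule idl_insertE)
  then show "Var i dvd g" by simp
next
  assume "Var i dvd g"
  then show "g \<in> idl (Var ` {i})"
    using ideal_mult_right[OF ideal_idl idl_base[of "Var i" "Var ` {i}"]] by (auto simp: dvd_def)
qed

lemma Var_nonzero [simp]: "Var i \<noteq> (0 :: ('v::finite, 'k::comm_ring_1) mpoly)"
  unfolding Var_def by (metis lookup_single_eq lookup_zero zero_neq_one)

lemma not_conic_dvd_Var1: "\<not> conic_form Var dvd (Var 1 :: (7, 'k::field_char_0) mpoly)"
proof
  assume "conic_form Var dvd (Var 1 :: (7, 'k) mpoly)"
  then obtain r :: "(7, 'k) mpoly" where "Var 1 = conic_form Var * r" by (auto simp: dvd_def)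
  from arg_cong[OF this, of "subst (seven 0 1 0 1 0 1 0) :: _ \<Rightarrow> (7, 'k) mpoly"]
  show False by (simp add: conic_form_def)
qed

text \<open>
  An element of the ideal of minors is \<open>\<alpha> a + \<beta> b\<close> modulo the partial derivatives, with \<open>\<alpha>\<close> and
  \<open>\<beta>\<close> in \<open>k[x\<^sub>1, x\<^sub>3, x\<^sub>5]\<close> as the even variables kill \<open>a\<close> and \<open>b\<close>. Since the tangents of \<open>a\<close> and
  \<open>b\<close> are \<open>x\<^sub>1 x\<^sub>3 q\<close> and \<open>x\<^sub>1\<^sup>2 q\<close>, it lies in the embedded component only if \<open>q\<close> divides
  \<open>x\<^sub>3 \<alpha> + x\<^sub>1 \<beta>\<close>. This makes \<open>(\<alpha>, \<beta>)\<close> a combination of \<open>(x\<^sub>1, - x\<^sub>3)\<close> and \<open>(x\<^sub>3, - x\<^sub>5)\<close>, which are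
  the relations of \<open>a\<close> and \<open>b\<close> modulo the partial derivatives.
\<close>

lemma minors_Int_component: "minors_ideal_C \<inter> embedded_component = polar_ideal"
proof (intro equalityI Int_greatest polar_subset_minors polar_subset_component subsetI)
  note J = ideals(1)
  fix g :: "(7, 'a) mpoly" assume g: "g \<in> minors_ideal_C \<inter> embedded_component"
  then obtain \<alpha> \<beta> j where j: "j \<in> polar_ideal" and eq: "g = \<alpha> * gen_a + \<beta> * gen_b + j"
    by (auto elim: minors_ideal_C_cases)
  let ?q = "conic_form Var :: (7, 'a) mpoly"
  let ?a = "odd_part \<alpha>" and ?b = "odd_part \<beta>"
  have odd: "odd_part gen_a = (0 :: (7, 'a) mpoly)" "odd_part gen_b = (0 :: (7, 'a) mpoly)"
    by (simp_all add: gen_a_def gen_b_def)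
  have "?q\<^sup>2 dvd tangent g" "?q\<^sup>2 dvd tangent j"
    using g j polar_subset_component by (auto simp: embedded_component_def)
  then have "?q\<^sup>2 dvd ?a * tangent gen_a + ?b * tangent gen_b"
    by (auto simp: eq odd dvd_add_left_iff)
  also have "?a * tangent gen_a + ?b * tangent gen_b = ?q * (Var 1 * (?a * Var 3 + ?b * Var 1))"
    by (simp add: tangent_gen algebra_simps power2_eq_square)
  finally have "?q dvd odd_part (Var 1) * odd_part (\<alpha> * Var 3 + \<beta> * Var 1)"
    by (simp add: power2_eq_square)
  then have "?q dvd ?a * Var 3 + ?b * Var 1"
    using conic_prime_odd[of "Var 1" "\<alpha> * Var 3 + \<beta> * Var 1"] by (simp add: not_conic_dvd_Var1)
  then obtain \<gamma> where \<gamma>: "?a * Var 3 + ?b * Var 1 = ?q * \<gamma>" by (auto simp: dvd_def)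
  \<comment> \<open>Modulo \<open>x\<^sub>1\<close> the equation reads \<open>x\<^sub>3 (\<alpha> + x\<^sub>3 \<gamma>) = 0\<close>, which determines \<open>\<alpha>\<close> and then \<open>\<beta>\<close>.\<close>
  have "Var 3 * (?a + Var 3 * \<gamma>) = Var 1 * (Var 5 * \<gamma> - ?b)"
    using \<gamma> by (simp add: conic_form_def algebra_simps power2_eq_square)
  then have "Var 1 dvd Var 3 * (?a + Var 3 * \<gamma>)" by simp
  then have "Var 1 dvd ?a + Var 3 * \<gamma>"
    by (simp add: Var_dvd_iff)
  then obtain c where c: "?a = Var 1 * c - Var 3 * \<gamma>" by (auto simp: dvd_def algebra_simps)
  have "Var 1 * (Var 3 * c) = Var 1 * (Var 5 * \<gamma> - ?b)"
    using \<gamma> by (simp add: c conic_form_def algebra_simps power2_eq_square)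
  then have b: "?b = Var 5 * \<gamma> - Var 3 * c" by simp
  have "?a * gen_a + ?b * gen_b = c * (Var 1 * gen_a - Var 3 * gen_b) - \<gamma> * (Var 3 * gen_a - Var 5 * gen_b)"
    unfolding c b by (simp add: algebra_simps)
  then have ab: "?a * gen_a + ?b * gen_b \<in> polar_ideal"
    using ideal_diff[OF J] ideal_mult[OF J] even_times_gen(9,10) by metis
  have "g = (?a * gen_a + ?b * gen_b) + ((\<alpha> - ?a) * gen_a + (\<beta> - ?b) * gen_b) + j"
    by (simp add: eq algebra_simps)
  then show "g \<in> polar_ideal"
    using ideal_add[OF J ideal_add[OF J ab ideal_add[OF J even_gen(1)[OF minus_odd_part] even_gen(2)[OF minus_odd_part]]] j]
    by metis
qed

section \<open>Primary decomposition of the polar ideal\<close>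

text \<open>
  The third power suffices since \<open>(q, z)\<^sup>3 \<subseteq> (q\<^sup>2, z\<^sup>2)\<close>.
\<close>

lemma radical_embedded_component: "radical type_ring embedded_component = embedded_ideal"
proof (intro equalityI subsetI)
  fix f :: "(7, 'a) mpoly" assume "f \<in> radical type_ring embedded_component"
  then obtain n where "(conic_form Var)\<^sup>2 dvd odd_part (f ^ n)"
    by (auto simp: radical_def embedded_component_def)
  then have "f ^ n \<in> embedded_ideal"
    by (auto simp: embedded_ideal_iff power2_eq_square dest: dvd_mult_left)
  then show "f \<in> embedded_ideal" by (rule prime_power[OF prime_embedded_ideal])
next
  fix f :: "(7, 'a) mpoly" assume "f \<in> embedded_ideal"
  then obtain w where w: "odd_part f = conic_form Var * w" by (auto simp: embedded_ideal_iff dvd_def)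
  have "odd_part (f ^ 3) = (conic_form Var)\<^sup>2 * (conic_form Var * w ^ 3)"
    by (simp add: w power_mult_distrib power2_eq_square power3_eq_cube mult_ac)
  moreover have "tangent (f ^ 3) = (conic_form Var)\<^sup>2 * (3 * w\<^sup>2 * tangent f)"
    by (simp add: w power2_eq_square power3_eq_cube algebra_simps)
  ultimately have "f ^ 3 \<in> embedded_component" by (simp add: embedded_component_def)
  then show "f \<in> radical type_ring embedded_component" by (auto simp: radical_def)
qed

text \<open>
  A factor which is prime to \<open>q\<close> in \<open>k[x\<^sub>1, x\<^sub>3, x\<^sub>5]\<close> can be cancelled, first in the constant coefficient and then
  in the coefficient of \<open>z\<close>.
\<close>

lemma primary_embedded_component: "primary_ideal type_ring embedded_component"
  unfolding primary_ideal_def radical_embedded_component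
proof (intro conjI ballI impI ideal_embedded_component)
  have "1 \<notin> (embedded_component :: (7, 'a) mpoly set)"
    using not_conic_dvd_one by (auto simp: embedded_component_def power2_eq_square dest: dvd_mult_left)
  then show "embedded_component \<noteq> carrier (type_ring :: (7, 'a) mpoly ring)" by auto
next
  fix a b :: "(7, 'a) mpoly" assume "a \<otimes>\<^bsub>type_ring\<^esub> b \<in> embedded_component"
  then have o: "(conic_form Var)\<^sup>2 dvd odd_part a * odd_part b"
    and t: "(conic_form Var)\<^sup>2 dvd odd_part a * tangent b + tangent a * odd_part b"
    by (auto simp: embedded_component_def)
  show "a \<in> embedded_component \<or> b \<in> embedded_ideal"
  proof (cases "conic_form Var dvd odd_part b")
    case False
    have a: "(conic_form Var)\<^sup>2 dvd odd_part a" using o False by (rule conic_square_cancel)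
    then have "(conic_form Var)\<^sup>2 dvd odd_part (tangent a) * odd_part b"
      using t by (simp add: dvd_add_right_iff)
    then have "(conic_form Var)\<^sup>2 dvd tangent a" using conic_square_cancel False by fastforce
    then show ?thesis using a by (simp add: embedded_component_def)
  qed (simp add: embedded_ideal_iff)
qed

text \<open>
  So \<open>I / J\<close> is torsion-free over \<open>R / Q\<close>: this determines all annihilators of elements of \<open>I / J\<close>.
\<close>

lemma minors_mod_polar_torsion_free:
  assumes "g \<in> minors_ideal_C" "v * g \<in> polar_ideal" "v \<notin> embedded_ideal"
  shows "g \<in> polar_ideal"
proof -
  have "g * v \<in> embedded_component"
    using assms(2) polar_subset_component by (auto simp: mult.commute)
  then have "g \<in> embedded_component"
    using primary_embedded_component assms(3)
    by (auto simp: primary_ideal_def radical_embedded_component)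
  then show ?thesis using assms(1) minors_Int_component by blast
qed

lemma polar_ideal_eq: "polar_ideal = scroll_ideal \<inter> even_ideal \<inter> embedded_component"
  unfolding minors_ideal_C_eq[symmetric] minors_Int_component ..

lemma Var0_square_not_in_scroll: "Var 0 ^ 2 \<notin> scroll_ideal"
  by (simp add: scroll_ideal_iff scroll_param_def)

lemma Var0_square_in_component: "Var 0 ^ 2 \<in> embedded_component"
  by (simp add: embedded_component_def power2_eq_square)

lemma Var0_square_in_even: "Var 0 ^ 2 \<in> even_ideal"
  by (simp add: even_ideal_iff)

lemma gen_a_not_in_polar: "gen_a \<notin> polar_ideal"
proof
  assume "gen_a \<in> (polar_ideal :: (7, 'a) mpoly set)"
  then have "(conic_form Var)\<^sup>2 dvd tangent (gen_a :: (7, 'a) mpoly)"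
    using polar_subset_component by (auto simp: embedded_component_def)
  then obtain r where "conic_form Var * (Var 1 * Var 3) = conic_form Var * (conic_form Var * r :: (7, 'a) mpoly)"
    by (auto simp: tangent_gen dvd_def power2_eq_square mult_ac)
  then have "Var 1 * Var 3 = (conic_form Var * r :: (7, 'a) mpoly)" by simp
  from arg_cong[OF this, of "subst (seven 0 1 0 1 0 1 0) :: _ \<Rightarrow> (7, 'a) mpoly"]
  show False by (simp add: conic_form_def)
qed

lemma gen_a_in_minors: "gen_a \<in> minors_ideal_C"
  unfolding gen_a_def by (rule minors_C_mem)

lemma scroll_even_incomparable:
  shows "\<not> scroll_ideal \<subseteq> (even_ideal :: (7, 'k::field_char_0) mpoly set)" "\<not> even_ideal \<subseteq> (scroll_ideal :: (7, 'k) mpoly set)"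
proof -
  have "conic_form Var \<notin> (even_ideal :: (7, 'k) mpoly set)" by (simp add: even_ideal_iff)
  then show "\<not> scroll_ideal \<subseteq> (even_ideal :: (7, 'k) mpoly set)" using conic_in_scroll_ideal by blast
  show "\<not> even_ideal \<subseteq> (scroll_ideal :: (7, 'k) mpoly set)"
    using Var0_square_in_even Var0_square_not_in_scroll by blast
qed

text \<open>
  Because \<open>Q I \<subseteq> J\<close>, a prime ideal above \<open>J\<close> contains \<open>I = P \<inter> m\<close> or \<open>Q\<close>, which contains \<open>m\<close>.
\<close>

lemma prime_above_polar:
  assumes p: "primeideal p type_ring" and "polar_ideal \<subseteq> p"
  shows "scroll_ideal \<subseteq> p \<or> even_ideal \<subseteq> p"
proof (cases "minors_ideal_C \<subseteq> p")
  case True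
  then show ?thesis
    unfolding minors_ideal_C_eq by (intro prime_Int_subset[OF p]) auto
next
  case False
  then obtain g where g: "g \<in> minors_ideal_C" "g \<notin> p" by blast
  have "r \<in> p" if "r \<in> embedded_ideal" for r
    using prime_mult[OF p, of r g] embedded_times_minors[OF that g(1)] g(2) assms(2) by blast
  then show ?thesis using even_subset_embedded by blast
qed

lemma minimal_primes_polar: "minimal_primes type_ring polar_ideal = {scroll_ideal, even_ideal}"
proof -
  have sub: "polar_ideal \<subseteq> (scroll_ideal :: (7, 'a) mpoly set)" "polar_ideal \<subseteq> (even_ideal :: (7, 'a) mpoly set)"
    unfolding polar_ideal_eq by auto
  have "scroll_ideal \<in> minimal_primes type_ring (polar_ideal :: (7, 'a) mpoly set)"
    "even_ideal \<in> minimal_primes type_ring (polar_ideal :: (7, 'a) mpoly set)"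
    using prime_above_polar scroll_even_incomparable prime_scroll_ideal prime_even_ideal sub
    unfolding minimal_primes_def by blast+
  moreover have "p = scroll_ideal \<or> p = even_ideal"
    if "p \<in> minimal_primes type_ring (polar_ideal :: (7, 'a) mpoly set)" for p
    using that prime_above_polar[of p] prime_scroll_ideal prime_even_ideal sub
    unfolding minimal_primes_def by blast
  ultimately show ?thesis by blast
qed

lemma even_proper_subset_embedded: "even_ideal \<subset> embedded_ideal"
proof -
  have "conic_form Var \<in> embedded_ideal" "conic_form Var \<notin> even_ideal"
    by (simp_all add: embedded_ideal_iff even_ideal_iff)
  then show ?thesis using even_subset_embedded by blast
qed

lemma embedded_neq_scroll: "embedded_ideal \<noteq> scroll_ideal"
  using even_subset_embedded scroll_even_incomparable(2) by blast

lemma polar_primary_decomposition: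
  "irredundant_primary_decomposition type_ring polar_ideal {scroll_ideal, even_ideal, embedded_component}"
proof -
  let ?D = "{scroll_ideal, even_ideal, embedded_component} :: (7, 'a) mpoly set set"
  have rad: "radical type_ring (scroll_ideal :: (7, 'a) mpoly set) = scroll_ideal"
    "radical type_ring (even_ideal :: (7, 'a) mpoly set) = even_ideal"
    by (simp_all add: radical_prime prime_scroll_ideal prime_even_ideal)
  have ne: "scroll_ideal \<noteq> (even_ideal :: (7, 'a) mpoly set)"
    "embedded_ideal \<noteq> (scroll_ideal :: (7, 'a) mpoly set)" "embedded_ideal \<noteq> (even_ideal :: (7, 'a) mpoly set)"
    using scroll_even_incomparable even_proper_subset_embedded embedded_neq_scroll by blast+
  show ?thesis
    unfolding irredundant_primary_decomposition_def
  proof (intro conjI)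
    show "\<forall>q\<in>?D. primary_ideal type_ring q"
      using primary_ideal_prime[OF prime_scroll_ideal] primary_ideal_prime[OF prime_even_ideal]
        primary_embedded_component by simp
    show "polar_ideal = carrier type_ring \<inter> \<Inter>?D"
      using polar_ideal_eq by auto
    show "inj_on (radical type_ring) ?D"
      unfolding inj_on_def using rad radical_embedded_component ne by auto
    \<comment> \<open>The squares \<open>x\<^sub>0\<^sup>2\<close> and \<open>q\<^sup>2\<close> and the minor \<open>a\<close> are each missed by exactly one component.\<close>
    show "\<forall>q\<in>?D. carrier type_ring \<inter> \<Inter>(?D - {q}) \<noteq> polar_ideal"
    proof
      fix q assume "q \<in> ?D"
      moreover have "Var 0 ^ 2 \<in> \<Inter>(?D - {scroll_ideal})" "Var 0 ^ 2 \<notin> (polar_ideal :: (7, 'a) mpoly set)"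
        using Var0_square_not_in_scroll Var0_square_in_component Var0_square_in_even polar_ideal_eq by auto
      moreover have "(conic_form Var)\<^sup>2 \<in> \<Inter>(?D - {even_ideal})" "(conic_form Var)\<^sup>2 \<notin> (polar_ideal :: (7, 'a) mpoly set)"
      proof -
        have "(conic_form Var)\<^sup>2 \<in> (scroll_ideal :: (7, 'a) mpoly set)"
          using ideal_mult[OF ideals(3) conic_in_scroll_ideal] by (simp add: power2_eq_square)
        moreover have "tangent (conic_form Var) = (0 :: (7, 'a) mpoly)"
          by (simp add: conic_form_def tangent_weight_def power2_eq_square)
        then have "(conic_form Var)\<^sup>2 \<in> (embedded_component :: (7, 'a) mpoly set)"
          by (simp add: embedded_component_def power2_eq_square)
        moreover have "(conic_form Var)\<^sup>2 \<notin> (even_ideal :: (7, 'a) mpoly set)"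
          by (simp add: even_ideal_iff)
        ultimately show "(conic_form Var)\<^sup>2 \<in> \<Inter>(?D - {even_ideal})" "(conic_form Var)\<^sup>2 \<notin> (polar_ideal :: (7, 'a) mpoly set)"
          using polar_ideal_eq by auto
      qed
      moreover have "gen_a \<in> \<Inter>(?D - {embedded_component})" "gen_a \<notin> (polar_ideal :: (7, 'a) mpoly set)"
        using gen_a_in_minors gen_a_not_in_polar minors_ideal_C_eq by auto
      ultimately show "carrier type_ring \<inter> \<Inter>(?D - {q}) \<noteq> polar_ideal"
        by (metis Int_UNIV_left insertE singletonD type_ring_simps(1))
    qed
  qed simp
qed

lemma minimal_part_polar: "minimal_part type_ring polar_ideal = minors_ideal_C"
proof -
  have rad: "radical type_ring (scroll_ideal :: (7, 'a) mpoly set) = scroll_ideal"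
    "radical type_ring (even_ideal :: (7, 'a) mpoly set) = even_ideal"
    by (simp_all add: radical_prime prime_scroll_ideal prime_even_ideal)
  have "embedded_ideal \<notin> {scroll_ideal, even_ideal :: (7, 'a) mpoly set}"
    using even_proper_subset_embedded embedded_neq_scroll by blast
  then have "{q \<in> {scroll_ideal, even_ideal, embedded_component}.
      radical type_ring q \<in> {scroll_ideal, even_ideal :: (7, 'a) mpoly set}} = {scroll_ideal, even_ideal}"
    using rad radical_embedded_component by auto
  then show ?thesis
    unfolding minimal_part_eq[OF polar_primary_decomposition] minimal_primes_polar minors_ideal_C_eq by simp
qed

text \<open>
  Let \<open>p\<close> be the annihilator of the class of \<open>f\<close>. For \<open>f\<close> in \<open>I\<close> it is \<open>Q\<close>, by torsion-freeness.
  Otherwise \<open>f\<close> is outside of one of the primes \<open>P\<close> and \<open>m\<close>, which then contains \<open>p\<close>, and it is equal to \<open>p\<close>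
  by minimality.
\<close>

lemma associated_primes_polar:
  "associated_primes type_ring polar_ideal \<subseteq> {scroll_ideal, even_ideal, embedded_ideal}"
proof
  fix p :: "(7, 'a) mpoly set" assume "p \<in> associated_primes type_ring polar_ideal"
  then obtain f where p: "primeideal p type_ring" and eq: "p = {r. r * f \<in> polar_ideal}"
    by (auto simp: associated_primes_def)
  have sub: "polar_ideal \<subseteq> p"
    unfolding eq using ideal_mult_right[OF ideals(1)] by blast
  show "p \<in> {scroll_ideal, even_ideal, embedded_ideal}"
  proof (cases "f \<in> minors_ideal_C")
    case True
    have "f \<notin> polar_ideal" using prime_proper[OF p] by (simp add: eq)
    then have "p = embedded_ideal"
      unfolding eq using minors_mod_polar_torsion_free[OF True] embedded_times_minors[OF _ True] by blast
    then show ?thesis by simp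
  next
    case False
    have "p \<subseteq> scroll_ideal" if "f \<notin> scroll_ideal"
      using that prime_mult[OF prime_scroll_ideal] polar_ideal_eq unfolding eq by blast
    moreover have "p \<subseteq> even_ideal" if "f \<notin> even_ideal"
      using that prime_mult[OF prime_even_ideal] polar_ideal_eq unfolding eq by blast
    ultimately show ?thesis
      using False prime_above_polar[OF p sub] scroll_even_incomparable minors_ideal_C_eq by blast
  qed
qed

text \<open>
  The embedded prime is the annihilator of the class of \<open>a\<close>.
\<close>

lemma embedded_primes_polar: "embedded_primes type_ring polar_ideal = {embedded_ideal}"
proof -
  have "embedded_ideal = {r. r * gen_a \<in> (polar_ideal :: (7, 'a) mpoly set)}"
    using minors_mod_polar_torsion_free[OF gen_a_in_minors] embedded_times_minors[OF _ gen_a_in_minors]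
      gen_a_not_in_polar by blast
  then have "embedded_ideal \<in> associated_primes type_ring (polar_ideal :: (7, 'a) mpoly set)"
    using prime_embedded_ideal by (auto simp: associated_primes_def)
  moreover have "embedded_ideal \<notin> minimal_primes type_ring (polar_ideal :: (7, 'a) mpoly set)"
    using even_proper_subset_embedded embedded_neq_scroll minimal_primes_polar by blast
  ultimately show ?thesis
    using associated_primes_polar minimal_primes_polar by (fastforce simp: embedded_primes_def)
qed

section \<open>The determinant and its minors\<close>

text \<open>
  The determinant, expanded along its first row.
\<close>

definition cubic :: "(7 \<Rightarrow> 'a::comm_ring_1) \<Rightarrow> 'a" where
  "cubic x = x 0 * (x 3 * x 6 - x 4 * x 5) - x 1 * (x 2 * x 6 - x 4 * x 4) + x 2 * (x 2 * x 5 - x 3 * x 4)"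

lemma det_eq_cubic:
  "det (vector [vector [x 0, x 1, x 2], vector [x 2, x 3, x 4], vector [x 4, x 5, x 6]] :: 'a::comm_ring_1 ^ 3 ^ 3)
    = cubic x"
  by (simp add: det_3 cubic_def algebra_simps)

lemma partial_deriv_cubic: "partial_deriv i (cubic Var) = polar Var i"
proof -
  have "\<forall>i. partial_deriv i (cubic Var :: (7, 'a) mpoly) = polar Var i"
    unfolding forall_7 by (simp add: cubic_def polar_def algebra_simps)
  then show ?thesis ..
qed

text \<open>
  Minors with a repeated row or column are zero, so that the indices need not be distinct.
\<close>

lemma minors_ideal_2:
  fixes A :: "'a::comm_ring_1 ^ 'n ^ 'm"
  shows "minors_ideal TYPE(2) A = idl {A $ i $ k * A $ j $ l - A $ i $ l * A $ j $ k | i j k l. True}"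
    (is "_ = idl ?S")
  unfolding minors_ideal_def
proof (rule idl_eqI)
  fix a assume "a \<in> {det (\<chi> i j. A $ r i $ c j) | (r :: 2 \<Rightarrow> 'm) (c :: 2 \<Rightarrow> 'n). inj r \<and> inj c}"
  then obtain r :: "2 \<Rightarrow> 'm" and c :: "2 \<Rightarrow> 'n" where "a = det (\<chi> i j. A $ r i $ c j)" by blast
  then have "a \<in> ?S" by (auto simp: det_2)
  then show "a \<in> idl ?S" by (rule idl_base)
next
  let ?T = "{det (\<chi> i j. A $ r i $ c j) | (r :: 2 \<Rightarrow> 'm) (c :: 2 \<Rightarrow> 'n). inj r \<and> inj c}"
  fix a assume "a \<in> ?S"
  then obtain i j k l where a: "a = A $ i $ k * A $ j $ l - A $ i $ l * A $ j $ k" by blast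
  show "a \<in> idl ?T"
  proof (cases "i = j \<or> k = l")
    case True
    then have "a = 0" by (auto simp: a mult.commute)
    then show ?thesis by (simp add: ideal_0)
  next
    case False
    let ?r = "\<lambda>t::2. if t = 1 then i else j" and ?c = "\<lambda>t::2. if t = 1 then k else l"
    have "inj ?r" "inj ?c"
      using False exhaust_2 by (auto simp: inj_on_def split: if_splits)
    moreover have "a = det (\<chi> s t. A $ ?r s $ ?c t)"
      by (simp add: det_2 a)
    ultimately have "a \<in> ?T"
      unfolding mem_Collect_eq by (intro exI[of _ ?r] exI[of _ ?c] conjI)
    then show ?thesis by (rule idl_base)
  qed
qed

lemma exhaust_5: "i = 1 \<or> i = 2 \<or> i = 3 \<or> i = 4 \<or> i = (5::5)"
proof (induct i)
  case (of_int z)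
  hence "z = 0 \<or> z = 1 \<or> z = 2 \<or> z = 3 \<or> z = 4" by simp arith
  then show ?case by auto
qed

lemma vector_5 [simp]:
  fixes a b c d e :: "'a::zero"
  shows
  "(vector [a, b, c, d, e] :: 'a ^ 5) $ 1 = a" "(vector [a, b, c, d, e] :: 'a ^ 5) $ 2 = b"
  "(vector [a, b, c, d, e] :: 'a ^ 5) $ 3 = c" "(vector [a, b, c, d, e] :: 'a ^ 5) $ 4 = d"
  "(vector [a, b, c, d, e] :: 'a ^ 5) $ 5 = e"
  unfolding vector_def by simp_all

text \<open>
  Minors alternate in their rows and in their columns: one minor for each pair of rows and each pair of columns decides
  whether an ideal contains all of them.
\<close>

lemma alternating_mem:
  assumes I: "ideal I (type_ring :: 'a::comm_ring_1 ring)"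
    and d: "\<And>i. d i i = 0" "\<And>i j. d j i = - d i j"
    and mem: "\<And>i j. d i j \<in> I \<or> d j i \<in> I \<or> i = j"
  shows "d i j \<in> I"
  using mem[of i j] d ideal_0[OF I] ideal_uminus[OF I] by metis

lemma alternating_2:
  fixes d :: "2 \<Rightarrow> 2 \<Rightarrow> 'a::comm_ring_1"
  assumes "ideal I (type_ring :: 'a ring)" "\<And>i. d i i = 0" "\<And>i j. d j i = - d i j" "d 1 2 \<in> I"
  shows "d i j \<in> I"
  using assms(1-3)
proof (rule alternating_mem)
  show "d i j \<in> I \<or> d j i \<in> I \<or> i = j" for i j
    using exhaust_2[of i] exhaust_2[of j] assms(4) by auto
qed

lemma alternating_3:
  fixes d :: "3 \<Rightarrow> 3 \<Rightarrow> 'a::comm_ring_1"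
  assumes "ideal I (type_ring :: 'a ring)" "\<And>i. d i i = 0" "\<And>i j. d j i = - d i j"
    "d 1 2 \<in> I" "d 1 3 \<in> I" "d 2 3 \<in> I"
  shows "d i j \<in> I"
  using assms(1-3)
proof (rule alternating_mem)
  show "d i j \<in> I \<or> d j i \<in> I \<or> i = j" for i j
    using exhaust_3[of i] exhaust_3[of j] assms(4-) by auto
qed

lemma alternating_5:
  fixes d :: "5 \<Rightarrow> 5 \<Rightarrow> 'a::comm_ring_1"
  assumes "ideal I (type_ring :: 'a ring)" "\<And>i. d i i = 0" "\<And>i j. d j i = - d i j"
    "d 1 2 \<in> I" "d 1 3 \<in> I" "d 1 4 \<in> I" "d 1 5 \<in> I" "d 2 3 \<in> I" "d 2 4 \<in> I" "d 2 5 \<in> I"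
    "d 3 4 \<in> I" "d 3 5 \<in> I" "d 4 5 \<in> I"
  shows "d i j \<in> I"
  using assms(1-3)
proof (rule alternating_mem)
  show "d i j \<in> I \<or> d j i \<in> I \<or> i = j" for i j
    using exhaust_5[of i] exhaust_5[of j] assms(4-) by (elim disjE) simp_all
qed

lemma minors_ideal_catalecticant:
  "minors_ideal TYPE(2) (vector [vector [Var 0, Var 1, Var 2], vector [Var 2, Var 3, Var 4],
      vector [Var 4, Var 5, Var 6]] :: (7, 'k::field_char_0) mpoly ^ 3 ^ 3) = minors_ideal_C"
  (is "minors_ideal _ ?C = _")
proof -
  let ?d = "\<lambda>i j k l. ?C $ i $ k * ?C $ j $ l - ?C $ i $ l * ?C $ j $ k"
  let ?S = "{?d i j k l | i j k l. True}"
  have "?d i j k l \<in> minors_ideal_C" for i j k l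
  proof (rule alternating_3[of _ "\<lambda>i j. ?d i j k l"])
    have rows: "?d i j k l \<in> minors_ideal_C"
      if "?d i j 1 2 \<in> minors_ideal_C" "?d i j 1 3 \<in> minors_ideal_C" "?d i j 2 3 \<in> minors_ideal_C" for i j
      by (rule alternating_3[of _ "?d i j"]) (use that in \<open>auto simp: mult.commute\<close>)
    show "?d 1 2 k l \<in> minors_ideal_C"
      by (rule rows) (use minors_C_mem(1-3) in \<open>simp_all add: mult.commute\<close>)
    show "?d 1 3 k l \<in> minors_ideal_C"
      by (rule rows) (use minors_C_mem(4-6) in \<open>simp_all add: mult.commute\<close>)
    show "?d 2 3 k l \<in> minors_ideal_C"
      by (rule rows) (use minors_C_mem(7-9) in \<open>simp_all add: mult.commute\<close>)
  qed (auto simp: mult.commute)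
  then have "idl ?S \<subseteq> minors_ideal_C"
    by (intro idl_minimal) auto
  moreover have "minors_ideal_C \<subseteq> idl ?S"
  proof (rule minors_ideal_C_minimal[OF ideal_idl])
    have d: "?d i j k l \<in> idl ?S" for i j k l by (intro idl_base) blast
    show "Var 0 * Var 3 - Var 1 * Var 2 \<in> idl ?S" using d[of 1 1 2 2] by simp
    show "Var 0 * Var 4 - Var 2 * Var 2 \<in> idl ?S" using d[of 1 1 2 3] by simp
    show "Var 1 * Var 4 - Var 2 * Var 3 \<in> idl ?S" using d[of 1 2 2 3] by simp
    show "Var 0 * Var 5 - Var 1 * Var 4 \<in> idl ?S" using d[of 1 1 3 2] by simp
    show "Var 0 * Var 6 - Var 2 * Var 4 \<in> idl ?S" using d[of 1 1 3 3] by simp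
    show "Var 1 * Var 6 - Var 2 * Var 5 \<in> idl ?S" using d[of 1 2 3 3] by simp
    show "Var 2 * Var 5 - Var 3 * Var 4 \<in> idl ?S" using d[of 2 1 3 2] by simp
    show "Var 2 * Var 6 - Var 4 * Var 4 \<in> idl ?S" using d[of 2 1 3 3] by simp
    show "Var 3 * Var 6 - Var 4 * Var 5 \<in> idl ?S" using d[of 2 2 3 3] by simp
  qed
  ultimately show ?thesis unfolding minors_ideal_2 by blast
qed

lemma minors_ideal_scroll:
  "minors_ideal TYPE(2) (vector [vector [Var 0, Var 1, Var 2, Var 3, Var 4],
      vector [Var 2, Var 3, Var 4, Var 5, Var 6]] :: (7, 'k::field_char_0) mpoly ^ 5 ^ 2) = scroll_ideal"
  (is "minors_ideal _ ?C = _")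
proof -
  let ?d = "\<lambda>i j k l. ?C $ i $ k * ?C $ j $ l - ?C $ i $ l * ?C $ j $ k"
  let ?S = "{?d i j k l | i j k l. True}"
  have sum: "Var 0 * Var 5 - Var 3 * Var 2 \<in> (scroll_ideal :: (7, 'k) mpoly set)"
    "Var 1 * Var 6 - Var 4 * Var 3 \<in> (scroll_ideal :: (7, 'k) mpoly set)"
    using ideal_add[OF ideals(3) scroll_minors(4) scroll_minors(3)]
      ideal_add[OF ideals(3) scroll_minors(6) scroll_minors(7)] by (simp_all add: mult.commute)
  have "?d i j k l \<in> scroll_ideal" for i j k l
  proof (rule alternating_2[of _ "\<lambda>i j. ?d i j k l"])
    show "?d 1 2 k l \<in> scroll_ideal"
    proof (rule alternating_5[of _ "?d 1 2"])
      show "?d 1 2 1 2 \<in> scroll_ideal" using scroll_minors(1) by (simp add: mult.commute)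
      show "?d 1 2 1 3 \<in> scroll_ideal" using scroll_minors(2) by simp
      show "?d 1 2 1 4 \<in> scroll_ideal" using sum by simp
      show "?d 1 2 1 5 \<in> scroll_ideal" using scroll_minors(5) by (simp add: mult.commute)
      show "?d 1 2 2 3 \<in> scroll_ideal" using scroll_minors(3) by simp
      show "?d 1 2 2 4 \<in> scroll_ideal" using scroll_minors(10) by simp
      show "?d 1 2 2 5 \<in> scroll_ideal" using sum by simp
      show "?d 1 2 3 4 \<in> scroll_ideal" using scroll_minors(7) by simp
      show "?d 1 2 3 5 \<in> scroll_ideal" using scroll_minors(8) by simp
      show "?d 1 2 4 5 \<in> scroll_ideal" using scroll_minors(9) by (simp add: mult.commute)
    qed (auto simp: mult.commute)
  qed (auto simp: mult.commute)
  then have "idl ?S \<subseteq> scroll_ideal"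
    by (intro idl_minimal) auto
  moreover have "scroll_ideal \<subseteq> idl ?S"
  proof -
    have d: "?d i j k l \<in> idl ?S" for i j k l by (intro idl_base) blast
    have "minors_ideal_C \<subseteq> idl ?S"
    proof (rule minors_ideal_C_minimal[OF ideal_idl])
      show "Var 0 * Var 3 - Var 1 * Var 2 \<in> idl ?S" using d[of 1 1 2 2] by simp
      show "Var 0 * Var 4 - Var 2 * Var 2 \<in> idl ?S" using d[of 1 1 2 3] by simp
      show b: "Var 1 * Var 4 - Var 2 * Var 3 \<in> idl ?S" using d[of 1 2 2 3] by (simp add: mult.commute)
      show "Var 0 * Var 6 - Var 2 * Var 4 \<in> idl ?S" using d[of 1 1 2 5] by (simp add: mult.commute)
      show a: "Var 2 * Var 5 - Var 3 * Var 4 \<in> idl ?S" using d[of 1 3 2 4] by simp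
      show "Var 2 * Var 6 - Var 4 * Var 4 \<in> idl ?S" using d[of 1 3 2 5] by simp
      show "Var 3 * Var 6 - Var 4 * Var 5 \<in> idl ?S" using d[of 1 4 2 5] by simp
      show "Var 0 * Var 5 - Var 1 * Var 4 \<in> idl ?S"
        using ideal_diff[OF ideal_idl d[of 1 1 2 4] b] by (simp add: mult.commute)
      show "Var 1 * Var 6 - Var 2 * Var 5 \<in> idl ?S"
        using ideal_diff[OF ideal_idl d[of 1 2 2 5] a] by (simp add: mult.commute)
    qed
    then have "minors_C Var \<subseteq> idl ?S"
      unfolding minors_ideal_C_def using idl_superset by blast
    moreover have "conic_form Var \<in> idl ?S"
      using d[of 1 2 2 4] by (simp add: conic_form_def power2_eq_square)
    ultimately show ?thesis
      unfolding scroll_ideal_def by (intro idl_minimal) auto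
  qed
  ultimately show ?thesis unfolding minors_ideal_2 by blast
qed

section \<open>The inverse of the polar map\<close>

text \<open>
  The coordinates \<open>y\<^sub>1, y\<^sub>3, y\<^sub>5\<close> stand for the coefficients of the Hessian of the binary cubic, up to sign; this is its
  discriminant.
\<close>

definition hessian_disc :: "(7 \<Rightarrow> 'a::comm_ring_1) \<Rightarrow> 'a" where
  "hessian_disc y = y 3 ^ 2 - 4 * y 1 * y 5"

text \<open>
  The six linear syzygies below, read as equations for \<open>x\<close>, have a solution of degree six in \<open>y\<close>. In it
  the even coordinates have the discriminant as a common factor, which is split off here.
\<close>

definition inverse_even :: "(7 \<Rightarrow> 'a::comm_ring_1) \<Rightarrow> 7 \<Rightarrow> 'a" where
  "inverse_even y = seven
     (2 * y 1 * y 4 * y 5 ^ 2 + y 2 * y 3 * y 5 ^ 2 + y 3 ^ 3 * y 6 - 2 * y 0 * y 5 ^ 3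
      - 3 * y 1 * y 3 * y 5 * y 6 - y 3 ^ 2 * y 4 * y 5)
     0
     (y 0 * y 3 * y 5 ^ 2 + 2 * y 1 ^ 2 * y 5 * y 6 + y 1 * y 3 * y 4 * y 5
      - 2 * y 1 * y 2 * y 5 ^ 2 - y 1 * y 3 ^ 2 * y 6)
     0
     (2 * y 0 * y 1 * y 5 ^ 2 + y 1 ^ 2 * y 3 * y 6 + y 1 * y 2 * y 3 * y 5
      - y 0 * y 3 ^ 2 * y 5 - 2 * y 1 ^ 2 * y 4 * y 5)
     0
     (y 0 * y 3 ^ 3 + 2 * y 1 ^ 2 * y 2 * y 5 + y 1 ^ 2 * y 3 * y 4 - 3 * y 0 * y 1 * y 3 * y 5
      - 2 * y 1 ^ 3 * y 6 - y 1 * y 2 * y 3 ^ 2)"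

definition inverse_odd :: "(7 \<Rightarrow> 'a::comm_ring_1) \<Rightarrow> 7 \<Rightarrow> 'a" where
  "inverse_odd y = seven 0
     (4 * y 0 * y 2 * y 3 * y 5 ^ 3 + y 0 * y 3 ^ 3 * y 5 * y 6 + 8 * y 1 ^ 3 * y 5 * y 6 ^ 2
      + 4 * y 1 ^ 2 * y 4 ^ 2 * y 5 ^ 2 + 4 * y 1 * y 2 * y 3 ^ 2 * y 5 * y 6
      + 2 * y 1 * y 3 ^ 3 * y 4 * y 6 + y 2 * y 3 ^ 3 * y 4 * y 5 - 4 * y 0 ^ 2 * y 5 ^ 4
      - 2 * y 0 * y 3 ^ 2 * y 4 * y 5 ^ 2 - 8 * y 1 ^ 2 * y 2 * y 5 ^ 2 * y 6
      - 3 * y 1 ^ 2 * y 3 ^ 2 * y 6 ^ 2 - 4 * y 1 ^ 2 * y 3 * y 4 * y 5 * y 6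
      - 2 * y 1 * y 3 ^ 2 * y 4 ^ 2 * y 5 - y 2 ^ 2 * y 3 ^ 2 * y 5 ^ 2 - y 2 * y 3 ^ 4 * y 6)
     0
     (2 * y 0 ^ 2 * y 3 * y 5 ^ 3 + 12 * y 0 * y 1 ^ 2 * y 5 ^ 2 * y 6
      + 4 * y 0 * y 1 * y 3 * y 4 * y 5 ^ 2 + y 0 * y 3 ^ 4 * y 6 + 2 * y 1 ^ 3 * y 3 * y 6 ^ 2
      + 4 * y 1 ^ 2 * y 2 * y 3 * y 5 * y 6 + 2 * y 1 ^ 2 * y 3 * y 4 ^ 2 * y 5
      + 2 * y 1 * y 2 ^ 2 * y 3 * y 5 ^ 2 - 4 * y 0 * y 1 * y 2 * y 5 ^ 3
      - 9 * y 0 * y 1 * y 3 ^ 2 * y 5 * y 6 - y 0 * y 2 * y 3 ^ 2 * y 5 ^ 2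
      - 4 * y 1 ^ 3 * y 4 * y 5 * y 6 - 4 * y 1 ^ 2 * y 2 * y 4 * y 5 ^ 2
      - y 1 ^ 2 * y 3 ^ 2 * y 4 * y 6 - y 1 * y 2 * y 3 ^ 2 * y 4 * y 5)
     0
     (8 * y 0 ^ 2 * y 1 * y 5 ^ 3 + y 0 * y 1 * y 3 ^ 3 * y 6
      + 4 * y 0 * y 1 * y 3 ^ 2 * y 4 * y 5 + 2 * y 0 * y 2 * y 3 ^ 3 * y 5
      + 4 * y 1 ^ 3 * y 3 * y 4 * y 6 + 4 * y 1 ^ 2 * y 2 ^ 2 * y 5 ^ 2
      + y 1 * y 2 * y 3 ^ 3 * y 4 - 3 * y 0 ^ 2 * y 3 ^ 2 * y 5 ^ 2
      - 8 * y 0 * y 1 ^ 2 * y 4 * y 5 ^ 2 - 4 * y 0 * y 1 * y 2 * y 3 * y 5 ^ 2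
      - y 0 * y 3 ^ 4 * y 4 - 4 * y 1 ^ 4 * y 6 ^ 2 - 2 * y 1 ^ 2 * y 2 * y 3 ^ 2 * y 6
      - y 1 ^ 2 * y 3 ^ 2 * y 4 ^ 2 - 2 * y 1 * y 2 ^ 2 * y 3 ^ 2 * y 5)
     0"

definition polar_inverse :: "(7 \<Rightarrow> 'a::comm_ring_1) \<Rightarrow> 7 \<Rightarrow> 'a" where
  "polar_inverse y i = hessian_disc y * inverse_even y i + inverse_odd y i"

definition inverse_factor :: "(7 \<Rightarrow> 'a::comm_ring_1) \<Rightarrow> 'a" where
  "inverse_factor y =
     2 * y 0 * y 1 * y 4 * y 5 ^ 2 + y 0 * y 2 * y 3 * y 5 ^ 2 + y 0 * y 3 ^ 3 * y 6
      + 2 * y 1 ^ 2 * y 2 * y 5 * y 6 + y 1 ^ 2 * y 3 * y 4 * y 6 + y 1 * y 2 * y 3 * y 4 * y 5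
      - y 0 ^ 2 * y 5 ^ 3 - 3 * y 0 * y 1 * y 3 * y 5 * y 6 - y 0 * y 3 ^ 2 * y 4 * y 5
      - y 1 ^ 3 * y 6 ^ 2 - y 1 ^ 2 * y 4 ^ 2 * y 5 - y 1 * y 2 ^ 2 * y 5 ^ 2
      - y 1 * y 2 * y 3 ^ 2 * y 6"

text \<open>
  The even coordinates, with the discriminant removed, have a Hessian proportional to \<open>y\<^sub>1, y\<^sub>3, y\<^sub>5\<close>, and
  the other four partial derivatives are bilinear in even and odd coordinates. This cuts the computation into seven identities of
  moderate size.
\<close>

lemma polar_polar_inverse:
  fixes y :: "7 \<Rightarrow> 'a::idom"
  shows "polar (polar_inverse y) i = hessian_disc y ^ 3 * inverse_factor y * y i"
proof -
  let ?D = "hessian_disc y" and ?k = "inverse_factor y"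
  let ?s = "inverse_even y" and ?t = "inverse_odd y"
  note s = inverse_even_def inverse_odd_def inverse_factor_def hessian_disc_def seven_simps
  have 5: "?s 2 * ?s 2 - ?s 0 * ?s 4 = ?D * ?k * y 5"
    unfolding s by Groebner_Basis.algebra
  have 3: "?s 0 * ?s 6 - ?s 2 * ?s 4 = ?D * ?k * y 3"
    unfolding s by Groebner_Basis.algebra
  have 1: "?s 4 * ?s 4 - ?s 2 * ?s 6 = ?D * ?k * y 1"
    unfolding s by Groebner_Basis.algebra
  have 0: "?t 3 * ?s 6 - ?s 4 * ?t 5 = ?D ^ 2 * ?k * y 0"
    unfolding s by Groebner_Basis.algebra
  have 2: "2 * (?s 2 * ?t 5) - ?t 1 * ?s 6 - ?t 3 * ?s 4 = ?D ^ 2 * ?k * y 2"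
    unfolding s by Groebner_Basis.algebra
  have 4: "2 * (?t 1 * ?s 4) - ?s 0 * ?t 5 - ?s 2 * ?t 3 = ?D ^ 2 * ?k * y 4"
    unfolding s by Groebner_Basis.algebra
  have 6: "?s 0 * ?t 3 - ?t 1 * ?s 2 = ?D ^ 2 * ?k * y 6"
    unfolding s by Groebner_Basis.algebra
  have G: "polar_inverse y 0 = ?D * ?s 0" "polar_inverse y 1 = ?t 1" "polar_inverse y 2 = ?D * ?s 2"
    "polar_inverse y 3 = ?t 3" "polar_inverse y 4 = ?D * ?s 4" "polar_inverse y 5 = ?t 5"
    "polar_inverse y 6 = ?D * ?s 6"
    by (simp_all add: polar_inverse_def inverse_even_def inverse_odd_def)
  have "polar (polar_inverse y) 0 = ?D * (?t 3 * ?s 6 - ?s 4 * ?t 5)"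
    "polar (polar_inverse y) 1 = ?D ^ 2 * (?s 4 * ?s 4 - ?s 2 * ?s 6)"
    "polar (polar_inverse y) 2 = ?D * (2 * (?s 2 * ?t 5) - ?t 1 * ?s 6 - ?t 3 * ?s 4)"
    "polar (polar_inverse y) 3 = ?D ^ 2 * (?s 0 * ?s 6 - ?s 2 * ?s 4)"
    "polar (polar_inverse y) 4 = ?D * (2 * (?t 1 * ?s 4) - ?s 0 * ?t 5 - ?s 2 * ?t 3)"
    "polar (polar_inverse y) 5 = ?D ^ 2 * (?s 2 * ?s 2 - ?s 0 * ?s 4)"
    "polar (polar_inverse y) 6 = ?D * (?s 0 * ?t 3 - ?t 1 * ?s 2)"
    by (simp_all add: polar_def G algebra_simps power2_eq_square)
  then have "\<forall>i. polar (polar_inverse y) i = ?D ^ 3 * ?k * y i"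
    unfolding forall_7 0 1 2 3 4 5 6 by (simp add: power2_eq_square power3_eq_cube mult_ac)
  then show ?thesis ..
qed

text \<open>
  Six linear syzygies of the partial derivatives. The first two are the linear relations between a binary cubic and
  its Hessian, and the others come from the invariance of the determinant under the special linear group acting on binary
  forms and from its homogeneity in the even and in the odd variables.
\<close>

definition linear_relations :: "(7 \<Rightarrow> 'a::comm_ring_1) \<Rightarrow> (7 \<Rightarrow> 'a) list" where
  "linear_relations x =
    [seven 0 (x 0) 0 (x 2) 0 (x 4) 0,
     seven 0 (x 2) 0 (x 4) 0 (x 6) 0,
     seven (3 * x 2) (2 * x 3) (2 * x 4) (x 5) (x 6) 0 0,
     seven (- 3 * x 0) (2 * x 1) (- 2 * x 2) (3 * x 3) (- x 4) (4 * x 5) 0,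
     seven 0 0 (x 0) (x 1) (2 * x 2) (2 * x 3) (3 * x 4),
     seven (- x 0) (- 2 * x 1) 0 (- x 3) (x 4) 0 (2 * x 6)]"

text \<open>
  The syzygies as a relation which is linear in both arguments. It holds for \<open>x\<close> and its image under the polar
  map, and also for \<open>polar_inverse y\<close> and \<open>y\<close>.
\<close>

definition related :: "(7 \<Rightarrow> 'a::comm_ring_1) \<Rightarrow> (7 \<Rightarrow> 'a) \<Rightarrow> bool" where
  "related x y \<longleftrightarrow> (\<forall>s\<in>set (linear_relations x). (\<Sum>i\<in>UNIV. s i * y i) = 0)"

lemma related_iff:
  "related x y \<longleftrightarrow>
     x 0 * y 1 + x 2 * y 3 + x 4 * y 5 = 0 \<and>
     x 2 * y 1 + x 4 * y 3 + x 6 * y 5 = 0 \<and>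
     3 * x 2 * y 0 + 2 * x 3 * y 1 + 2 * x 4 * y 2 + x 5 * y 3 + x 6 * y 4 = 0 \<and>
     2 * x 1 * y 1 - 3 * x 0 * y 0 - 2 * x 2 * y 2 + 3 * x 3 * y 3 - x 4 * y 4 + 4 * x 5 * y 5 = 0 \<and>
     x 0 * y 2 + x 1 * y 3 + 2 * x 2 * y 4 + 2 * x 3 * y 5 + 3 * x 4 * y 6 = 0 \<and>
     x 4 * y 4 - x 0 * y 0 - 2 * x 1 * y 1 - x 3 * y 3 + 2 * x 6 * y 6 = 0"
  by (simp add: related_def linear_relations_def sum_7 algebra_simps)

lemma related_polar: "related x (polar x)"
  unfolding related_iff polar_def seven_simps by (simp add: algebra_simps)

lemma related_polar_inverse: "related (polar_inverse y) (y :: 7 \<Rightarrow> 'a::idom)"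
proof -
  show ?thesis
    unfolding related_iff polar_inverse_def inverse_even_def inverse_odd_def hessian_disc_def seven_simps
    by (intro conjI; Groebner_Basis.algebra)
qed

lemma related_linear:
  assumes "related v y" "related w y"
  shows "related (\<lambda>i. a * v i - b * w i) y"
proof -
  have "a * e - b * f = 0" if "e = 0" "f = 0" for e f :: 'a using that by simp
  note * = this[OF assms[unfolded related_iff, THEN conjunct1]]
    this[OF assms[unfolded related_iff, THEN conjunct2, THEN conjunct1]]
    this[OF assms[unfolded related_iff, THEN conjunct2, THEN conjunct2, THEN conjunct1]]
    this[OF assms[unfolded related_iff, THEN conjunct2, THEN conjunct2, THEN conjunct2, THEN conjunct1]]
    this[OF assms[unfolded related_iff, THEN conjunct2, THEN conjunct2, THEN conjunct2, THEN conjunct2, THEN conjunct1]]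
    this[OF assms[unfolded related_iff, THEN conjunct2, THEN conjunct2, THEN conjunct2, THEN conjunct2, THEN conjunct2]]
  show ?thesis
    unfolding related_iff using * by (simp add: algebra_simps)
qed

text \<open>
  Solving by elimination: the first two equations express \<open>v 4\<close> and \<open>v 6\<close> by \<open>v 0\<close> and \<open>v 2\<close>, and a
  combination of the other four is free of \<open>v 1\<close>, \<open>v 3\<close>, \<open>v 5\<close>. If \<open>v 0 = 0\<close>, this leaves a multiple of
  \<open>v 2\<close>, whose coefficient is \<open>6\<close> times \<open>inverse_even y 0\<close>. The remaining coordinates are divided out by
  \<open>y 3\<close>, \<open>y 5\<close> and the discriminant.
\<close>

lemma related_zero:
  fixes v y :: "7 \<Rightarrow> 'a::{idom, ring_char_0}"
  assumes rel: "related v y" and v0: "v 0 = 0"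
    and y: "y 3 \<noteq> 0" "y 5 \<noteq> 0" "hessian_disc y \<noteq> 0" "inverse_even y 0 \<noteq> 0"
  shows "v i = 0"
proof -
  note r = rel[unfolded related_iff v0, simplified]
  have e1: "v 2 * y 3 + v 4 * y 5 = 0" and e2: "v 2 * y 1 + v 4 * y 3 + v 6 * y 5 = 0"
    and e3: "3 * v 2 * y 0 + 2 * v 3 * y 1 + 2 * v 4 * y 2 + v 5 * y 3 + v 6 * y 4 = 0"
    and e4: "2 * v 1 * y 1 - 2 * v 2 * y 2 + 3 * v 3 * y 3 - v 4 * y 4 + 4 * v 5 * y 5 = 0"
    and e5: "v 1 * y 3 + 2 * v 2 * y 4 + 2 * v 3 * y 5 + 3 * v 4 * y 6 = 0"
    and e6: "v 4 * y 4 - 2 * v 1 * y 1 - v 3 * y 3 + 2 * v 6 * y 6 = 0"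
    using r by (simp_all add: algebra_simps)
  have "6 * inverse_even y 0 * v 2 = 0"
  proof -
    have "6 * inverse_even y 0 * v 2 =
        y 5 ^ 2 * (y 3 * (2 * v 1 * y 1 - 2 * v 2 * y 2 + 3 * v 3 * y 3 - v 4 * y 4 + 4 * v 5 * y 5)
          + 4 * y 1 * (v 1 * y 3 + 2 * v 2 * y 4 + 2 * v 3 * y 5 + 3 * v 4 * y 6)
          - 4 * y 5 * (3 * v 2 * y 0 + 2 * v 3 * y 1 + 2 * v 4 * y 2 + v 5 * y 3 + v 6 * y 4)
          + 3 * y 3 * (v 4 * y 4 - 2 * v 1 * y 1 - v 3 * y 3 + 2 * v 6 * y 6))
        + (8 * y 2 * y 5 ^ 2 - 2 * y 3 * y 4 * y 5 - 12 * y 1 * y 5 * y 6 + 6 * y 3 ^ 2 * y 6 - 4 * y 3 * y 4 * y 5) * (v 2 * y 3 + v 4 * y 5)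
        + (4 * y 4 * y 5 ^ 2 - 6 * y 3 * y 5 * y 6) * (v 2 * y 1 + v 4 * y 3 + v 6 * y 5)"
      unfolding inverse_even_def seven_simps by Groebner_Basis.algebra
    then show ?thesis unfolding e1 e2 e3 e4 e5 e6 by simp
  qed
  then have v2: "v 2 = 0" using y by simp
  have v4: "v 4 = 0" using e1 y by (simp add: v2)
  have v6: "v 6 = 0" using e2 y by (simp add: v2 v4)
  have "hessian_disc y * v 3 = 2 * y 1 * (v 1 * y 3 + 2 * v 2 * y 4 + 2 * v 3 * y 5 + 3 * v 4 * y 6) * (- 1)
      - y 3 * (v 4 * y 4 - 2 * v 1 * y 1 - v 3 * y 3 + 2 * v 6 * y 6)"
    unfolding v2 v4 v6 hessian_disc_def by Groebner_Basis.algebra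
  then have v3: "v 3 = 0" unfolding e5 e6 using y by simp
  have v1: "v 1 = 0" using e5 y by (simp add: v2 v3 v4)
  have v5: "v 5 = 0" using e3 y by (simp add: v2 v3 v4 v6)
  have "\<forall>i. v i = 0" unfolding forall_7 using v0 v1 v2 v3 v4 v5 v6 by simp
  then show ?thesis ..
qed

text \<open>
  A combination of two solutions has first coordinate zero, hence vanishes.
\<close>

lemma related_proportional:
  fixes v w y :: "7 \<Rightarrow> 'a::{idom, ring_char_0}"
  assumes "related v y" "related w y" "w 0 \<noteq> 0"
    and y: "y 3 \<noteq> 0" "y 5 \<noteq> 0" "hessian_disc y \<noteq> 0" "inverse_even y 0 \<noteq> 0"
  shows "v i * w j = v j * w i"
proof -
  have *: "w 0 * v i = v 0 * w i" for i
    using related_zero[OF related_linear[OF assms(1,2), of "w 0" "v 0"] _ y, of i] by (simp add: mult.commute)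
  have "w 0 * (v i * w j) = v 0 * w i * w j" using *[of i] by (simp add: mult.assoc[symmetric])
  also have "\<dots> = w 0 * (v j * w i)" using *[of j] by (simp add: mult_ac)
  finally show ?thesis using assms(3) by simp
qed

section \<open>Algebraic independence\<close>

abbreviation mdeg :: "('v::finite \<Rightarrow>\<^sub>0 nat) \<Rightarrow> nat" where
  "mdeg m \<equiv> (\<Sum>i\<in>UNIV. Poly_Mapping.lookup m i)"

definition hom_part :: "nat \<Rightarrow> ('v::finite, 'k::comm_ring_1) mpoly \<Rightarrow> ('v, 'k) mpoly" where
  "hom_part d f = (\<Sum>m | m \<in> Poly_Mapping.keys f \<and> mdeg m = d. Poly_Mapping.single m (Poly_Mapping.lookup f m))"

lemma lookup_hom_part: "Poly_Mapping.lookup (hom_part d f) m = (if mdeg m = d then Poly_Mapping.lookup f m else 0)"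
  by (auto simp: hom_part_def lookup_sum lookup_single when_def sum.delta in_keys_iff)

lemma hom_part_0 [simp]: "hom_part d 0 = 0"
  by (simp add: hom_part_def)

lemma hom_part_sum: "hom_part d (sum f A) = (\<Sum>a\<in>A. hom_part d (f a))"
  by (rule poly_mapping_eqI) (simp add: lookup_hom_part lookup_sum)

lemma hom_part_homogeneous:
  assumes "homogeneous n f"
  shows "hom_part d f = (if n = d then f else 0)"
  using assms by (intro poly_mapping_eqI) (auto simp: lookup_hom_part homogeneous_def in_keys_iff)

lemma homogeneous_hom_part: "homogeneous d (hom_part d f)"
  by (auto simp: homogeneous_def in_keys_iff lookup_hom_part split: if_splits)

lemma sum_hom_part: "f = (\<Sum>d\<in>mdeg ` Poly_Mapping.keys f. hom_part d f)"
proof (rule poly_mapping_eqI)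
  fix m
  show "Poly_Mapping.lookup f m = Poly_Mapping.lookup (\<Sum>d\<in>mdeg ` Poly_Mapping.keys f. hom_part d f) m"
    by (cases "m \<in> Poly_Mapping.keys f")
      (auto simp: lookup_sum lookup_hom_part sum.delta in_keys_iff)
qed

lemma subst_scaled_homogeneous:
  assumes "homogeneous d f"
  shows "subst (\<lambda>i. h * Var i) f = h ^ d * f"
proof -
  have "monom_value (\<lambda>i. h * Var i) m = h ^ mdeg m * monom_value Var m" for m
    by (simp add: monom_value_def power_mult_distrib prod.distrib power_sum)
  then have "subst (\<lambda>i. h * Var i) f =
      (\<Sum>m\<in>Poly_Mapping.keys f. h ^ d * (Const (Poly_Mapping.lookup f m) * monom_value Var m))"
    unfolding subst_def monom_value_def[symmetric] using assms
    by (intro sum.cong) (auto simp: homogeneous_def mult_ac)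
  also have "\<dots> = h ^ d * subst Var f"
    by (simp add: subst_def monom_value_def sum_distrib_left)
  finally show ?thesis by (simp add: subst_id)
qed

text \<open>
  Scaling the variables by \<open>h\<close> moves the component of degree \<open>d\<close> to degree \<open>(e + 1) d\<close>, multiplying it by
  \<open>h\<^sup>d\<close>. Different components cannot cancel there.
\<close>

lemma subst_scaled_eq_0:
  fixes g h :: "('v::{finite, linorder}, 'k::field) mpoly"
  assumes h: "homogeneous e h" "h \<noteq> 0" and g: "subst (\<lambda>i. h * Var i) g = 0"
  shows "g = 0"
proof -
  let ?A = "mdeg ` Poly_Mapping.keys g"
  have "hom_part n g = 0" if n: "n \<in> ?A" for n
  proof -
    have hom: "homogeneous (e * d + d) (h ^ d * hom_part d g)" for d
      by (rule homogeneous_mult[OF homogeneous_power[OF h(1) refl] homogeneous_hom_part refl])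
    have "0 = hom_part (e * n + n) (subst (\<lambda>i. h * Var i) (\<Sum>d\<in>?A. hom_part d g))"
      using g sum_hom_part[of g] by simp
    also have "\<dots> = (\<Sum>d\<in>?A. hom_part (e * n + n) (h ^ d * hom_part d g))"
      by (simp add: subst_scaled_homogeneous[OF homogeneous_hom_part] hom_part_sum)
    also have "\<dots> = (\<Sum>d\<in>?A. if d = n then h ^ d * hom_part d g else 0)"
    proof (rule sum.cong)
      fix d
      have "e * d + d = e * n + n \<longleftrightarrow> d = n"
        using mult_cancel1[of "Suc e" d n] by (simp add: algebra_simps)
      then show "hom_part (e * n + n) (h ^ d * hom_part d g) = (if d = n then h ^ d * hom_part d g else 0)"
        by (simp add: hom_part_homogeneous[OF hom])
    qed simp
    also have "\<dots> = h ^ n * hom_part n g" using n by (simp add: sum.delta)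
    finally show ?thesis using h(2) by simp
  qed
  then show ?thesis using sum_hom_part[of g] by (metis sum.neutral)
qed

lemma seven_map: "f (seven a0 a1 a2 a3 a4 a5 a6 i) = seven (f a0) (f a1) (f a2) (f a3) (f a4) (f a5) (f a6) i"
  by (simp add: seven_def)

lemma subst_polar: "subst F (polar y i) = polar (\<lambda>i. subst F (y i)) i"
  by (simp add: polar_def seven_map[of "subst F"])

lemma subst_inverse:
  "subst F (hessian_disc y) = hessian_disc (\<lambda>i. subst F (y i))"
  "subst F (inverse_even y i) = inverse_even (\<lambda>i. subst F (y i)) i"
  "subst F (inverse_factor y) = inverse_factor (\<lambda>i. subst F (y i))"
  by (simp_all add: hessian_disc_def inverse_even_def inverse_factor_def seven_map[of "subst F"])

lemma subst_polar_inverse: "subst F (polar_inverse y i) = polar_inverse (\<lambda>i. subst F (y i)) i"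
proof -
  have "subst F (inverse_odd y i) = inverse_odd (\<lambda>i. subst F (y i)) i"
    by (simp add: inverse_odd_def seven_map[of "subst F"])
  then show ?thesis by (simp add: polar_inverse_def subst_inverse)
qed

lemma homogeneous_seven:
  assumes "homogeneous d a0" "homogeneous d a1" "homogeneous d a2" "homogeneous d a3"
    "homogeneous d a4" "homogeneous d a5" "homogeneous d a6"
  shows "homogeneous d (seven a0 a1 a2 a3 a4 a5 a6 i)"
  using assms by (simp add: seven_def)

lemmas homogeneous_intros =
  homogeneous_add homogeneous_diff homogeneous_mult homogeneous_power homogeneous_Var homogeneous_numeral

lemma homogeneous_hessian_disc: "homogeneous 2 (hessian_disc Var)"
  unfolding hessian_disc_def by (rule homogeneous_intros | simp)+

lemma homogeneous_inverse_factor: "homogeneous 5 (inverse_factor Var)"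
  unfolding inverse_factor_def by (rule homogeneous_intros | simp)+

lemma homogeneous_polar: "homogeneous 2 (polar Var i)"
  unfolding polar_def by (rule homogeneous_seven homogeneous_intros | simp)+

lemma homogeneous_polar_inverse: "homogeneous 6 (polar_inverse Var i)"
proof -
  have "homogeneous 4 (inverse_even Var i)"
    unfolding inverse_even_def by (rule homogeneous_seven homogeneous_intros | simp)+
  moreover have "homogeneous 6 (inverse_odd Var i)"
    unfolding inverse_odd_def by (rule homogeneous_seven homogeneous_intros | simp)+
  ultimately show ?thesis
    unfolding polar_inverse_def
    by (intro homogeneous_add homogeneous_mult[OF homogeneous_hessian_disc]) auto
qed

lemma inverse_factor_nonzero: "hessian_disc Var ^ 3 * inverse_factor Var \<noteq> (0 :: (7, 'k::field_char_0) mpoly)"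
proof
  let ?p = "seven 0 1 0 0 0 1 1 :: 7 \<Rightarrow> (7, 'k) mpoly"
  assume "hessian_disc Var ^ 3 * inverse_factor Var = (0 :: (7, 'k) mpoly)"
  from arg_cong[OF this, of "subst ?p"] show False
    by (simp add: subst_inverse) (simp add: hessian_disc_def inverse_factor_def)
qed

text \<open>
  Inserting the inverse turns a relation of the partial derivatives into a polynomial that vanishes at a scaled tuple
  of variables.
\<close>

lemma polar_algebraically_independent:
  "algebraically_independent (polar Var :: 7 \<Rightarrow> (7, 'k::field_char_0) mpoly)"
  unfolding algebraically_independent_def
proof (intro allI impI)
  fix g :: "(7, 'k) mpoly" assume "subst (polar Var :: 7 \<Rightarrow> (7, 'k) mpoly) g = 0"
  then have "subst (polar_inverse Var) (subst (polar Var :: 7 \<Rightarrow> (7, 'k) mpoly) g) = 0" by simp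
  then have "subst (\<lambda>i. (hessian_disc Var ^ 3 * inverse_factor Var :: (7, 'k) mpoly) * Var i) g = 0"
    by (simp add: subst_subst subst_polar polar_polar_inverse)
  moreover have "homogeneous 11 (hessian_disc Var ^ 3 * inverse_factor Var :: (7, 'k) mpoly)"
    by (rule homogeneous_mult[OF homogeneous_power[OF homogeneous_hessian_disc refl] homogeneous_inverse_factor]) simp
  ultimately show "g = 0"
    using subst_scaled_eq_0 inverse_factor_nonzero by blast
qed

section \<open>The polar map is birational\<close>

text \<open>
  The point \<open>(1, 0, 0, 1, 1, 0, 1)\<close> witnesses that the polynomials which must not vanish identically are nonzero;
  any point in a dense open set would do.
\<close>

lemma generic_point:
  fixes p :: "7 \<Rightarrow> (7, 'k::field_char_0) mpoly"
  defines "p \<equiv> seven 1 0 0 1 1 0 1"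
  shows "polar p 3 \<noteq> 0" "polar p 5 \<noteq> 0" "hessian_disc (polar p) \<noteq> 0" "inverse_even (polar p) 0 \<noteq> 0"
    "polar_inverse (polar p) 0 \<noteq> 0"
  by (simp_all add: p_def polar_def hessian_disc_def inverse_even_def inverse_odd_def polar_inverse_def)

lemma generic_nonzero:
  fixes f :: "(7, 'k::field_char_0) mpoly"
  assumes "subst (seven 1 0 0 1 1 0 1 :: 7 \<Rightarrow> (7, 'k) mpoly) f \<noteq> 0"
  shows "f \<noteq> 0"
  using assms by auto

text \<open>
  Both \<open>x\<close> and its image under the two maps solve the equations with coefficients \<open>polar x\<close>.
\<close>

lemma polar_inverse_polar:
  fixes i j :: 7
  shows "polar_inverse (polar Var) i * Var j = (polar_inverse (polar Var) j * Var i :: (7, 'k::field_char_0) mpoly)"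
proof (rule related_proportional)
  show "related (polar_inverse (polar Var)) (polar Var :: 7 \<Rightarrow> (7, 'k) mpoly)"
    by (rule related_polar_inverse)
  show "related Var (polar Var :: 7 \<Rightarrow> (7, 'k) mpoly)"
    by (rule related_polar)
  show "polar Var 3 \<noteq> (0 :: (7, 'k) mpoly)" "polar Var 5 \<noteq> (0 :: (7, 'k) mpoly)"
    "hessian_disc (polar Var) \<noteq> (0 :: (7, 'k) mpoly)" "inverse_even (polar Var) 0 \<noteq> (0 :: (7, 'k) mpoly)"
    by (rule generic_nonzero, simp add: subst_polar subst_inverse generic_point)+
qed simp

lemma rational_map_Var: "rational_map (Var :: 'v::finite \<Rightarrow> ('v, 'k::field) mpoly)"
  unfolding rational_map_def by (auto intro: homogeneous_Var)

lemma birational_polar: "birational_map (polar Var :: 7 \<Rightarrow> (7, 'k::field_char_0) mpoly)"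
proof -
  let ?F = "polar Var :: 7 \<Rightarrow> (7, 'k) mpoly" and ?G = "polar_inverse Var :: 7 \<Rightarrow> (7, 'k) mpoly"
  have GF: "subst ?F (?G i) = polar_inverse ?F i" for i
    by (simp add: subst_polar_inverse)
  have FG: "subst ?G (?F i) = hessian_disc Var ^ 3 * inverse_factor Var * Var i" for i
    by (simp add: subst_polar polar_polar_inverse)
  have nzG: "polar_inverse ?F 0 \<noteq> 0"
    by (rule generic_nonzero) (simp add: subst_polar subst_polar_inverse generic_point)
  have F: "rational_map ?F"
    unfolding rational_map_def
    using homogeneous_polar generic_nonzero[of "?F 3"] by (auto simp: subst_polar generic_point)
  have G: "rational_map ?G"
    unfolding rational_map_def
  proof
    show "\<exists>i. ?G i \<noteq> 0" using nzG GF[of 0] by (metis subst_0)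
  qed (use homogeneous_polar_inverse in blast)
  have "rational_map (\<lambda>i. subst ?F (?G i))"
    unfolding rational_map_def
  proof
    show "\<exists>d. \<forall>i. homogeneous d (subst ?F (?G i))"
      using homogeneous_subst[where F = ?F, OF homogeneous_polar_inverse homogeneous_polar] by blast
  qed (use nzG GF in auto)
  moreover have "rational_map (\<lambda>i. subst ?G (?F i))"
    unfolding rational_map_def
  proof
    show "\<exists>d. \<forall>i. homogeneous d (subst ?G (?F i))"
      using homogeneous_subst[where F = ?G, OF homogeneous_polar homogeneous_polar_inverse] by blast
    have "subst ?G (?F 0) \<noteq> 0" unfolding FG using inverse_factor_nonzero by simp
    then show "\<exists>i. subst ?G (?F i) \<noteq> 0" by blast
  qed
  ultimately have "same_rational_map (\<lambda>i. subst ?F (?G i)) Var" "same_rational_map (\<lambda>i. subst ?G (?F i)) Var"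
    using rational_map_Var polar_inverse_polar by (auto simp: same_rational_map_def GF FG mult_ac)
  then show ?thesis unfolding birational_map_def using F G by blast
qed

lemma homaloidal_cubic: "homaloidal (cubic Var :: (7, 'k::field_char_0) mpoly)"
proof -
  have "homogeneous 3 (cubic Var :: (7, 'k) mpoly)"
    unfolding cubic_def by (rule homogeneous_intros | simp)+
  moreover have "(\<lambda>i. partial_deriv i (cubic Var)) = (polar Var :: 7 \<Rightarrow> (7, 'k) mpoly)"
    by (simp add: partial_deriv_cubic)
  ultimately show ?thesis
    using birational_polar unfolding homaloidal_def by auto
qed

section \<open>The linear syzygies of the polar ideal\<close>

lemma to_fract_numeral: "to_fract (numeral n :: 'a::idom) = numeral n"
proof -
  have "to_fract (of_nat m :: 'a) = of_nat m" for m by (induction m) simp_all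
  from this[of "numeral n"] show ?thesis by simp
qed

definition relation_vector :: "nat \<Rightarrow> (7, 'k::field_char_0) mpoly ^ 7" where
  "relation_vector k = (\<chi> i. (linear_relations Var ! k) i)"

lemma relation_vector_linear_syzygy:
  assumes "k < 6"
  shows "relation_vector k \<in> linear_syzygies (polar Var :: 7 \<Rightarrow> (7, 'k::field_char_0) mpoly)"
proof -
  let ?s = "linear_relations (Var :: 7 \<Rightarrow> (7, 'k) mpoly)"
  have "?s ! k \<in> set ?s" using assms by (intro nth_mem) (simp add: linear_relations_def)
  then have "(\<Sum>i\<in>UNIV. (?s ! k) i * polar Var i) = 0"
    using related_polar[of "Var :: 7 \<Rightarrow> (7, 'k) mpoly"] by (simp add: related_def)
  moreover have "\<forall>s\<in>set ?s. \<forall>i. homogeneous 1 (s i)"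
    unfolding linear_relations_def
    by (simp, intro conjI allI;
        (rule homogeneous_seven homogeneous_uminus homogeneous_intros homogeneous_Var[simplified] | simp)+)
  ultimately show ?thesis
    using \<open>?s ! k \<in> set ?s\<close> by (simp add: linear_syzygies_def syzygies_def relation_vector_def)
qed

text \<open>
  Up to the factor \<open>- 27\<close>, the discriminant of the binary cubic with coefficients
  \<open>x\<^sub>0, 3 x\<^sub>2, 3 x\<^sub>4, x\<^sub>6\<close>.
\<close>

lemma cubic_discriminant_nonzero:
  "4 * Var 2 ^ 3 * Var 6 - 3 * Var 2 ^ 2 * Var 4 ^ 2 - 6 * Var 0 * Var 2 * Var 4 * Var 6
     + 4 * Var 0 * Var 4 ^ 3 + Var 0 ^ 2 * Var 6 ^ 2 \<noteq> (0 :: (7, 'k::field_char_0) mpoly)" (is "?d \<noteq> 0")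
proof
  assume "?d = 0"
  from arg_cong[OF this, of "subst (seven 1 0 0 0 0 0 1) :: _ \<Rightarrow> (7, 'k) mpoly"]
  show False by simp
qed

text \<open>
  The coordinates \<open>0, 2, 4, 6\<close> involve the last four vectors only, by a matrix whose determinant is
  the discriminant of the binary cubic up to a nonzero constant. The remaining two vectors are independent as
  \<open>x\<^sub>0 x\<^sub>4 - x\<^sub>2\<^sup>2\<close> is not zero.
\<close>

lemma relation_vectors_independent:
  fixes c :: "nat \<Rightarrow> (7, 'k::field_char_0) mpoly fract"
  assumes "(\<Sum>k<6. c k *s (\<chi> i. to_fract (relation_vector k $ i))) = 0" "k < 6"
  shows "c k = 0"
proof -
  have sum6: "(\<Sum>k<6. g k) = g 0 + g 1 + g 2 + g 3 + g 4 + g 5" for g :: "nat \<Rightarrow> (7, 'k) mpoly fract"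
    by (simp add: eval_nat_numeral)
  have E: "(\<Sum>k<6. c k * to_fract ((linear_relations Var ! k) i)) = 0" for i
    using arg_cong[OF assms(1), of "\<lambda>v. v $ i"] by (simp add: relation_vector_def)
  obtain x0 x2 x4 x6 :: "(7, 'k) mpoly fract"
    where x: "to_fract (Var 0) = x0" "to_fract (Var 2) = x2" "to_fract (Var 4) = x4" "to_fract (Var 6) = x6"
    by blast
  obtain x1 x3 x5 :: "(7, 'k) mpoly fract"
    where xo: "to_fract (Var 1) = x1" "to_fract (Var 3) = x3" "to_fract (Var 5) = x5"
    by blast
  obtain c0 c1 c2 c3 c4 c5 where c: "c 0 = c0" "c 1 = c1" "c 2 = c2" "c 3 = c3" "c 4 = c4" "c 5 = c5"
    by blast
  note s = sum6 linear_relations_def x xo c c(2)[unfolded One_nat_def] to_fract_numeral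
  have E0: "3 * x2 * c2 - 3 * x0 * c3 - x0 * c5 = 0"
    using E[of 0] by (simp add: s algebra_simps)
  have E2: "2 * x4 * c2 - 2 * x2 * c3 + x0 * c4 = 0"
    using E[of 2] by (simp add: s algebra_simps)
  have E4: "x6 * c2 - x4 * c3 + 2 * x2 * c4 + x4 * c5 = 0"
    using E[of 4] by (simp add: s algebra_simps)
  have E6: "3 * x4 * c4 + 2 * x6 * c5 = 0"
    using E[of 6] by (simp add: s algebra_simps)
  let ?d = "4 * x2 ^ 3 * x6 - 3 * x2 ^ 2 * x4 ^ 2 - 6 * x0 * x2 * x4 * x6 + 4 * x0 * x4 ^ 3 + x0 ^ 2 * x6 ^ 2"
  have d: "?d \<noteq> 0"
  proof
    assume "?d = 0"
    then have "to_fract (4 * Var 2 ^ 3 * Var 6 - 3 * Var 2 ^ 2 * Var 4 ^ 2 - 6 * Var 0 * Var 2 * Var 4 * Var 6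
        + 4 * Var 0 * Var 4 ^ 3 + Var 0 ^ 2 * Var 6 ^ 2 :: (7, 'k) mpoly) = 0"
      by (simp add: x to_fract_numeral power2_eq_square power3_eq_cube)
    then show False by (simp only: to_fract_eq_0_iff cubic_discriminant_nonzero)
  qed
  have six: "(6 :: (7, 'k) mpoly fract) \<noteq> 0"
    using to_fract_numeral[of "num.Bit0 (num.Bit1 num.One)", where 'a = "(7, 'k) mpoly"]
    by (metis to_fract_eq_0_iff zero_neq_numeral)
  have nonzero: "e = 0" if "- 6 * ?d * e = 0" for e
    using that d six by (simp only: mult_eq_0_iff neg_equal_0_iff_equal simp_thms)
  have c2: "c2 = 0"
  proof (rule nonzero)
    \<comment> \<open>The cofactors of the system of \<open>E0\<close>, \<open>E2\<close>, \<open>E4\<close>, \<open>E6\<close>, here and in the next two steps.\<close>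
    have "- 6 * ?d * c2 = (6 * x2 * x4 ^ 2 + 2 * x0 * x4 * x6 - 8 * x2 ^ 2 * x6) * (3 * x2 * c2 - 3 * x0 * c3 - x0 * c5)
        + (12 * x0 * x2 * x6 - 12 * x0 * x4 ^ 2) * (2 * x4 * c2 - 2 * x2 * c3 + x0 * c4)
        + (6 * x0 * x2 * x4 - 6 * x0 ^ 2 * x6) * (x6 * c2 - x4 * c3 + 2 * x2 * c4 + x4 * c5)
        + (4 * x0 ^ 2 * x4 - 4 * x0 * x2 ^ 2) * (3 * x4 * c4 + 2 * x6 * c5)"
      by Groebner_Basis.algebra
    then show "- 6 * ?d * c2 = 0" unfolding E0 E2 E4 E6 by simp
  qed
  have c3: "c3 = 0"
  proof (rule nonzero)
    have "- 6 * ?d * c3 = (6 * x4 ^ 3 + 2 * x0 * x6 ^ 2 - 8 * x2 * x4 * x6) * (3 * x2 * c2 - 3 * x0 * c3 - x0 * c5)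
        + (12 * x2 ^ 2 * x6 - 9 * x2 * x4 ^ 2 - 3 * x0 * x4 * x6) * (2 * x4 * c2 - 2 * x2 * c3 + x0 * c4)
        + (6 * x0 * x4 ^ 2 - 6 * x0 * x2 * x6) * (x6 * c2 - x4 * c3 + 2 * x2 * c4 + x4 * c5)
        + (x0 ^ 2 * x6 - x0 * x2 * x4) * (3 * x4 * c4 + 2 * x6 * c5)"
      by Groebner_Basis.algebra
    then show "- 6 * ?d * c3 = 0" unfolding E0 E2 E4 E6 by simp
  qed
  have c4: "c4 = 0"
  proof (rule nonzero)
    have "- 6 * ?d * c4 = (4 * x2 * x6 ^ 2 - 4 * x4 ^ 2 * x6) * (3 * x2 * c2 - 3 * x0 * c3 - x0 * c5)
        + (6 * x2 * x4 * x6 - 6 * x0 * x6 ^ 2) * (2 * x4 * c2 - 2 * x2 * c3 + x0 * c4)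
        + (12 * x0 * x4 * x6 - 12 * x2 ^ 2 * x6) * (x6 * c2 - x4 * c3 + 2 * x2 * c4 + x4 * c5)
        + (6 * x2 ^ 2 * x4 + 2 * x0 * x2 * x6 - 8 * x0 * x4 ^ 2) * (3 * x4 * c4 + 2 * x6 * c5)"
      by Groebner_Basis.algebra
    then show "- 6 * ?d * c4 = 0" unfolding E0 E2 E4 E6 by simp
  qed
  have x_nz: "x0 \<noteq> 0" "x6 \<noteq> 0" unfolding x[symmetric] by simp_all
  have c5: "c5 = 0" using E0 x_nz by (simp add: c2 c3)
  have E1: "x0 * c0 + x2 * c1 = 0"
    using E[of 1] c2 c3 c4 c5 by (simp add: s algebra_simps)
  have E3: "x2 * c0 + x4 * c1 = 0"
    using E[of 3] c2 c3 c4 c5 by (simp add: s algebra_simps)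
  have h: "x0 * x4 - x2 * x2 \<noteq> 0"
  proof
    assume "x0 * x4 - x2 * x2 = 0"
    then have "to_fract (Var 0 * Var 4 - Var 2 * Var 2 :: (7, 'k) mpoly) = 0" by (simp add: x)
    then have "Var 0 * Var 4 - Var 2 * Var 2 = (0 :: (7, 'k) mpoly)" by (simp only: to_fract_eq_0_iff)
    from arg_cong[OF this, of "subst (seven 1 0 0 0 1 0 0) :: _ \<Rightarrow> (7, 'k) mpoly"]
    show False by simp
  qed
  have "(x0 * x4 - x2 * x2) * c0 = x4 * (x0 * c0 + x2 * c1) - x2 * (x2 * c0 + x4 * c1)"
    "(x0 * x4 - x2 * x2) * c1 = x0 * (x2 * c0 + x4 * c1) - x2 * (x0 * c0 + x2 * c1)"
    by (simp_all add: algebra_simps)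
  then have "c0 = 0" "c1 = 0" unfolding E1 E3 using h by simp_all
  then have "\<forall>k\<in>{0, 1, 2, 3, 4, 5}. c k = 0" using c c2 c3 c4 c5 by simp
  moreover have "k \<in> {0, 1, 2, 3, 4, 5}" using assms(2) by auto
  ultimately show ?thesis by blast
qed

lemma dim_ge_of_independent_family:
  fixes f :: "nat \<Rightarrow> 'a::field ^ 'n"
  assumes f: "\<And>k. k < n \<Longrightarrow> f k \<in> V"
    and zero: "\<And>c k. (\<Sum>k<n. c k *s f k) = 0 \<Longrightarrow> k < n \<Longrightarrow> c k = 0"
  shows "n \<le> vec.dim V"
proof -
  have inj: "inj_on f {..<n}"
  proof (rule inj_onI, rule ccontr)
    fix i j assume ij: "i \<in> {..<n}" "j \<in> {..<n}" "f i = f j" "i \<noteq> j"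
    let ?c = "\<lambda>k. (if k = i then 1 else 0) - (if k = j then 1 else 0) :: 'a"
    have delta: "(\<Sum>k<n. (if k = a then 1 else 0 :: 'a) *s f k) = f a" if "a < n" for a
    proof -
      have "(\<Sum>k<n. (if k = a then 1 else 0 :: 'a) *s f k) = (\<Sum>k<n. if k = a then f k else 0)"
        by (rule sum.cong) auto
      then show ?thesis using that by (simp add: sum.delta)
    qed
    have "(\<Sum>k<n. ?c k *s f k) = f i - f j"
      using delta[of i] delta[of j] ij by (simp add: vec.scale_left_diff_distrib sum_subtractf)
    then have "?c i = 0" using ij by (intro zero) auto
    then show False using ij by simp
  qed
  have "vec.independent (f ` {..<n})"
  proof (rule vec.independent_if_scalars_zero)
    fix g x assume g: "(\<Sum>x\<in>f ` {..<n}. g x *s x) = 0" and "x \<in> f ` {..<n}"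
    then obtain k where k: "k < n" "x = f k" by auto
    have "(\<Sum>k<n. g (f k) *s f k) = 0" using g by (simp add: sum.reindex[OF inj])
    then show "g x = 0" using zero[of "\<lambda>k. g (f k)"] k by simp
  qed simp
  moreover have "f ` {..<n} \<subseteq> V" using f by auto
  ultimately have "card (f ` {..<n}) \<le> vec.dim V" by (intro vec.independent_card_le_dim)
  then show ?thesis by (simp add: card_image inj)
qed

lemma module_vec: "Modules.module ((*s) :: 'a::comm_ring_1 \<Rightarrow> 'a ^ 'n \<Rightarrow> 'a ^ 'n)"
  by unfold_locales (vector algebra_simps)+

text \<open>
  A common nontrivial relation puts the module into a hyperplane.
\<close>

lemma module_rank_le_of_relation:
  fixes M :: "('a::idom ^ 'n) set"
  assumes M: "\<And>s. s \<in> M \<Longrightarrow> (\<Sum>i\<in>UNIV. s $ i * F i) = 0" and F: "F j \<noteq> 0"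
  shows "module_rank (Modules.module.span (*s) M) \<le> CARD('n) - 1"
proof -
  interpret m: Modules.module "(*s) :: 'a \<Rightarrow> 'a ^ 'n \<Rightarrow> 'a ^ 'n" by (rule module_vec)
  let ?H = "{v :: 'a fract ^ 'n. (\<Sum>i\<in>UNIV. v $ i * to_fract (F i)) = 0}"
  have sub: "vec.subspace ?H"
    by (auto simp: vec.subspace_def distrib_right sum.distrib mult.assoc simp flip: sum_distrib_left)
  have rel: "(\<Sum>i\<in>UNIV. s $ i * F i) = 0" if "s \<in> m.span M" for s
    using that
  proof (induction rule: m.span_induct_alt)
    case (step c x y)
    then show ?case
      using M[of x] by (simp add: distrib_right sum.distrib mult.assoc flip: sum_distrib_left)
  qed simp
  have "(\<lambda>s. \<chi> i. to_fract (s $ i)) ` m.span M \<subseteq> ?H"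
  proof clarify
    fix s assume "s \<in> m.span M"
    from arg_cong[OF rel[OF this], of to_fract]
    show "(\<Sum>i\<in>UNIV. (\<chi> i. to_fract (s $ i)) $ i * to_fract (F i)) = 0" by simp
  qed
  then have "module_rank (m.span M) \<le> vec.dim ?H"
    unfolding module_rank_def by (rule vec.dim_subset)
  moreover have "vec.dim ?H \<noteq> CARD('n)"
  proof
    assume "vec.dim ?H = CARD('n)"
    then have "?H = UNIV"
      by (intro vec.subspace_dim_equal[OF sub vec.subspace_UNIV]) (simp_all only: vec_dim_card subset_UNIV order_refl)
    then have "(axis j 1 :: 'a fract ^ 'n) \<in> ?H" by blast
    then show False using F by (simp add: axis_def if_distrib[of "\<lambda>x. x * _"] cong: if_cong)
  qed
  moreover have "vec.dim ?H \<le> CARD('n)"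
    using vec.dim_subset[of ?H UNIV] by (simp only: vec_dim_card subset_UNIV)
  ultimately show ?thesis by linarith
qed

lemma linear_syzygies_polar_rank:
  "module_rank (Modules.module.span (*s) (linear_syzygies (polar Var :: 7 \<Rightarrow> (7, 'k::field_char_0) mpoly))) = 6"
proof (rule antisym)
  interpret m: Modules.module "(*s) :: (7, 'k) mpoly \<Rightarrow> (7, 'k) mpoly ^ 7 \<Rightarrow> _" by (rule module_vec)
  let ?M = "linear_syzygies (polar Var :: 7 \<Rightarrow> (7, 'k) mpoly)"
  have "polar Var 3 \<noteq> (0 :: (7, 'k) mpoly)"
    by (rule generic_nonzero) (simp add: subst_polar generic_point)
  then have "module_rank (m.span ?M) \<le> CARD(7) - 1"
    by (intro module_rank_le_of_relation[where F = "polar Var"]) (auto simp: linear_syzygies_def syzygies_def)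
  then show "module_rank (m.span ?M) \<le> 6" by simp
  show "6 \<le> module_rank (m.span ?M)"
    unfolding module_rank_def
  proof (rule dim_ge_of_independent_family)
    fix k :: nat assume "k < 6"
    then show "(\<chi> i. to_fract (relation_vector k $ i)) \<in> (\<lambda>s. \<chi> i. to_fract (s $ i)) ` m.span ?M"
      by (intro imageI m.span_base relation_vector_linear_syzygy)
  qed (rule relation_vectors_independent)
qed

text \<open>
  Evaluation at the \<open>i\<close>-th point annihilates the ideal generated by the other members of the family.
\<close>

lemma minimal_generators_if_points:
  fixes F :: "'n \<Rightarrow> ('v::finite, 'k::comm_ring_1) mpoly" and p :: "'n \<Rightarrow> 'v \<Rightarrow> ('v, 'k) mpoly"
  assumes "\<And>i j. i \<noteq> j \<Longrightarrow> subst (p i) (F j) = 0" "\<And>i. subst (p i) (F i) \<noteq> 0"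
  shows "minimal_generators F"
  unfolding minimal_generators_def
proof
  fix i
  have "ideal {g. subst (p i) g = 0} type_ring" by (simp add: ideal_iff)
  then have "idl (F ` (UNIV - {i})) \<subseteq> {g. subst (p i) g = 0}"
    by (rule idl_minimal) (use assms(1) in auto)
  moreover have "F i \<in> idl (range F)" by (rule idl_base) simp
  ultimately show "idl (F ` (UNIV - {i})) \<noteq> idl (range F)" using assms(2)[of i] by blast
qed

text \<open>
  The seven points are mapped to the unit vectors, up to sign, by the polar map.
\<close>

lemma polar_minimal_generators:
  "minimal_generators (polar Var :: 7 \<Rightarrow> (7, 'k::field_char_0) mpoly)"
proof (rule minimal_generators_if_points)
  let ?p = "seven (seven 0 0 0 1 0 0 1) (seven 0 0 0 0 1 0 0) (seven 0 1 0 0 0 0 1) (seven 1 0 0 0 0 0 1)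
    (seven 1 0 0 0 0 1 0) (seven 0 0 1 0 0 0 0) (seven 1 0 0 1 0 0 0) :: 7 \<Rightarrow> 7 \<Rightarrow> (7, 'k) mpoly"
  have "\<forall>i j. (i \<noteq> j \<longrightarrow> polar (?p i) j = 0) \<and> polar (?p i) i \<noteq> 0"
    unfolding forall_7 by (simp add: polar_def)
  then show "\<And>i j. i \<noteq> j \<Longrightarrow> subst (?p i) (polar Var j) = 0" "\<And>i. subst (?p i) (polar Var i) \<noteq> 0"
    by (simp_all add: subst_polar)
qed

lemma polar_maximal_linear_rank:
  "maximal_linear_rank (polar Var :: 7 \<Rightarrow> (7, 'k::field_char_0) mpoly)"
  unfolding maximal_linear_rank_def
  using homogeneous_polar polar_minimal_generators linear_syzygies_polar_rank by auto

theorem proposition3p24: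
  fixes R :: "(7, 'k::field_char_0) mpoly ring"
    and x :: "7 \<Rightarrow> (7, 'k) mpoly"
    and C :: "(7, 'k) mpoly ^ 3 ^ 3"
    and C' :: "(7, 'k) mpoly ^ 5 ^ 2"
    and J I P Q :: "(7, 'k) mpoly set"
  assumes "R = ring_of_type_algebra"
    and "x = Var"
    and "C = vector [vector [x 0, x 1, x 2],
                     vector [x 2, x 3, x 4],
                     vector [x 4, x 5, x 6]]"
    and "C' = vector [vector [x 0, x 1, x 2, x 3, x 4],
                      vector [x 2, x 3, x 4, x 5, x 6]]"
    and "J = gradient_ideal (det C)"
    and "I = minors_ideal TYPE(2) C"
    and "P = minors_ideal TYPE(2) C'"
    and "Q = colon_ideal R I P <+>\<^bsub>R\<^esub> P"
  shows
    "(minimal_part R J = I \<and>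
      radical_ideal R I \<and>
      I = P \<inter> colon_ideal R I P \<and>
      I = P \<inter> Idl\<^bsub>R\<^esub> {x 0, x 2, x 4, x 6} \<and>
      Q = Idl\<^bsub>R\<^esub> {x 0, x 2, x 4, x 6, x 1 * x 5 - (x 3)\<^sup>2} \<and>
      embedded_primes R J = {Q}) \<and>
     (algebraically_independent (\<lambda>i. partial_deriv i (det C)) \<and>
      maximal_linear_rank (\<lambda>i. partial_deriv i (det C)) \<and>
      homaloidal (det C))"
proof -
  have R: "R = type_ring" and detC: "det C = cubic Var"
    using assms(1-3) det_eq_cubic[of x] by simp_all
  have polar: "(\<lambda>i. partial_deriv i (det C)) = polar Var"
    by (simp add: detC partial_deriv_cubic)
  have J: "J = polar_ideal"
    by (simp only: assms(5) gradient_ideal_def polar polar_ideal_def)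
  have I: "I = minors_ideal_C" and P: "P = scroll_ideal"
    using assms(2,3,4,6,7) minors_ideal_catalecticant minors_ideal_scroll by simp_all
  have even: "Idl\<^bsub>R\<^esub> {x 0, x 2, x 4, x 6} = even_ideal"
    by (simp add: R assms(2) even_ideal_def)
  have colon: "colon_ideal R I P = even_ideal"
    by (simp add: R I P colon_minors_scroll)
  have Q: "Q = embedded_ideal"
    unfolding assms(8) colon unfolding R P even_plus_scroll ..
  have Q_gens: "embedded_ideal = Idl\<^bsub>R\<^esub> {x 0, x 2, x 4, x 6, x 1 * x 5 - (x 3)\<^sup>2}"
    by (simp add: R assms(2) embedded_ideal_def conic_form_def)
  show ?thesis
    unfolding colon even Q Q_gens[symmetric] polar J
    unfolding R I P detC
    using minimal_part_polar minors_ideal_C_radical minors_ideal_C_eq embedded_primes_polar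
      polar_algebraically_independent polar_maximal_linear_rank homaloidal_cubic
    by blast
qed

end
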